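(* Let $\Bbbk$ be a field and $H\subseteq G$ finite groups. Then the induction functor $\mathrm{Ind}_H^G$ induces a separable Frobenius monoidal functor $$\mathcal Z(\mathrm{Ind}_H^G)\colon\mathcal Z(\mathrm{Rep}_\Bbbk H)\longrightarrow\mathcal Z(\mathrm{Rep}_\Bbbk G).$$ Its lax and oplax monoidal structures $\mu,\delta$ are compatible with the braidings $\Psi$ in the sense that for all objects $V,W$ of $\mathcal Z(\mathrm{Rep}_\Bbbk H)$ $$\delta_{W,V}\circ\mathrm{Ind}_H^G(\Psi_{V,W})=\Psi_{\mathrm{Ind}_H^G(V),\mathrm{Ind}_H^G(W)}\circ\delta_{V,W},\qquad \mathrm{Ind}_H^G(\Psi_{V,W})\circ\mu_{V,W}=\mu_{W,V}\circ\Psi_{\mathrm{Ind}_H^G(V),\mathrm{Ind}_H^G(W)}.$$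
   Context: $\mathrm{Rep}_\Bbbk G$ is the category of finite-dimensional $G$-representations over $\Bbbk$. The monoidal center $\mathcal Z(\mathrm{Rep}_\Bbbk G)$ is identified, as a braided monoidal category, with Yetter--Drinfeld modules: $G$-graded $G$-representations $V=\bigoplus_{g\in G}V_g$ with $g\cdot V_h=V_{ghg^{-1}}$; $|v|$ denotes the degree of a homogeneous $v$; the half-braiding is $c_M(v\otimes m)=|v|m\otimes v$ for $M\in\mathrm{Rep}_\Bbbk G$, and the braiding is $\Psi_{V,W}(v\otimes w)=|v|w\otimes v$. On objects, $\mathcal Z(\mathrm{Ind}_H^G)$ sends a Yetter--Drinfeld module $V$ over $H$ to $\mathrm{Ind}_H^G(V)=\Bbbk G\otimes_{\Bbbk H}V$ with grading $|g\otimes v|=g|v|g^{-1}$ (where $|v|\in H\subseteq G$); on morphisms it is $\mathrm{Ind}_H^G$. The lax and oplax monoidal structures are those obtained from $\mathrm{Ind}_H^G$ being right and left adjoint to the monoidal functor $\mathrm{Res}_H^G$; for instance $\delta_{V,W}(g\otimes(v\otimes w))=(g\otimes v)\otimes(g\otimes w)$, and $\mu_{V,W}((g\otimes v)\otimes(k\otimes w))=g\otimes(v\otimes g^{-1}kw)$ if $g^{-1}k\in H$ and $0$ otherwise. A Frobenius monoidal functor $F\colon\mathcal C\to\mathcal D$ is a functor with a lax monoidal structure $(\mu_{V,W}\colon F(V)\otimes F(W)\to F(V\otimes W),\ \eta\colon\mathbf1\to F(\mathbf1))$ and an oplax monoidal structure $(\delta_{V,W}\colon F(V\otimes W)\to F(V)\otimes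 F(W),\ \epsilon\colon F(\mathbf1)\to\mathbf1)$ such that for all $V,W,U$: $(\mu_{V,W}\otimes\mathrm{id}_{F(U)})(\mathrm{id}_{F(V)}\otimes\delta_{W,U})=\delta_{V\otimes W,U}\,\mu_{V,W\otimes U}$ and $(\mathrm{id}_{F(V)}\otimes\mu_{W,U})(\delta_{V,W}\otimes\mathrm{id}_{F(U)})=\delta_{V,W\otimes U}\,\mu_{V\otimes W,U}$. It is separable if $\mu_{V,W}\circ\delta_{V,W}=\mathrm{id}_{F(V\otimes W)}$ for all $V,W$. *)

theory Defs
  imports "HOL-Algebra.Module" "HOL-Algebra.Left_Coset"
begin

section \<open>Monoidal categories and Frobenius monoidal functors\<close>

record ('o, 'a) category =
  Obj :: "'o set"
  Arr :: "'a set"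
  Dom :: "'a \<Rightarrow> 'o"
  Cod :: "'a \<Rightarrow> 'o"
  Ident :: "'o \<Rightarrow> 'a"
  Comp :: "'a \<Rightarrow> 'a \<Rightarrow> 'a"  (infixl "\<cdot>\<index>" 70)

definition Hom :: "('o, 'a, 'z) category_scheme \<Rightarrow> 'o \<Rightarrow> 'o \<Rightarrow> 'a set" where
  "Hom C X Y = {f \<in> Arr C. Dom C f = X \<and> Cod C f = Y}"

definition inverse_arrows :: "('o, 'a, 'z) category_scheme \<Rightarrow> 'a \<Rightarrow> 'a \<Rightarrow> bool" where
  "inverse_arrows C f g \<longleftrightarrow> f \<in> Hom C (Dom C f) (Cod C f) \<and> g \<in> Hom C (Cod C f) (Dom C f)
     \<and> g \<cdot>\<^bsub>C\<^esub> f = Ident C (Dom C f) \<and> f \<cdot>\<^bsub>C\<^esub> g = Ident C (Cod C f)"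

definition iso_arrow :: "('o, 'a, 'z) category_scheme \<Rightarrow> 'a \<Rightarrow> bool" where
  "iso_arrow C f \<longleftrightarrow> (\<exists>g. inverse_arrows C f g)"

definition inv_arrow :: "('o, 'a, 'z) category_scheme \<Rightarrow> 'a \<Rightarrow> 'a" where
  "inv_arrow C f = (THE g. inverse_arrows C f g)"

locale category = fixes C (structure)
  assumes dom_in_Obj: "f \<in> Arr C \<Longrightarrow> Dom C f \<in> Obj C"
    and cod_in_Obj: "f \<in> Arr C \<Longrightarrow> Cod C f \<in> Obj C"
    and ident_in_Hom: "X \<in> Obj C \<Longrightarrow> Ident C X \<in> Hom C X X"
    and comp_in_Hom: "\<lbrakk>f \<in> Hom C X Y; g \<in> Hom C Y Z\<rbrakk> \<Longrightarrow> g \<cdot> f \<in> Hom C X Z"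
    and comp_ident: "f \<in> Hom C X Y \<Longrightarrow> f \<cdot> Ident C X = f"
    and ident_comp: "f \<in> Hom C X Y \<Longrightarrow> Ident C Y \<cdot> f = f"
    and comp_assoc: "\<lbrakk>f \<in> Hom C X Y; g \<in> Hom C Y Z; h \<in> Hom C Z W\<rbrakk>
      \<Longrightarrow> h \<cdot> (g \<cdot> f) = (h \<cdot> g) \<cdot> f"

record ('o, 'a) monoidal_category = "('o, 'a) category" +
  TenO :: "'o \<Rightarrow> 'o \<Rightarrow> 'o"  (infixl "\<boxdot>\<index>" 75)
  TenA :: "'a \<Rightarrow> 'a \<Rightarrow> 'a"  (infixl "\<boxtimes>\<index>" 75)
  UnitO :: 'o
  Assoc :: "'o \<Rightarrow> 'o \<Rightarrow> 'o \<Rightarrow> 'a"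
  LUnit :: "'o \<Rightarrow> 'a"
  RUnit :: "'o \<Rightarrow> 'a"

locale monoidal_category = category C for C (structure) +
  assumes ten_in_Obj: "\<lbrakk>X \<in> Obj C; Y \<in> Obj C\<rbrakk> \<Longrightarrow> X \<boxdot> Y \<in> Obj C"
    and ten_in_Hom: "\<lbrakk>f \<in> Hom C X X'; g \<in> Hom C Y Y'\<rbrakk> \<Longrightarrow> f \<boxtimes> g \<in> Hom C (X \<boxdot> Y) (X' \<boxdot> Y')"
    and ten_ident: "\<lbrakk>X \<in> Obj C; Y \<in> Obj C\<rbrakk> \<Longrightarrow> Ident C X \<boxtimes> Ident C Y = Ident C (X \<boxdot> Y)"
    and ten_comp: "\<lbrakk>f \<in> Hom C X X'; f' \<in> Hom C X' X''; g \<in> Hom C Y Y'; g' \<in> Hom C Y' Y''\<rbrakk>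
      \<Longrightarrow> (f' \<cdot> f) \<boxtimes> (g' \<cdot> g) = (f' \<boxtimes> g') \<cdot> (f \<boxtimes> g)"
    and unit_in_Obj: "UnitO C \<in> Obj C"
    and assoc_in_Hom: "\<lbrakk>X \<in> Obj C; Y \<in> Obj C; Z \<in> Obj C\<rbrakk>
      \<Longrightarrow> Assoc C X Y Z \<in> Hom C ((X \<boxdot> Y) \<boxdot> Z) (X \<boxdot> (Y \<boxdot> Z))"
    and assoc_iso: "\<lbrakk>X \<in> Obj C; Y \<in> Obj C; Z \<in> Obj C\<rbrakk> \<Longrightarrow> iso_arrow C (Assoc C X Y Z)"
    and assoc_natural: "\<lbrakk>f \<in> Hom C X X'; g \<in> Hom C Y Y'; h \<in> Hom C Z Z'\<rbrakk>
      \<Longrightarrow> Assoc C X' Y' Z' \<cdot> ((f \<boxtimes> g) \<boxtimes> h) = (f \<boxtimes> (g \<boxtimes> h)) \<cdot> Assoc C X Y Z"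
    and lunit_in_Hom: "X \<in> Obj C \<Longrightarrow> LUnit C X \<in> Hom C (UnitO C \<boxdot> X) X"
    and lunit_iso: "X \<in> Obj C \<Longrightarrow> iso_arrow C (LUnit C X)"
    and lunit_natural: "f \<in> Hom C X Y \<Longrightarrow> LUnit C Y \<cdot> (Ident C (UnitO C) \<boxtimes> f) = f \<cdot> LUnit C X"
    and runit_in_Hom: "X \<in> Obj C \<Longrightarrow> RUnit C X \<in> Hom C (X \<boxdot> UnitO C) X"
    and runit_iso: "X \<in> Obj C \<Longrightarrow> iso_arrow C (RUnit C X)"
    and runit_natural: "f \<in> Hom C X Y \<Longrightarrow> RUnit C Y \<cdot> (f \<boxtimes> Ident C (UnitO C)) = f \<cdot> RUnit C X"
    and pentagon: "\<lbrakk>W \<in> Obj C; X \<in> Obj C; Y \<in> Obj C; Z \<in> Obj C\<rbrakk>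
      \<Longrightarrow> Assoc C W X (Y \<boxdot> Z) \<cdot> Assoc C (W \<boxdot> X) Y Z
        = (Ident C W \<boxtimes> Assoc C X Y Z) \<cdot> Assoc C W (X \<boxdot> Y) Z \<cdot> (Assoc C W X Y \<boxtimes> Ident C Z)"
    and triangle: "\<lbrakk>X \<in> Obj C; Y \<in> Obj C\<rbrakk>
      \<Longrightarrow> (Ident C X \<boxtimes> LUnit C Y) \<cdot> Assoc C X (UnitO C) Y = RUnit C X \<boxtimes> Ident C Y"

locale category_functor = C: category C + D: category D for C and D +
  fixes FO :: "'o1 \<Rightarrow> 'o2" and FA :: "'a1 \<Rightarrow> 'a2"
  assumes FO_in_Obj: "X \<in> Obj C \<Longrightarrow> FO X \<in> Obj D"
    and FA_in_Hom: "f \<in> Hom C X Y \<Longrightarrow> FA f \<in> Hom D (FO X) (FO Y)"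
    and FA_ident: "X \<in> Obj C \<Longrightarrow> FA (Ident C X) = Ident D (FO X)"
    and FA_comp: "\<lbrakk>f \<in> Hom C X Y; g \<in> Hom C Y Z\<rbrakk> \<Longrightarrow> FA (g \<cdot>\<^bsub>C\<^esub> f) = FA g \<cdot>\<^bsub>D\<^esub> FA f"

locale lax_monoidal_functor =
  C: monoidal_category C + D: monoidal_category D + category_functor C D FO FA
  for C and D and FO :: "'o1 \<Rightarrow> 'o2" and FA :: "'a1 \<Rightarrow> 'a2" +
  fixes mu :: "'o1 \<Rightarrow> 'o1 \<Rightarrow> 'a2" and eta :: 'a2
  assumes mu_in_Hom: "\<lbrakk>X \<in> Obj C; Y \<in> Obj C\<rbrakk>
      \<Longrightarrow> mu X Y \<in> Hom D (FO X \<boxdot>\<^bsub>D\<^esub> FO Y) (FO (X \<boxdot>\<^bsub>C\<^esub> Y))"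
    and mu_natural: "\<lbrakk>f \<in> Hom C X X'; g \<in> Hom C Y Y'\<rbrakk>
      \<Longrightarrow> mu X' Y' \<cdot>\<^bsub>D\<^esub> (FA f \<boxtimes>\<^bsub>D\<^esub> FA g) = FA (f \<boxtimes>\<^bsub>C\<^esub> g) \<cdot>\<^bsub>D\<^esub> mu X Y"
    and eta_in_Hom: "eta \<in> Hom D (UnitO D) (FO (UnitO C))"
    and mu_assoc: "\<lbrakk>X \<in> Obj C; Y \<in> Obj C; Z \<in> Obj C\<rbrakk>
      \<Longrightarrow> FA (Assoc C X Y Z) \<cdot>\<^bsub>D\<^esub> mu (X \<boxdot>\<^bsub>C\<^esub> Y) Z \<cdot>\<^bsub>D\<^esub> (mu X Y \<boxtimes>\<^bsub>D\<^esub> Ident D (FO Z))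
        = mu X (Y \<boxdot>\<^bsub>C\<^esub> Z) \<cdot>\<^bsub>D\<^esub> (Ident D (FO X) \<boxtimes>\<^bsub>D\<^esub> mu Y Z) \<cdot>\<^bsub>D\<^esub> Assoc D (FO X) (FO Y) (FO Z)"
    and mu_eta_left: "X \<in> Obj C
      \<Longrightarrow> FA (LUnit C X) \<cdot>\<^bsub>D\<^esub> mu (UnitO C) X \<cdot>\<^bsub>D\<^esub> (eta \<boxtimes>\<^bsub>D\<^esub> Ident D (FO X)) = LUnit D (FO X)"
    and mu_eta_right: "X \<in> Obj C
      \<Longrightarrow> FA (RUnit C X) \<cdot>\<^bsub>D\<^esub> mu X (UnitO C) \<cdot>\<^bsub>D\<^esub> (Ident D (FO X) \<boxtimes>\<^bsub>D\<^esub> eta) = RUnit D (FO X)"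

locale oplax_monoidal_functor =
  C: monoidal_category C + D: monoidal_category D + category_functor C D FO FA
  for C and D and FO :: "'o1 \<Rightarrow> 'o2" and FA :: "'a1 \<Rightarrow> 'a2" +
  fixes delta :: "'o1 \<Rightarrow> 'o1 \<Rightarrow> 'a2" and eps :: 'a2
  assumes delta_in_Hom: "\<lbrakk>X \<in> Obj C; Y \<in> Obj C\<rbrakk>
      \<Longrightarrow> delta X Y \<in> Hom D (FO (X \<boxdot>\<^bsub>C\<^esub> Y)) (FO X \<boxdot>\<^bsub>D\<^esub> FO Y)"
    and delta_natural: "\<lbrakk>f \<in> Hom C X X'; g \<in> Hom C Y Y'\<rbrakk>
      \<Longrightarrow> delta X' Y' \<cdot>\<^bsub>D\<^esub> FA (f \<boxtimes>\<^bsub>C\<^esub> g) = (FA f \<boxtimes>\<^bsub>D\<^esub> FA g) \<cdot>\<^bsub>D\<^esub> delta X Y"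
    and eps_in_Hom: "eps \<in> Hom D (FO (UnitO C)) (UnitO D)"
    and delta_assoc: "\<lbrakk>X \<in> Obj C; Y \<in> Obj C; Z \<in> Obj C\<rbrakk>
      \<Longrightarrow> Assoc D (FO X) (FO Y) (FO Z) \<cdot>\<^bsub>D\<^esub> (delta X Y \<boxtimes>\<^bsub>D\<^esub> Ident D (FO Z)) \<cdot>\<^bsub>D\<^esub> delta (X \<boxdot>\<^bsub>C\<^esub> Y) Z
        = (Ident D (FO X) \<boxtimes>\<^bsub>D\<^esub> delta Y Z) \<cdot>\<^bsub>D\<^esub> delta X (Y \<boxdot>\<^bsub>C\<^esub> Z) \<cdot>\<^bsub>D\<^esub> FA (Assoc C X Y Z)"
    and delta_eps_left: "X \<in> Obj C
      \<Longrightarrow> LUnit D (FO X) \<cdot>\<^bsub>D\<^esub> (eps \<boxtimes>\<^bsub>D\<^esub> Ident D (FO X)) \<cdot>\<^bsub>D\<^esub> delta (UnitO C) X = FA (LUnit C X)"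
    and delta_eps_right: "X \<in> Obj C
      \<Longrightarrow> RUnit D (FO X) \<cdot>\<^bsub>D\<^esub> (Ident D (FO X) \<boxtimes>\<^bsub>D\<^esub> eps) \<cdot>\<^bsub>D\<^esub> delta X (UnitO C) = FA (RUnit C X)"

text \<open>The Frobenius conditions are usually written for strict monoidal categories; here the
  associators are inserted.\<close>

locale frobenius_monoidal_functor =
  lax_monoidal_functor C D FO FA mu eta + oplax_monoidal_functor C D FO FA delta eps
  for C and D and FO :: "'o1 \<Rightarrow> 'o2" and FA :: "'a1 \<Rightarrow> 'a2" and mu eta delta eps +
  assumes frobenius1: "\<lbrakk>V \<in> Obj C; W \<in> Obj C; U \<in> Obj C\<rbrakk>
      \<Longrightarrow> (mu V W \<boxtimes>\<^bsub>D\<^esub> Ident D (FO U)) \<cdot>\<^bsub>D\<^esub> inv_arrow D (Assoc D (FO V) (FO W) (FO U))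
            \<cdot>\<^bsub>D\<^esub> (Ident D (FO V) \<boxtimes>\<^bsub>D\<^esub> delta W U)
        = delta (V \<boxdot>\<^bsub>C\<^esub> W) U \<cdot>\<^bsub>D\<^esub> FA (inv_arrow C (Assoc C V W U)) \<cdot>\<^bsub>D\<^esub> mu V (W \<boxdot>\<^bsub>C\<^esub> U)"
    and frobenius2: "\<lbrakk>V \<in> Obj C; W \<in> Obj C; U \<in> Obj C\<rbrakk>
      \<Longrightarrow> (Ident D (FO V) \<boxtimes>\<^bsub>D\<^esub> mu W U) \<cdot>\<^bsub>D\<^esub> Assoc D (FO V) (FO W) (FO U)
            \<cdot>\<^bsub>D\<^esub> (delta V W \<boxtimes>\<^bsub>D\<^esub> Ident D (FO U))
        = delta V (W \<boxdot>\<^bsub>C\<^esub> U) \<cdot>\<^bsub>D\<^esub> FA (Assoc C V W U) \<cdot>\<^bsub>D\<^esub> mu (V \<boxdot>\<^bsub>C\<^esub> W) U"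

locale separable_frobenius_monoidal_functor = frobenius_monoidal_functor +
  assumes separable: "\<lbrakk>V \<in> Obj C; W \<in> Obj C\<rbrakk>
    \<Longrightarrow> mu V W \<cdot>\<^bsub>D\<^esub> delta V W = Ident D (FO (V \<boxdot>\<^bsub>C\<^esub> W))"


section \<open>Vectors and balanced tensor products\<close>

text \<open>A type of vectors that is closed under tensor products and induction, so that all
  representations under consideration form one category.  A representation is carried by a subset
  of this type: \<open>Atom\<close> embeds an arbitrary type, \<open>Scalar\<close> the base field, \<open>Fun\<close> the functions on
  the group (for the group algebra), and \<open>Formal\<close> the formal sums
  \<open>m\<^sub>1 \<otimes> n\<^sub>1 + \<dots> + m\<^sub>r \<otimes> n\<^sub>r\<close>.\<close>

datatype ('g, 'k, 'x) vec =
    Atom 'x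
  | Scalar (scalar: 'k)
  | Fun (coeff: "'g \<Rightarrow> 'k")
  | Formal (terms: "(('g, 'k, 'x) vec \<times> ('g, 'k, 'x) vec) list")

text \<open>The tensor product of \<open>M\<close> and \<open>N\<close> balanced over \<open>S\<close>, which acts on \<open>M\<close> from the right by \<open>r\<close>
  and on \<open>N\<close> from the left by \<open>l\<close>: the relation below is the congruence on formal sums for which
  the quotient is the commutative monoid generated by the \<open>m \<otimes> n\<close> subject to biadditivity and
  \<open>(m s) \<otimes> n = m \<otimes> (s n)\<close>.  By \<open>zero\<close> and \<open>add_left\<close>, \<open>(- m) \<otimes> n\<close> is the inverse of \<open>m \<otimes> n\<close>,
  hence this monoid is the usual abelian group.\<close>

inductive balanced_eq ::
    "('v, 'p) ring_scheme \<Rightarrow> ('v, 'q) ring_scheme \<Rightarrow> 's set \<Rightarrow> ('v \<Rightarrow> 's \<Rightarrow> 'v) \<Rightarrow> ('s \<Rightarrow> 'v \<Rightarrow> 'v)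
      \<Rightarrow> ('v \<times> 'v) list \<Rightarrow> ('v \<times> 'v) list \<Rightarrow> bool"
  for M N S r l where
    refl: "xs \<in> lists (carrier M \<times> carrier N) \<Longrightarrow> balanced_eq M N S r l xs xs"
  | sym: "balanced_eq M N S r l xs ys \<Longrightarrow> balanced_eq M N S r l ys xs"
  | trans: "\<lbrakk>balanced_eq M N S r l xs ys; balanced_eq M N S r l ys zs\<rbrakk>
      \<Longrightarrow> balanced_eq M N S r l xs zs"
  | append: "\<lbrakk>balanced_eq M N S r l xs xs'; balanced_eq M N S r l ys ys'\<rbrakk>
      \<Longrightarrow> balanced_eq M N S r l (xs @ ys) (xs' @ ys')"
  | commute: "\<lbrakk>xs \<in> lists (carrier M \<times> carrier N); ys \<in> lists (carrier M \<times> carrier N)\<rbrakk>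
      \<Longrightarrow> balanced_eq M N S r l (xs @ ys) (ys @ xs)"
  | zero: "n \<in> carrier N \<Longrightarrow> balanced_eq M N S r l [(\<zero>\<^bsub>M\<^esub>, n)] []"
  | add_left: "\<lbrakk>m \<in> carrier M; m' \<in> carrier M; n \<in> carrier N\<rbrakk>
      \<Longrightarrow> balanced_eq M N S r l [(m \<oplus>\<^bsub>M\<^esub> m', n)] [(m, n), (m', n)]"
  | add_right: "\<lbrakk>m \<in> carrier M; n \<in> carrier N; n' \<in> carrier N\<rbrakk>
      \<Longrightarrow> balanced_eq M N S r l [(m, n \<oplus>\<^bsub>N\<^esub> n')] [(m, n), (m, n')]"
  | balance: "\<lbrakk>m \<in> carrier M; s \<in> S; n \<in> carrier N\<rbrakk>
      \<Longrightarrow> balanced_eq M N S r l [(r m s, n)] [(m, l s n)]"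

text \<open>The class of a formal sum, encoded by a chosen representative: two formal sums have the
  same encoding iff they are related.\<close>

definition formal_class ::
    "((('g, 'k, 'x) vec \<times> ('g, 'k, 'x) vec) list \<Rightarrow> (('g, 'k, 'x) vec \<times> ('g, 'k, 'x) vec) list \<Rightarrow> bool)
      \<Rightarrow> (('g, 'k, 'x) vec \<times> ('g, 'k, 'x) vec) list \<Rightarrow> ('g, 'k, 'x) vec" where
  "formal_class E xs = Formal (SOME ys. E xs ys)"

text \<open>The extension to a tensor product of the balanced map \<open>(m, n) \<mapsto> \<phi> m n\<close> with values in \<open>T\<close>.\<close>

definition lift ::
    "('v, 'p) ring_scheme \<Rightarrow> (('g, 'k, 'x) vec \<Rightarrow> ('g, 'k, 'x) vec \<Rightarrow> 'v) \<Rightarrow> ('g, 'k, 'x) vec \<Rightarrow> 'v" where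
  "lift T \<phi> x = foldr (\<lambda>(m, n) y. \<phi> m n \<oplus>\<^bsub>T\<^esub> y) (terms x) \<zero>\<^bsub>T\<^esub>"


section \<open>Representations and Yetter--Drinfeld modules\<close>

text \<open>As in \<^typ>\<open>('k, 'v) module\<close>, the fields \<^const>\<open>mult\<close> and \<^const>\<open>one\<close> carry no meaning for
  representations.\<close>

record ('k, 'v, 'g) rep = "('k, 'v) module" +
  act :: "'g \<Rightarrow> 'v \<Rightarrow> 'v"

record ('k, 'v, 'g) yd = "('k, 'v, 'g) rep" +
  grade :: "'g \<Rightarrow> 'v set"

definition finite_dim :: "('k, 'r) ring_scheme \<Rightarrow> ('k, 'v, 'm) module_scheme \<Rightarrow> bool" where
  "finite_dim K V \<longleftrightarrow> (\<exists>B. finite B \<and> B \<subseteq> carrier V \<and>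
     (\<forall>v \<in> carrier V. \<exists>c \<in> B \<rightarrow> carrier K. v = (\<Oplus>\<^bsub>V\<^esub>b\<in>B. c b \<odot>\<^bsub>V\<^esub> b)))"

definition linear_maps ::
    "('k, 'r) ring_scheme \<Rightarrow> ('k, 'v, 'm) module_scheme \<Rightarrow> ('k, 'w, 'n) module_scheme \<Rightarrow> ('v \<Rightarrow> 'w) set" where
  "linear_maps K V W = {f \<in> carrier V \<rightarrow> carrier W.
     (\<forall>x \<in> carrier V. \<forall>y \<in> carrier V. f (x \<oplus>\<^bsub>V\<^esub> y) = f x \<oplus>\<^bsub>W\<^esub> f y) \<and>
     (\<forall>c \<in> carrier K. \<forall>x \<in> carrier V. f (c \<odot>\<^bsub>V\<^esub> x) = c \<odot>\<^bsub>W\<^esub> f x)}"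

definition representation ::
    "('k, 'r) ring_scheme \<Rightarrow> ('g, 'm) monoid_scheme \<Rightarrow> ('k, 'v, 'g, 'n) rep_scheme \<Rightarrow> bool" where
  "representation K G V \<longleftrightarrow> module K V \<and> finite_dim K V \<and>
     (\<forall>g \<in> carrier G. act V g \<in> linear_maps K V V) \<and>
     (\<forall>v \<in> carrier V. act V \<one>\<^bsub>G\<^esub> v = v) \<and>
     (\<forall>g \<in> carrier G. \<forall>h \<in> carrier G. \<forall>v \<in> carrier V.
        act V (g \<otimes>\<^bsub>G\<^esub> h) v = act V g (act V h v))"

definition decomposition ::
    "('g, 'm) monoid_scheme \<Rightarrow> ('k, 'v, 'g, 'n) yd_scheme \<Rightarrow> 'v \<Rightarrow> ('g \<Rightarrow> 'v) \<Rightarrow> bool" where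
  "decomposition G V v f \<longleftrightarrow>
     f \<in> (\<Pi>\<^sub>E g\<in>carrier G. grade V g) \<and> v = (\<Oplus>\<^bsub>V\<^esub>g\<in>carrier G. f g)"

definition component ::
    "('g, 'm) monoid_scheme \<Rightarrow> ('k, 'v, 'g, 'n) yd_scheme \<Rightarrow> 'v \<Rightarrow> 'g \<Rightarrow> 'v" where
  "component G V v = (THE f. decomposition G V v f)"

definition yetter_drinfeld ::
    "('k, 'r) ring_scheme \<Rightarrow> ('g, 'm) monoid_scheme \<Rightarrow> ('k, 'v, 'g, 'n) yd_scheme \<Rightarrow> bool" where
  "yetter_drinfeld K G V \<longleftrightarrow> representation K G V \<and>
     (\<forall>g \<in> carrier G. submodule (grade V g) K V) \<and>
     (\<forall>v \<in> carrier V. \<exists>!f. decomposition G V v f) \<and>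
     (\<forall>g \<in> carrier G. \<forall>h \<in> carrier G.
        act V g ` grade V h = grade V (g \<otimes>\<^bsub>G\<^esub> h \<otimes>\<^bsub>G\<^esub> inv\<^bsub>G\<^esub> g))"

definition yd_maps ::
    "('k, 'r) ring_scheme \<Rightarrow> ('g, 'm) monoid_scheme \<Rightarrow> ('k, 'v, 'g, 'n) yd_scheme
      \<Rightarrow> ('k, 'v, 'g, 'n) yd_scheme \<Rightarrow> ('v \<Rightarrow> 'v) set" where
  "yd_maps K G V W = {f \<in> linear_maps K V W.
     (\<forall>g \<in> carrier G. \<forall>v \<in> carrier V. f (act V g v) = act W g (f v)) \<and>
     (\<forall>g \<in> carrier G. f ` grade V g \<subseteq> grade W g)}"

record ('o, 'v) arrow =
  src :: 'o
  tgt :: 'o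
  fn :: "'v \<Rightarrow> 'v"

type_synonym ('g, 'k, 'x) ydo = "('k, ('g, 'k, 'x) vec, 'g) yd"
type_synonym ('g, 'k, 'x) yda = "(('g, 'k, 'x) ydo, ('g, 'k, 'x) vec) arrow"
type_synonym ('g, 'k, 'x) yd_category = "(('g, 'k, 'x) ydo, ('g, 'k, 'x) yda) monoidal_category"

definition arrow_of ::
    "('g, 'k, 'x) ydo \<Rightarrow> ('g, 'k, 'x) ydo \<Rightarrow> (('g, 'k, 'x) vec \<Rightarrow> ('g, 'k, 'x) vec) \<Rightarrow> ('g, 'k, 'x) yda" where
  "arrow_of V W \<phi> = \<lparr>src = V, tgt = W, fn = restrict \<phi> (carrier V)\<rparr>"


section \<open>The monoidal category of Yetter--Drinfeld modules\<close>

definition tensor_class where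
  "tensor_class K V W =
     formal_class (balanced_eq V W (carrier K) (\<lambda>v c. c \<odot>\<^bsub>V\<^esub> v) (\<lambda>c w. c \<odot>\<^bsub>W\<^esub> w))"

definition pure where
  "pure K V W v w = tensor_class K V W [(v, w)]"

definition tensor_rep ::
    "('k, 'r) ring_scheme \<Rightarrow> ('k, ('g, 'k, 'x) vec, 'g, 'm) rep_scheme
      \<Rightarrow> ('k, ('g, 'k, 'x) vec, 'g, 'n) rep_scheme \<Rightarrow> ('k, ('g, 'k, 'x) vec, 'g) rep" where
  "tensor_rep K V W =
     \<lparr>carrier = tensor_class K V W ` lists (carrier V \<times> carrier W),
      mult = undefined, one = undefined,
      zero = tensor_class K V W [],
      add = (\<lambda>x y. tensor_class K V W (terms x @ terms y)),
      smult = (\<lambda>c x. tensor_class K V W (map (\<lambda>(v, w). (c \<odot>\<^bsub>V\<^esub> v, w)) (terms x))),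
      act = (\<lambda>g x. tensor_class K V W (map (\<lambda>(v, w). (act V g v, act W g w)) (terms x)))\<rparr>"

definition tensor_yd ::
    "('k, 'r) ring_scheme \<Rightarrow> ('g, 'm) monoid_scheme
      \<Rightarrow> ('g, 'k, 'x) ydo \<Rightarrow> ('g, 'k, 'x) ydo \<Rightarrow> ('g, 'k, 'x) ydo" where
  "tensor_yd K G V W = rep.extend (tensor_rep K V W) (yd.fields
     (\<lambda>x. tensor_class K V W ` lists {(v, w) | v w g h. g \<in> carrier G \<and> h \<in> carrier G
        \<and> v \<in> grade V g \<and> w \<in> grade W h \<and> g \<otimes>\<^bsub>G\<^esub> h = x}))"

definition unit_yd ::
    "('k, 'r) ring_scheme \<Rightarrow> ('g, 'm) monoid_scheme \<Rightarrow> ('g, 'k, 'x) ydo" where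
  "unit_yd K G =
     \<lparr>carrier = Scalar ` carrier K,
      mult = undefined, one = undefined,
      zero = Scalar \<zero>\<^bsub>K\<^esub>,
      add = (\<lambda>x y. Scalar (scalar x \<oplus>\<^bsub>K\<^esub> scalar y)),
      smult = (\<lambda>c x. Scalar (c \<otimes>\<^bsub>K\<^esub> scalar x)),
      act = (\<lambda>g x. x),
      grade = (\<lambda>g. if g = \<one>\<^bsub>G\<^esub> then Scalar ` carrier K else {Scalar \<zero>\<^bsub>K\<^esub>})\<rparr>"

definition tensor_arrow ::
    "('k, 'r) ring_scheme \<Rightarrow> ('g, 'm) monoid_scheme
      \<Rightarrow> ('g, 'k, 'x) yda \<Rightarrow> ('g, 'k, 'x) yda \<Rightarrow> ('g, 'k, 'x) yda" where
  "tensor_arrow K G f f' = (let T = tensor_yd K G (tgt f) (tgt f') in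
     arrow_of (tensor_yd K G (src f) (src f')) T
       (lift T (\<lambda>v w. pure K (tgt f) (tgt f') (fn f v) (fn f' w))))"

definition assoc_yd ::
    "('k, 'r) ring_scheme \<Rightarrow> ('g, 'm) monoid_scheme
      \<Rightarrow> ('g, 'k, 'x) ydo \<Rightarrow> ('g, 'k, 'x) ydo \<Rightarrow> ('g, 'k, 'x) ydo \<Rightarrow> ('g, 'k, 'x) yda" where
  "assoc_yd K G V W U = (let T = tensor_yd K G V (tensor_yd K G W U) in
     arrow_of (tensor_yd K G (tensor_yd K G V W) U) T
       (lift T (\<lambda>x u. lift T (\<lambda>v w. pure K V (tensor_yd K G W U) v (pure K W U w u)) x)))"

definition YD :: "('k, 'r) ring_scheme \<Rightarrow> ('g, 'm) monoid_scheme \<Rightarrow> ('g, 'k, 'x) yd_category" where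
  "YD K G =
     \<lparr>Obj = {V. yetter_drinfeld K G V},
      Arr = {arrow_of V W f | V W f.
        yetter_drinfeld K G V \<and> yetter_drinfeld K G W \<and> f \<in> yd_maps K G V W},
      Dom = src, Cod = tgt,
      Ident = (\<lambda>V. arrow_of V V (\<lambda>v. v)),
      Comp = (\<lambda>f' f. arrow_of (src f) (tgt f') (\<lambda>v. fn f' (fn f v))),
      TenO = tensor_yd K G,
      TenA = tensor_arrow K G,
      UnitO = unit_yd K G,
      Assoc = assoc_yd K G,
      LUnit = (\<lambda>V. arrow_of (tensor_yd K G (unit_yd K G) V) V (lift V (\<lambda>c v. scalar c \<odot>\<^bsub>V\<^esub> v))),
      RUnit = (\<lambda>V. arrow_of (tensor_yd K G V (unit_yd K G)) V (lift V (\<lambda>v c. scalar c \<odot>\<^bsub>V\<^esub> v)))\<rparr>"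

text \<open>The braiding \<open>v \<otimes> w \<mapsto> |v| w \<otimes> v\<close> for homogeneous \<open>v\<close>, extended linearly by decomposing an
  arbitrary \<open>v\<close> into its homogeneous components.\<close>

definition braiding ::
    "('k, 'r) ring_scheme \<Rightarrow> ('g, 'm) monoid_scheme
      \<Rightarrow> ('g, 'k, 'x) ydo \<Rightarrow> ('g, 'k, 'x) ydo \<Rightarrow> ('g, 'k, 'x) yda" where
  "braiding K G V W = (let T = tensor_yd K G W V in
     arrow_of (tensor_yd K G V W) T
       (lift T (\<lambda>v w. \<Oplus>\<^bsub>T\<^esub>g\<in>carrier G. pure K W V (act W g w) (component G V v g))))"


section \<open>Induction\<close>

definition group_elem :: "('k, 'r) ring_scheme \<Rightarrow> 'g \<Rightarrow> ('g, 'k, 'x) vec" where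
  "group_elem K g = Fun (\<lambda>x. if x = g then \<one>\<^bsub>K\<^esub> else \<zero>\<^bsub>K\<^esub>)"

text \<open>Elements are functions extended by zero outside \<^term>\<open>carrier G\<close>, so that the group algebra of
  a subgroup is contained in that of the group.\<close>

definition group_algebra ::
    "('k, 'r) ring_scheme \<Rightarrow> ('g, 'm) monoid_scheme \<Rightarrow> ('k, ('g, 'k, 'x) vec) module" where
  "group_algebra K G =
     \<lparr>carrier = {Fun a | a. (\<forall>g \<in> carrier G. a g \<in> carrier K) \<and> (\<forall>g. g \<notin> carrier G \<longrightarrow> a g = \<zero>\<^bsub>K\<^esub>)},
      mult = (\<lambda>a b. Fun (\<lambda>x. if x \<in> carrier G
        then \<Oplus>\<^bsub>K\<^esub>y\<in>carrier G. coeff a y \<otimes>\<^bsub>K\<^esub> coeff b (inv\<^bsub>G\<^esub> y \<otimes>\<^bsub>G\<^esub> x) else \<zero>\<^bsub>K\<^esub>)),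
      one = group_elem K \<one>\<^bsub>G\<^esub>,
      zero = Fun (\<lambda>x. \<zero>\<^bsub>K\<^esub>),
      add = (\<lambda>a b. Fun (\<lambda>x. coeff a x \<oplus>\<^bsub>K\<^esub> coeff b x)),
      smult = (\<lambda>c a. Fun (\<lambda>x. c \<otimes>\<^bsub>K\<^esub> coeff a x))\<rparr>"

definition algebra_act ::
    "('g, 'm) monoid_scheme \<Rightarrow> ('k, ('g, 'k, 'x) vec, 'g, 'n) rep_scheme
      \<Rightarrow> ('g, 'k, 'x) vec \<Rightarrow> ('g, 'k, 'x) vec \<Rightarrow> ('g, 'k, 'x) vec" where
  "algebra_act G V a v = (\<Oplus>\<^bsub>V\<^esub>g\<in>carrier G. coeff a g \<odot>\<^bsub>V\<^esub> act V g v)"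

definition ind_class where
  "ind_class K G H V =
     formal_class (balanced_eq (group_algebra K G) V (carrier (group_algebra K (G\<lparr>carrier := H\<rparr>)))
       (\<lambda>a b. a \<otimes>\<^bsub>group_algebra K G\<^esub> b) (algebra_act (G\<lparr>carrier := H\<rparr>) V))"

definition ind_pure where
  "ind_pure K G H V g v = ind_class K G H V [(group_elem K g, v)]"

text \<open>The representation \<open>kG \<otimes>\<^bsub>kH\<^esub> V\<close> induced from a representation of the subgroup \<open>H\<close>.\<close>

definition ind_rep ::
    "('k, 'r) ring_scheme \<Rightarrow> ('g, 'm) monoid_scheme \<Rightarrow> 'g set
      \<Rightarrow> ('k, ('g, 'k, 'x) vec, 'g, 'n) rep_scheme \<Rightarrow> ('k, ('g, 'k, 'x) vec, 'g) rep" where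
  "ind_rep K G H V =
     \<lparr>carrier = ind_class K G H V ` lists (carrier (group_algebra K G) \<times> carrier V),
      mult = undefined, one = undefined,
      zero = ind_class K G H V [],
      add = (\<lambda>x y. ind_class K G H V (terms x @ terms y)),
      smult = (\<lambda>c x. ind_class K G H V
        (map (\<lambda>(a, v). (c \<odot>\<^bsub>group_algebra K G\<^esub> a, v)) (terms x))),
      act = (\<lambda>g x. ind_class K G H V
        (map (\<lambda>(a, v). (group_elem K g \<otimes>\<^bsub>group_algebra K G\<^esub> a, v)) (terms x)))\<rparr>"

text \<open>The homogeneous subspaces are spanned by the \<open>g \<otimes> v\<close>, of degree \<open>g |v| g\<^sup>-\<^sup>1\<close>.\<close>

definition ind_yd ::
    "('k, 'r) ring_scheme \<Rightarrow> ('g, 'm) monoid_scheme \<Rightarrow> 'g set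
      \<Rightarrow> ('g, 'k, 'x) ydo \<Rightarrow> ('g, 'k, 'x) ydo" where
  "ind_yd K G H V = rep.extend (ind_rep K G H V) (yd.fields
     (\<lambda>x. ind_class K G H V ` lists {(group_elem K g, v) | g v h. g \<in> carrier G \<and> h \<in> H
        \<and> v \<in> grade V h \<and> g \<otimes>\<^bsub>G\<^esub> h \<otimes>\<^bsub>G\<^esub> inv\<^bsub>G\<^esub> g = x}))"

definition ind_arrow ::
    "('k, 'r) ring_scheme \<Rightarrow> ('g, 'm) monoid_scheme \<Rightarrow> 'g set
      \<Rightarrow> ('g, 'k, 'x) yda \<Rightarrow> ('g, 'k, 'x) yda" where
  "ind_arrow K G H f = (let T = ind_yd K G H (tgt f) in
     arrow_of (ind_yd K G H (src f)) T
       (lift T (\<lambda>a v. ind_class K G H (tgt f) [(a, fn f v)])))"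

text \<open>The linear map on an induced representation given by \<open>g \<otimes> v \<mapsto> \<phi> g v\<close>.\<close>

definition ind_lift ::
    "('g, 'm) monoid_scheme \<Rightarrow> ('k, 'v, 'n) module_scheme
      \<Rightarrow> ('g \<Rightarrow> ('g, 'k, 'x) vec \<Rightarrow> 'v) \<Rightarrow> ('g, 'k, 'x) vec \<Rightarrow> 'v" where
  "ind_lift G T \<phi> = lift T (\<lambda>a v. \<Oplus>\<^bsub>T\<^esub>g\<in>carrier G. coeff a g \<odot>\<^bsub>T\<^esub> \<phi> g v)"

definition ind_delta ::
    "('k, 'r) ring_scheme \<Rightarrow> ('g, 'm) monoid_scheme \<Rightarrow> 'g set
      \<Rightarrow> ('g, 'k, 'x) ydo \<Rightarrow> ('g, 'k, 'x) ydo \<Rightarrow> ('g, 'k, 'x) yda" where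
  "ind_delta K G H V W =
    (let IV = ind_yd K G H V; IW = ind_yd K G H W; T = tensor_yd K G IV IW in
     arrow_of (ind_yd K G H (tensor_yd K (G\<lparr>carrier := H\<rparr>) V W)) T
       (ind_lift G T (\<lambda>g. lift T (\<lambda>v w.
          pure K IV IW (ind_pure K G H V g v) (ind_pure K G H W g w)))))"

definition ind_mu ::
    "('k, 'r) ring_scheme \<Rightarrow> ('g, 'm) monoid_scheme \<Rightarrow> 'g set
      \<Rightarrow> ('g, 'k, 'x) ydo \<Rightarrow> ('g, 'k, 'x) ydo \<Rightarrow> ('g, 'k, 'x) yda" where
  "ind_mu K G H V W =
    (let VW = tensor_yd K (G\<lparr>carrier := H\<rparr>) V W; T = ind_yd K G H VW in
     arrow_of (tensor_yd K G (ind_yd K G H V) (ind_yd K G H W)) T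
       (lift T (\<lambda>x y. ind_lift G T (\<lambda>g v. ind_lift G T (\<lambda>k w.
          if inv\<^bsub>G\<^esub> g \<otimes>\<^bsub>G\<^esub> k \<in> H
          then ind_pure K G H VW g (pure K V W v (act W (inv\<^bsub>G\<^esub> g \<otimes>\<^bsub>G\<^esub> k) w))
          else \<zero>\<^bsub>T\<^esub>) y) x)))"

text \<open>The counit at the trivial representation of the adjunction in which induction is left adjoint
  to restriction.\<close>

definition ind_eps ::
    "('k, 'r) ring_scheme \<Rightarrow> ('g, 'm) monoid_scheme \<Rightarrow> 'g set \<Rightarrow> ('g, 'k, 'x) yda" where
  "ind_eps K G H =
     arrow_of (ind_yd K G H (unit_yd K (G\<lparr>carrier := H\<rparr>))) (unit_yd K G)
       (ind_lift G (unit_yd K G) (\<lambda>g c. c))"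

text \<open>The unit at the trivial representation of the adjunction in which induction is right adjoint to
  restriction: \<open>1 \<mapsto> \<Sum> g \<otimes> 1\<close>, with \<open>g\<close> running over representatives of the left cosets of \<open>H\<close>.\<close>

definition ind_eta ::
    "('k, 'r) ring_scheme \<Rightarrow> ('g, 'm) monoid_scheme \<Rightarrow> 'g set \<Rightarrow> ('g, 'k, 'x) yda" where
  "ind_eta K G H =
    (let I = unit_yd K (G\<lparr>carrier := H\<rparr>); T = ind_yd K G H I in
     arrow_of (unit_yd K G) T
       (\<lambda>c. \<Oplus>\<^bsub>T\<^esub>X\<in>lcosets\<^bsub>G\<^esub> H. ind_pure K G H I (SOME g. g \<in> X) c))"

end

theory Submission
  imports Defs
begin

text \<open>
All objects in sight are generated, as abelian groups, by pure tensors \<open>v \<otimes> w\<close> and \<open>g \<otimes> v\<close>, and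
every structure map is additive. Each axiom of a Frobenius monoidal functor and each compatibility
with the braiding is therefore an identity between values on (iterated) pure tensors, which in the
case of the braiding may moreover be taken homogeneous. For instance,
both composites in the first Frobenius relation send \<open>(g \<otimes> v) \<otimes> (k \<otimes> (w \<otimes> u))\<close> to
\<open>(g \<otimes> (v \<otimes> h w)) \<otimes> (k \<otimes> u)\<close> if \<open>h = g\<^sup>-\<^sup>1 k\<close> lies in \<open>H\<close>, because then \<open>g \<otimes> h u = k \<otimes> u\<close>,
and to \<open>0\<close> otherwise. A tensor product or an induced module is a
Yetter--Drinfeld module because the projections onto the prospective homogeneous components are
well defined on it.
\<close>


section \<open>Additive spans\<close>

text \<open>A vector of a tensor product or induced module is a class of formal sums, encoded by a
  representative picked with \<open>SOME\<close>, and its scalar multiples and translates are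
  computed from that representative. Nothing can be said about them until the computation is
  recognised as the \<open>lift\<close> of a balanced map, so the universal property has to be
  proved for bare abelian groups, before any module structure exists. For the same reason generation
  means closure under addition alone: scalars are absorbed into an entry, as in (c v) \<otimes> w or
  g \<otimes> (c v), and negatives as in (- m) \<otimes> n. The second obstacle is iteration.
  Associator and multiplication are lifts inside lifts, so the inner argument is an arbitrary
  element on which no formula is available. Linearity in the outer argument is therefore read as an
  equality of linear maps in the inner one and tested there on generators
  (\<open>linear_param\<close>). Finally, preservation of degrees is a condition on subsets; it
  becomes an equation, and thus testable on generators, as commutation with the projections onto
  components (\<open>yd_mapsI\<close>).\<close>

inductive_set additive_span :: "('v, 'p) ring_scheme \<Rightarrow> 'v set \<Rightarrow> 'v set" for M A where
  zero: "\<zero>\<^bsub>M\<^esub> \<in> additive_span M A"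
| step: "\<lbrakk>a \<in> A; x \<in> additive_span M A\<rbrakk> \<Longrightarrow> a \<oplus>\<^bsub>M\<^esub> x \<in> additive_span M A"

definition generates :: "('v, 'p) ring_scheme \<Rightarrow> 'v set \<Rightarrow> bool" where
  "generates M A \<longleftrightarrow> A \<subseteq> carrier M \<and> carrier M \<subseteq> additive_span M A"

definition additive :: "('v, 'p) ring_scheme \<Rightarrow> ('w, 'q) ring_scheme \<Rightarrow> ('v \<Rightarrow> 'w) \<Rightarrow> bool" where
  "additive M T f \<longleftrightarrow> f \<in> carrier M \<rightarrow> carrier T \<and>
     (\<forall>x \<in> carrier M. \<forall>y \<in> carrier M. f (x \<oplus>\<^bsub>M\<^esub> y) = f x \<oplus>\<^bsub>T\<^esub> f y)"

lemma additiveI: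
  assumes "\<And>x. x \<in> carrier M \<Longrightarrow> f x \<in> carrier T"
    and "\<And>x y. \<lbrakk>x \<in> carrier M; y \<in> carrier M\<rbrakk> \<Longrightarrow> f (x \<oplus>\<^bsub>M\<^esub> y) = f x \<oplus>\<^bsub>T\<^esub> f y"
  shows "additive M T f"
  using assms by (auto simp: additive_def)

lemma additive_closed: "\<lbrakk>additive M T f; x \<in> carrier M\<rbrakk> \<Longrightarrow> f x \<in> carrier T"
  by (auto simp: additive_def)

lemma additive_add:
  "\<lbrakk>additive M T f; x \<in> carrier M; y \<in> carrier M\<rbrakk> \<Longrightarrow> f (x \<oplus>\<^bsub>M\<^esub> y) = f x \<oplus>\<^bsub>T\<^esub> f y"
  by (auto simp: additive_def)

lemma additive_zero:
  assumes "abelian_group M" "abelian_group T" "additive M T f"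
  shows "f \<zero>\<^bsub>M\<^esub> = \<zero>\<^bsub>T\<^esub>"
proof -
  interpret M: abelian_group M by fact
  interpret T: abelian_group T by fact
  have "f \<zero>\<^bsub>M\<^esub> = f \<zero>\<^bsub>M\<^esub> \<oplus>\<^bsub>T\<^esub> f \<zero>\<^bsub>M\<^esub>"
    using additive_add[OF assms(3), of "\<zero>\<^bsub>M\<^esub>" "\<zero>\<^bsub>M\<^esub>"] by simp
  moreover have "f \<zero>\<^bsub>M\<^esub> \<in> carrier T"
    using assms(3) by (simp add: additive_closed)
  ultimately show ?thesis by (metis T.add.r_cancel_one')
qed

context abelian_group
begin

lemma additive_span_closed:
  assumes "A \<subseteq> carrier G" and "x \<in> additive_span G A"
  shows "x \<in> carrier G"
  using assms(2) by induction (use assms(1) in auto)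

lemma additive_span_base: "A \<subseteq> carrier G \<Longrightarrow> a \<in> A \<Longrightarrow> a \<in> additive_span G A"
  using additive_span.step[OF _ additive_span.zero, of a A G] by auto

lemma additive_span_add:
  assumes A: "A \<subseteq> carrier G" and x: "x \<in> additive_span G A" and y: "y \<in> additive_span G A"
  shows "x \<oplus> y \<in> additive_span G A"
  using x
proof induction
  case zero
  then show ?case using additive_span_closed[OF A y] y by simp
next
  case (step a x)
  have "(a \<oplus> x) \<oplus> y = a \<oplus> (x \<oplus> y)"
    using step additive_span_closed[OF A] y A by (simp add: a_assoc subset_iff)
  then show ?case using additive_span.step[OF step(1,3)] by simp
qed

lemma additive_span_least:
  assumes "x \<in> additive_span G A" and "\<zero> \<in> B" and "\<And>x y. \<lbrakk>x \<in> B; y \<in> B\<rbrakk> \<Longrightarrow> x \<oplus> y \<in> B" and "A \<subseteq> B"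
  shows "x \<in> B"
  using assms(1) by induction (use assms(2-) in auto)

lemma generates_induct [consumes 2, case_names zero base add]:
  assumes "generates G A" and "x \<in> carrier G"
    and "P \<zero>" and "\<And>a. a \<in> A \<Longrightarrow> P a"
    and "\<And>x y. \<lbrakk>x \<in> carrier G; y \<in> carrier G; P x; P y\<rbrakk> \<Longrightarrow> P (x \<oplus> y)"
  shows "P x"
proof -
  have A: "A \<subseteq> carrier G" using assms(1) by (simp add: generates_def)
  have "x \<in> additive_span G A" using assms(1,2) by (auto simp: generates_def)
  then show ?thesis
    by induction (use assms(3-) A additive_span_closed[OF A] in auto)
qed

text \<open>It suffices to reach a set \<open>B\<close> that is already known to generate; the span
  of \<open>A\<close> is closed under addition, so it then contains everything.\<close>

lemma generatesI:
  assumes "A \<subseteq> carrier G" and "generates G B" and "\<And>b. b \<in> B \<Longrightarrow> b \<in> additive_span G A"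
  shows "generates G A"
proof -
  have "x \<in> additive_span G A" if "x \<in> carrier G" for x
    using assms(2) that
    by (induction rule: generates_induct)
      (auto intro: additive_span.zero additive_span_add[OF assms(1)] assms(3))
  then show ?thesis using assms(1) by (auto simp: generates_def)
qed

lemma generates_carrier: "generates G (carrier G)"
  by (auto simp: generates_def intro: additive_span_base)

lemma generates_mono: "\<lbrakk>generates G A; A \<subseteq> B; B \<subseteq> carrier G\<rbrakk> \<Longrightarrow> generates G B"
  by (meson additive_span_base generatesI subsetD)

lemma finsum_single:
  assumes "finite I" and "i \<in> I" and "f i \<in> carrier G" and "\<And>j. \<lbrakk>j \<in> I; j \<noteq> i\<rbrakk> \<Longrightarrow> f j = \<zero>"
  shows "(\<Oplus>j\<in>I. f j) = f i"
proof -
  have "(\<Oplus>j\<in>I. f j) = (\<Oplus>j\<in>I. if j = i then f i else \<zero>)"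
    by (rule finsum_cong') (use assms in auto)
  also have "\<dots> = f i"
    using add.finprod_singleton_swap[of i I "\<lambda>_. f i"] assms by simp
  finally show ?thesis .
qed

lemma finsum_mem:
  assumes "\<zero> \<in> B" and "\<And>x y. \<lbrakk>x \<in> B; y \<in> B\<rbrakk> \<Longrightarrow> x \<oplus> y \<in> B" and "B \<subseteq> carrier G"
    and "\<And>i. i \<in> I \<Longrightarrow> f i \<in> B"
  shows "(\<Oplus>i\<in>I. f i) \<in> B"
  using assms(4)
\<comment> \<open>A sum over an infinite index set is zero by convention, so that case falls to the
  assumption that zero lies in \<open>B\<close>.\<close>
proof (induction I rule: infinite_finite_induct)
  case (insert i I)
  then have "f \<in> insert i I \<rightarrow> carrier G" using assms(3) by blast
  then show ?case using insert assms(2) by (simp add: Pi_def)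
qed (use assms(1) in auto)

end

lemma generates_subset: "generates M A \<Longrightarrow> a \<in> A \<Longrightarrow> a \<in> carrier M"
  by (auto simp: generates_def)

text \<open>Uniqueness half of the universal properties. Agreement on generators propagates along
  sums because zero and sums are respected on both sides.\<close>

lemma additive_eq_on_carrier:
  assumes "abelian_group M" "abelian_group T" "additive M T f" "additive M T g" "generates M A"
    and "\<And>a. a \<in> A \<Longrightarrow> f a = g a" and "x \<in> carrier M"
  shows "f x = g x"
proof -
  interpret M: abelian_group M by fact
  show ?thesis using assms(5,7)
    by (induction rule: M.generates_induct)
      (simp_all add: additive_zero[OF assms(1,2)] additive_add[OF assms(3)] additive_add[OF assms(4)]
        assms(3,4,6))
qed

lemma additive_finsum:
  assumes "abelian_group M" "abelian_group T" "additive M T f" "\<And>i. i \<in> I \<Longrightarrow> x i \<in> carrier M"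
  shows "f (\<Oplus>\<^bsub>M\<^esub>i\<in>I. x i) = (\<Oplus>\<^bsub>T\<^esub>i\<in>I. f (x i))"
proof -
  interpret M: abelian_group M by fact
  interpret T: abelian_group T by fact
  note [simp] = additive_zero[OF assms(1-3)]
  show ?thesis using assms(4)
  proof (induction I rule: infinite_finite_induct)
    case (insert i I)
    have "f (\<Oplus>\<^bsub>M\<^esub>i\<in>insert i I. x i) = f (x i \<oplus>\<^bsub>M\<^esub> (\<Oplus>\<^bsub>M\<^esub>i\<in>I. x i))"
      using insert by (subst M.finsum_insert) auto
    also have "\<dots> = f (x i) \<oplus>\<^bsub>T\<^esub> f (\<Oplus>\<^bsub>M\<^esub>i\<in>I. x i)"
      using insert by (intro additive_add[OF assms(3)]) auto
    also have "\<dots> = f (x i) \<oplus>\<^bsub>T\<^esub> (\<Oplus>\<^bsub>T\<^esub>i\<in>I. f (x i))"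
      using insert by simp
    also have "\<dots> = (\<Oplus>\<^bsub>T\<^esub>i\<in>insert i I. f (x i))"
      using insert by (subst T.finsum_insert) (auto intro: additive_closed[OF assms(3)])
    finally show ?case .
  qed simp_all
qed


section \<open>Balanced tensor products of abelian groups\<close>

definition balanced_map ::
    "('v, 'p) ring_scheme \<Rightarrow> ('v, 'q) ring_scheme \<Rightarrow> 's set \<Rightarrow> ('v \<Rightarrow> 's \<Rightarrow> 'v) \<Rightarrow> ('s \<Rightarrow> 'v \<Rightarrow> 'v)
      \<Rightarrow> ('w, 't) ring_scheme \<Rightarrow> ('v \<Rightarrow> 'v \<Rightarrow> 'w) \<Rightarrow> bool" where
  "balanced_map M N S r l T \<phi> \<longleftrightarrow>
     (\<forall>m \<in> carrier M. additive N T (\<phi> m)) \<and> (\<forall>n \<in> carrier N. additive M T (\<lambda>m. \<phi> m n)) \<and>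
     (\<forall>m \<in> carrier M. \<forall>s \<in> S. \<forall>n \<in> carrier N. \<phi> (r m s) n = \<phi> m (l s n))"

text \<open>Both quotients of the development are instances: over K with scalars moved across, and
  over kH acting on kG by right multiplication. Only the carrier, zero and addition of
  \<open>Q\<close> are prescribed, so the complete record with its scalar multiplication, action and
  grading can be plugged in for \<open>Q\<close>, and those fields are examined afterwards.\<close>

locale balanced_quotient = M: abelian_group M + N: abelian_group N
  for M :: "(('g, 'k, 'x) vec, 'p) ring_scheme" and N :: "(('g, 'k, 'x) vec, 'q) ring_scheme" +
  fixes S :: "'s set" and r l and Q :: "(('g, 'k, 'x) vec, 't) ring_scheme"
  assumes r_closed: "\<lbrakk>m \<in> carrier M; s \<in> S\<rbrakk> \<Longrightarrow> r m s \<in> carrier M"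
    and l_closed: "\<lbrakk>s \<in> S; n \<in> carrier N\<rbrakk> \<Longrightarrow> l s n \<in> carrier N"
    and carrier_Q: "carrier Q = formal_class (balanced_eq M N S r l) ` lists (carrier M \<times> carrier N)"
    and zero_Q: "\<zero>\<^bsub>Q\<^esub> = formal_class (balanced_eq M N S r l) []"
    and add_Q: "add Q = (\<lambda>x y. formal_class (balanced_eq M N S r l) (terms x @ terms y))"
begin

abbreviation "E \<equiv> balanced_eq M N S r l"
abbreviation "cls \<equiv> formal_class E"
abbreviation "sums \<equiv> lists (carrier M \<times> carrier N)"

lemma E_sums: "E xs ys \<Longrightarrow> xs \<in> sums \<and> ys \<in> sums"
  by (induction rule: balanced_eq.induct) (auto simp: r_closed l_closed)

text \<open>By symmetry and transitivity related sums define the same predicate,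
  \<open>E xs = E ys\<close>, so \<open>SOME\<close> picks the same representative for both.\<close>

lemma cls_eqI:
  assumes "E xs ys"
  shows "cls xs = cls ys"
proof -
  have "E xs = E ys"
    using assms by (intro ext) (blast intro: balanced_eq.sym balanced_eq.trans)
  then show ?thesis by (simp add: formal_class_def)
qed

lemma E_terms: "xs \<in> sums \<Longrightarrow> E xs (terms (cls xs))"
  unfolding formal_class_def vec.sel by (rule someI[where x = xs]) (rule balanced_eq.refl)

lemma terms_sums: "x \<in> carrier Q \<Longrightarrow> terms x \<in> sums"
  using E_terms E_sums unfolding carrier_Q by blast

lemma cls_closed: "xs \<in> sums \<Longrightarrow> cls xs \<in> carrier Q"
  by (simp add: carrier_Q)

lemma cls_append: "\<lbrakk>xs \<in> sums; ys \<in> sums\<rbrakk> \<Longrightarrow> cls (xs @ ys) = cls xs \<oplus>\<^bsub>Q\<^esub> cls ys"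
  unfolding add_Q by (intro cls_eqI balanced_eq.append E_terms)

lemma cls_Cons: "\<lbrakk>m \<in> carrier M; n \<in> carrier N; xs \<in> sums\<rbrakk> \<Longrightarrow> cls ((m, n) # xs) = cls [(m, n)] \<oplus>\<^bsub>Q\<^esub> cls xs"
  using cls_append[of "[(m, n)]" xs] by simp

text \<open>Concatenation gives a commutative monoid directly from the rules. Inverses come by
  induction on the list, negating the left entry of each term and using \<open>add_left\<close> and
  \<open>zero\<close>.\<close>

lemma abelian_group_Q: "abelian_group Q"
proof -
  interpret Q: abelian_monoid Q
  proof (rule abelian_monoidI)
    fix x y z assume "x \<in> carrier Q" "y \<in> carrier Q" "z \<in> carrier Q"
    then obtain xs ys zs where [simp]: "x = cls xs" "y = cls ys" "z = cls zs"
      and s: "xs \<in> sums" "ys \<in> sums" "zs \<in> sums"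
      by (auto simp: carrier_Q)
    have "xs @ ys \<in> sums" using s by simp
    then show "x \<oplus>\<^bsub>Q\<^esub> y \<in> carrier Q"
      using s by (simp only: \<open>x = cls xs\<close> \<open>y = cls ys\<close> cls_closed cls_append[symmetric])
    show "(x \<oplus>\<^bsub>Q\<^esub> y) \<oplus>\<^bsub>Q\<^esub> z = x \<oplus>\<^bsub>Q\<^esub> (y \<oplus>\<^bsub>Q\<^esub> z)"
      using s by (simp add: cls_append[symmetric])
    show "x \<oplus>\<^bsub>Q\<^esub> y = y \<oplus>\<^bsub>Q\<^esub> x"
      using s by (auto simp: cls_append[symmetric] intro: cls_eqI balanced_eq.commute)
    show "\<zero>\<^bsub>Q\<^esub> \<oplus>\<^bsub>Q\<^esub> x = x"
      using s by (simp add: zero_Q cls_append[symmetric])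
  qed (auto simp: zero_Q intro: cls_closed)
  have inv: "\<exists>y \<in> carrier Q. y \<oplus>\<^bsub>Q\<^esub> cls xs = \<zero>\<^bsub>Q\<^esub>" if "xs \<in> sums" for xs
    using that
  proof (induction xs)
    case Nil
    then show ?case by (intro bexI[of _ "\<zero>\<^bsub>Q\<^esub>"]) (auto simp: zero_Q[symmetric])
  next
    case (Cons p xs)
    obtain m n where [simp]: "p = (m, n)" by fastforce
    from Cons.hyps have mn: "m \<in> carrier M" "n \<in> carrier N" "xs \<in> sums" by auto
    then obtain y where y: "y \<in> carrier Q" "y \<oplus>\<^bsub>Q\<^esub> cls xs = \<zero>\<^bsub>Q\<^esub>" using Cons.IH by auto
    have "cls [(\<ominus>\<^bsub>M\<^esub> m, n)] \<oplus>\<^bsub>Q\<^esub> cls [(m, n)] = cls ([(\<ominus>\<^bsub>M\<^esub> m, n)] @ [(m, n)])"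
      using mn by (intro cls_append[symmetric]) auto
    also have "\<dots> = cls [(\<ominus>\<^bsub>M\<^esub> m \<oplus>\<^bsub>M\<^esub> m, n)]"
      using mn balanced_eq.add_left[of "\<ominus>\<^bsub>M\<^esub> m" M m n N S r l]
      by (intro cls_eqI[symmetric]) auto
    also have "\<dots> = \<zero>\<^bsub>Q\<^esub>"
      using mn by (auto simp: M.l_neg zero_Q intro: cls_eqI balanced_eq.zero)
    finally have "cls [(\<ominus>\<^bsub>M\<^esub> m, n)] \<oplus>\<^bsub>Q\<^esub> cls [(m, n)] = \<zero>\<^bsub>Q\<^esub>" .
    moreover have "cls [(\<ominus>\<^bsub>M\<^esub> m, n)] \<in> carrier Q" "cls [(m, n)] \<in> carrier Q" "cls xs \<in> carrier Q"
      using mn by (auto intro: cls_closed)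
    ultimately have "(y \<oplus>\<^bsub>Q\<^esub> cls [(\<ominus>\<^bsub>M\<^esub> m, n)]) \<oplus>\<^bsub>Q\<^esub> (cls [(m, n)] \<oplus>\<^bsub>Q\<^esub> cls xs) = \<zero>\<^bsub>Q\<^esub>"
      using y by (metis Q.a_assoc Q.l_zero Q.a_closed)
    then show ?case using mn y
      by (intro bexI[of _ "y \<oplus>\<^bsub>Q\<^esub> cls [(\<ominus>\<^bsub>M\<^esub> m, n)]"]) (simp_all add: cls_Cons[of m n xs] cls_closed del: in_lists_conv_set)
  qed
  have inv: "\<exists>y \<in> carrier Q. y \<oplus>\<^bsub>Q\<^esub> x = \<zero>\<^bsub>Q\<^esub>" if "x \<in> carrier Q" for x
    using that inv unfolding carrier_Q by blast
  show ?thesis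
    by (rule abelian_groupI) (simp_all add: Q.a_assoc inv, simp add: Q.a_comm)
qed

sublocale Q: abelian_group Q by (rule abelian_group_Q)

lemma cls1_closed: "\<lbrakk>m \<in> carrier M; n \<in> carrier N\<rbrakk> \<Longrightarrow> cls [(m, n)] \<in> carrier Q"
  by (auto intro: cls_closed)

lemma cls1_add_left:
  "\<lbrakk>m \<in> carrier M; m' \<in> carrier M; n \<in> carrier N\<rbrakk>
    \<Longrightarrow> cls [(m \<oplus>\<^bsub>M\<^esub> m', n)] = cls [(m, n)] \<oplus>\<^bsub>Q\<^esub> cls [(m', n)]"
  using cls_eqI[OF balanced_eq.add_left] by (simp add: cls_Cons[symmetric])

lemma cls1_add_right:
  "\<lbrakk>m \<in> carrier M; n \<in> carrier N; n' \<in> carrier N\<rbrakk>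
    \<Longrightarrow> cls [(m, n \<oplus>\<^bsub>N\<^esub> n')] = cls [(m, n)] \<oplus>\<^bsub>Q\<^esub> cls [(m, n')]"
  using cls_eqI[OF balanced_eq.add_right] by (simp add: cls_Cons[symmetric])

lemma cls1_balance:
  "\<lbrakk>m \<in> carrier M; s \<in> S; n \<in> carrier N\<rbrakk> \<Longrightarrow> cls [(r m s, n)] = cls [(m, l s n)]"
  by (intro cls_eqI balanced_eq.balance)

lemma additive_cls1_left: "n \<in> carrier N \<Longrightarrow> additive M Q (\<lambda>m. cls [(m, n)])"
  by (rule additiveI) (simp_all add: cls1_closed cls1_add_left)

lemma additive_cls1_right: "m \<in> carrier M \<Longrightarrow> additive N Q (\<lambda>n. cls [(m, n)])"
  by (rule additiveI) (simp_all add: cls1_closed cls1_add_right)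

text \<open>Carriers and homogeneous components are introduced as images of lists over a set of
  pairs; this turns both into spans, so that induction over generators applies to them.\<close>

lemma cls_image_lists:
  assumes "P \<subseteq> carrier M \<times> carrier N"
  shows "cls ` lists P = additive_span Q {cls [(m, n)] | m n. (m, n) \<in> P}" (is "_ = additive_span Q ?A")
proof (intro equalityI subsetI)
  fix x assume "x \<in> cls ` lists P"
  then obtain xs where [simp]: "x = cls xs" and "xs \<in> lists P" by blast
  from this(2) have "xs \<in> sums \<and> cls xs \<in> additive_span Q ?A"
  proof (induction xs)
    case Nil
    then show ?case by (simp add: zero_Q[symmetric] additive_span.zero)
  next
    case (Cons p xs)
    obtain m n where [simp]: "p = (m, n)" by fastforce
    from Cons have IH: "(m, n) \<in> P" "xs \<in> sums" "cls xs \<in> additive_span Q ?A" by simp_all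
    then have mn: "m \<in> carrier M" "n \<in> carrier N" using assms by auto
    have "cls [(m, n)] \<in> ?A" using IH(1) by blast
    then have "cls [(m, n)] \<oplus>\<^bsub>Q\<^esub> cls xs \<in> additive_span Q ?A" by (rule additive_span.step) (rule IH(3))
    then show ?case using mn IH(2) by (simp add: cls_Cons[of m n xs])
  qed
  then show "x \<in> additive_span Q ?A" by simp
next
  fix x assume "x \<in> additive_span Q ?A"
  then have "\<exists>xs \<in> lists P. x = cls xs"
  proof induction
    case zero
    show ?case unfolding zero_Q by blast
  next
    case (step a x)
    then obtain m n xs where mn: "(m, n) \<in> P" "a = cls [(m, n)]" and xs: "xs \<in> lists P" "x = cls xs"
      by blast
    have "xs \<in> sums" using xs(1) assms by (meson lists_mono subsetD)
    moreover have "m \<in> carrier M" "n \<in> carrier N" using mn assms by auto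
    ultimately have "a \<oplus>\<^bsub>Q\<^esub> x = cls ((m, n) # xs)" using mn(2) xs(2) by (simp only: cls_Cons[of m n xs])
    moreover have "(m, n) # xs \<in> lists P" using mn xs by simp
    ultimately show ?case by blast
  qed
  then show "x \<in> cls ` lists P" by blast
qed

lemma generates_cls1:
  assumes A: "generates M A" and B: "generates N B"
  shows "generates Q {cls [(a, b)] | a b. a \<in> A \<and> b \<in> B}" (is "generates Q ?C")
proof (rule Q.generatesI)
  show C: "?C \<subseteq> carrier Q" using generates_subset[OF A] generates_subset[OF B] cls1_closed by blast
  have "carrier Q = additive_span Q {cls [(m, n)] | m n. (m, n) \<in> carrier M \<times> carrier N}"
    unfolding carrier_Q by (rule cls_image_lists) simp
  moreover have "{cls [(m, n)] | m n. (m, n) \<in> carrier M \<times> carrier N} \<subseteq> carrier Q"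
    using cls1_closed by blast
  ultimately show "generates Q {cls [(m, n)] | m n. (m, n) \<in> carrier M \<times> carrier N}"
    unfolding generates_def by blast
  \<comment> \<open>The right entry is expanded first, over a generator \<open>a\<close> on the
    left. An arbitrary left entry is expanded afterwards, and its generators are then covered by
    this fact.\<close>
  have *: "cls [(a, n)] \<in> additive_span Q ?C" if a: "a \<in> A" and "n \<in> carrier N" for a n
  proof -
    have "a \<in> carrier M" using A a by (rule generates_subset)
    note add = additive_cls1_right[OF this]
    show ?thesis using B that(2)
    proof (induction rule: N.generates_induct)
      case zero
      show ?case using additive_zero[OF N.abelian_group_axioms abelian_group_Q add] by (simp add: additive_span.zero)
    next
      case (base b)
      then show ?case using a by (intro Q.additive_span_base C) auto
    next
      case (add x y)
      then show ?case using \<open>a \<in> carrier M\<close> by (simp add: cls1_add_right Q.additive_span_add[OF C])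
    qed
  qed
  fix b assume "b \<in> {cls [(m, n)] | m n. (m, n) \<in> carrier M \<times> carrier N}"
  then obtain m n where [simp]: "b = cls [(m, n)]" and m: "m \<in> carrier M" and n: "n \<in> carrier N" by auto
  note add = additive_cls1_left[OF n]
  from A m have "cls [(m, n)] \<in> additive_span Q ?C"
  proof (induction rule: M.generates_induct)
    case zero
    show ?case using additive_zero[OF M.abelian_group_axioms abelian_group_Q add] by (simp add: additive_span.zero)
  next
    case (base b)
    then show ?case using n by (intro *)
  next
    case (add x y)
    then show ?case using n by (simp add: cls1_add_left Q.additive_span_add[OF C])
  qed
  then show "b \<in> additive_span Q ?C" by simp
qed

context
  fixes T :: "('w, 'u) ring_scheme" and \<phi>
  assumes T: "abelian_group T" and \<phi>: "balanced_map M N S r l T \<phi>"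
begin

interpretation T: abelian_group T by (rule T)

private abbreviation "eval \<equiv> \<lambda>xs. foldr (\<lambda>(m, n) y. \<phi> m n \<oplus>\<^bsub>T\<^esub> y) xs \<zero>\<^bsub>T\<^esub>"

private lemma \<phi>_left: "n \<in> carrier N \<Longrightarrow> additive M T (\<lambda>m. \<phi> m n)"
  and \<phi>_right: "m \<in> carrier M \<Longrightarrow> additive N T (\<phi> m)"
  and \<phi>_bal: "\<lbrakk>m \<in> carrier M; s \<in> S; n \<in> carrier N\<rbrakk> \<Longrightarrow> \<phi> (r m s) n = \<phi> m (l s n)"
  using \<phi> by (auto simp: balanced_map_def)

private lemma \<phi>_closed: "\<lbrakk>m \<in> carrier M; n \<in> carrier N\<rbrakk> \<Longrightarrow> \<phi> m n \<in> carrier T"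
  using \<phi>_left by (rule additive_closed)

private lemma eval_closed: "xs \<in> sums \<Longrightarrow> eval xs \<in> carrier T"
  by (induction xs) (auto simp: \<phi>_closed)

private lemma eval_append: "\<lbrakk>xs \<in> sums; ys \<in> sums\<rbrakk> \<Longrightarrow> eval (xs @ ys) = eval xs \<oplus>\<^bsub>T\<^esub> eval ys"
proof (induction xs)
  case (Cons p xs)
  then show ?case using eval_closed[of xs] eval_closed[of ys]
    by (cases p) (simp add: \<phi>_closed T.a_assoc del: in_lists_conv_set)
qed (simp add: eval_closed)

text \<open>\<open>lift\<close> evaluates the representative chosen by \<open>SOME\<close>.
  Invariance under every rule of the congruence is what allows any other list for the same class to
  be used instead.\<close>

private lemma eval_E: "E xs ys \<Longrightarrow> eval xs = eval ys"
proof (induction rule: balanced_eq.induct)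
  case (append xs xs' ys ys')
  then show ?case using E_sums eval_append by metis
next
  case (commute xs ys)
  then show ?case by (simp only: eval_append eval_closed T.a_comm)
next
  case (zero n)
  then show ?case using additive_zero[OF M.abelian_group_axioms T \<phi>_left] by simp
next
  case (add_left m m' n)
  then show ?case using additive_add[OF \<phi>_left, of n m m'] by (simp add: \<phi>_closed)
next
  case (add_right m n n')
  then show ?case using additive_add[OF \<phi>_right, of m n n'] by (simp add: \<phi>_closed)
qed (auto simp: \<phi>_bal)

private lemma lift_cls: "xs \<in> sums \<Longrightarrow> lift T \<phi> (cls xs) = eval xs"
  using eval_E[OF E_terms] by (simp add: lift_def)

lemma lift_additive: "additive Q T (lift T \<phi>)"
proof (rule additiveI)
  fix x y assume "x \<in> carrier Q" "y \<in> carrier Q"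
  then show "lift T \<phi> (x \<oplus>\<^bsub>Q\<^esub> y) = lift T \<phi> x \<oplus>\<^bsub>T\<^esub> lift T \<phi> y"
  proof -
    assume "x \<in> carrier Q" "y \<in> carrier Q"
    then obtain xs ys where s: "xs \<in> sums" "ys \<in> sums" and [simp]: "x = cls xs" "y = cls ys"
      unfolding carrier_Q by blast
    then have "xs @ ys \<in> sums" by simp
    then show ?thesis using s by (simp only: \<open>x = cls xs\<close> \<open>y = cls ys\<close> cls_append[symmetric] lift_cls eval_append)
  qed
next
  fix x assume "x \<in> carrier Q"
  then obtain xs where "xs \<in> sums" "x = cls xs" unfolding carrier_Q by blast
  then show "lift T \<phi> x \<in> carrier T" by (simp only: lift_cls eval_closed)
qed

lemma lift_cls1: "\<lbrakk>m \<in> carrier M; n \<in> carrier N\<rbrakk> \<Longrightarrow> lift T \<phi> (cls [(m, n)]) = \<phi> m n"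
  by (simp add: lift_cls \<phi>_closed)

end

text \<open>Scalar multiplication and group action are introduced by mapping over
  \<open>terms x\<close>. Both sides here are computed from that same list, so the identity precedes
  well-definedness, which follows once the map under \<open>lift\<close> is seen to be
  balanced.\<close>

lemma cls_map_terms:
  assumes "f \<in> carrier M \<rightarrow> carrier M" "f' \<in> carrier N \<rightarrow> carrier N" "x \<in> carrier Q"
  shows "cls (map (\<lambda>(m, n). (f m, f' n)) (terms x)) = lift Q (\<lambda>m n. cls [(f m, f' n)]) x"
proof -
  have "map (\<lambda>(m, n). (f m, f' n)) xs \<in> sums \<and> cls (map (\<lambda>(m, n). (f m, f' n)) xs)
      = foldr (\<lambda>(m, n) y. cls [(f m, f' n)] \<oplus>\<^bsub>Q\<^esub> y) xs \<zero>\<^bsub>Q\<^esub>"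
    if "xs \<in> sums" for xs
    using that
  proof (induction xs)
    case Nil
    then show ?case by (simp add: zero_Q)
  next
    case (Cons p xs)
    obtain m n where [simp]: "p = (m, n)" by fastforce
    have "m \<in> carrier M" "n \<in> carrier N" and xs: "xs \<in> sums" using Cons.hyps by auto
    then have fm: "f m \<in> carrier M" "f' n \<in> carrier N" using assms(1,2) by auto
    let ?ys = "map (\<lambda>(m, n). (f m, f' n)) xs"
    have IH: "?ys \<in> sums" "cls ?ys = foldr (\<lambda>(m, n) y. cls [(f m, f' n)] \<oplus>\<^bsub>Q\<^esub> y) xs \<zero>\<^bsub>Q\<^esub>"
      using Cons.IH xs by auto
    then show ?case using fm by (simp add: cls_Cons[OF fm IH(1)] del: in_lists_conv_set)
  qed
  then show ?thesis using terms_sums[OF assms(3)] by (simp add: lift_def)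
qed

end


section \<open>Linear maps\<close>

definition bilinear ::
    "('k, 'r) ring_scheme \<Rightarrow> ('k, 'v, 'm) module_scheme \<Rightarrow> ('k, 'w, 'n) module_scheme
      \<Rightarrow> ('k, 't, 'p) module_scheme \<Rightarrow> ('v \<Rightarrow> 'w \<Rightarrow> 't) \<Rightarrow> bool" where
  "bilinear K V W T \<phi> \<longleftrightarrow> (\<forall>v \<in> carrier V. \<phi> v \<in> linear_maps K W T) \<and>
     (\<forall>w \<in> carrier W. (\<lambda>v. \<phi> v w) \<in> linear_maps K V T)"

lemma linear_additive: "f \<in> linear_maps K V W \<Longrightarrow> additive V W f"
  by (auto simp: linear_maps_def additive_def)

lemma linear_closed: "\<lbrakk>f \<in> linear_maps K V W; x \<in> carrier V\<rbrakk> \<Longrightarrow> f x \<in> carrier W"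
  by (auto simp: linear_maps_def)

lemma linear_add:
  "\<lbrakk>f \<in> linear_maps K V W; x \<in> carrier V; y \<in> carrier V\<rbrakk> \<Longrightarrow> f (x \<oplus>\<^bsub>V\<^esub> y) = f x \<oplus>\<^bsub>W\<^esub> f y"
  by (auto simp: linear_maps_def)

lemma linear_smult:
  "\<lbrakk>f \<in> linear_maps K V W; c \<in> carrier K; x \<in> carrier V\<rbrakk> \<Longrightarrow> f (c \<odot>\<^bsub>V\<^esub> x) = c \<odot>\<^bsub>W\<^esub> f x"
  by (auto simp: linear_maps_def)

lemma linear_mapsI:
  assumes "\<And>x. x \<in> carrier V \<Longrightarrow> f x \<in> carrier W"
    and "\<And>x y. \<lbrakk>x \<in> carrier V; y \<in> carrier V\<rbrakk> \<Longrightarrow> f (x \<oplus>\<^bsub>V\<^esub> y) = f x \<oplus>\<^bsub>W\<^esub> f y"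
    and "\<And>c x. \<lbrakk>c \<in> carrier K; x \<in> carrier V\<rbrakk> \<Longrightarrow> f (c \<odot>\<^bsub>V\<^esub> x) = c \<odot>\<^bsub>W\<^esub> f x"
  shows "f \<in> linear_maps K V W"
  using assms by (auto simp: linear_maps_def)

locale modules_over = K: cring K for K :: "('k, 'r) ring_scheme"
begin

text \<open>The facts of the \<open>module\<close> locale are restated with
  \<open>module K V\<close> as a premise. Equations below involve many modules at once, most of them
  composite; the simplifier discharges such premises where otherwise each module would call for an
  interpretation.\<close>

lemma mod_group [simp]: "module K V \<Longrightarrow> abelian_group V"
  by (rule module.axioms)

lemma mod_monoid [simp]: "module K V \<Longrightarrow> abelian_monoid V"
  by (rule abelian_group.axioms(1)) simp

lemma mod_zero [simp]: "module K V \<Longrightarrow> \<zero>\<^bsub>V\<^esub> \<in> carrier V"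
  by (rule abelian_monoid.zero_closed) simp

lemma mod_add [simp]: "\<lbrakk>module K V; x \<in> carrier V; y \<in> carrier V\<rbrakk> \<Longrightarrow> x \<oplus>\<^bsub>V\<^esub> y \<in> carrier V"
  by (rule abelian_monoid.a_closed) simp_all

lemma mod_smult [simp]: "\<lbrakk>module K V; c \<in> carrier K; x \<in> carrier V\<rbrakk> \<Longrightarrow> c \<odot>\<^bsub>V\<^esub> x \<in> carrier V"
  by (rule module.smult_closed)

lemma mod_r_zero [simp]: "\<lbrakk>module K V; x \<in> carrier V\<rbrakk> \<Longrightarrow> x \<oplus>\<^bsub>V\<^esub> \<zero>\<^bsub>V\<^esub> = x"
  by (rule abelian_monoid.r_zero) simp_all

lemma mod_smult_zero [simp]: "\<lbrakk>module K V; c \<in> carrier K\<rbrakk> \<Longrightarrow> c \<odot>\<^bsub>V\<^esub> \<zero>\<^bsub>V\<^esub> = \<zero>\<^bsub>V\<^esub>"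
  by (rule module.smult_r_null)

lemma mod_zero_smult [simp]: "\<lbrakk>module K V; x \<in> carrier V\<rbrakk> \<Longrightarrow> \<zero>\<^bsub>K\<^esub> \<odot>\<^bsub>V\<^esub> x = \<zero>\<^bsub>V\<^esub>"
  by (rule module.smult_l_null)

lemma mod_one_smult [simp]: "\<lbrakk>module K V; x \<in> carrier V\<rbrakk> \<Longrightarrow> \<one>\<^bsub>K\<^esub> \<odot>\<^bsub>V\<^esub> x = x"
  by (rule module.smult_one)

lemma mod_smult_add:
  "\<lbrakk>module K V; c \<in> carrier K; x \<in> carrier V; y \<in> carrier V\<rbrakk> \<Longrightarrow> c \<odot>\<^bsub>V\<^esub> (x \<oplus>\<^bsub>V\<^esub> y) = c \<odot>\<^bsub>V\<^esub> x \<oplus>\<^bsub>V\<^esub> c \<odot>\<^bsub>V\<^esub> y"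
  by (rule module.smult_r_distr)

lemma mod_add_smult:
  "\<lbrakk>module K V; c \<in> carrier K; d \<in> carrier K; x \<in> carrier V\<rbrakk> \<Longrightarrow> (c \<oplus>\<^bsub>K\<^esub> d) \<odot>\<^bsub>V\<^esub> x = c \<odot>\<^bsub>V\<^esub> x \<oplus>\<^bsub>V\<^esub> d \<odot>\<^bsub>V\<^esub> x"
  by (rule module.smult_l_distr)

lemma mod_mult_smult:
  "\<lbrakk>module K V; c \<in> carrier K; d \<in> carrier K; x \<in> carrier V\<rbrakk> \<Longrightarrow> (c \<otimes>\<^bsub>K\<^esub> d) \<odot>\<^bsub>V\<^esub> x = c \<odot>\<^bsub>V\<^esub> (d \<odot>\<^bsub>V\<^esub> x)"
  by (rule module.smult_assoc1)

lemma mod_add_ac: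
  assumes "module K V" "x \<in> carrier V" "y \<in> carrier V"
  shows "x \<oplus>\<^bsub>V\<^esub> y = y \<oplus>\<^bsub>V\<^esub> x"
    and "z \<in> carrier V \<Longrightarrow> (x \<oplus>\<^bsub>V\<^esub> y) \<oplus>\<^bsub>V\<^esub> z = x \<oplus>\<^bsub>V\<^esub> (y \<oplus>\<^bsub>V\<^esub> z)"
    and "z \<in> carrier V \<Longrightarrow> x \<oplus>\<^bsub>V\<^esub> (y \<oplus>\<^bsub>V\<^esub> z) = y \<oplus>\<^bsub>V\<^esub> (x \<oplus>\<^bsub>V\<^esub> z)"
proof -
  interpret V: module K V by fact
  show "x \<oplus>\<^bsub>V\<^esub> y = y \<oplus>\<^bsub>V\<^esub> x"
    and "z \<in> carrier V \<Longrightarrow> (x \<oplus>\<^bsub>V\<^esub> y) \<oplus>\<^bsub>V\<^esub> z = x \<oplus>\<^bsub>V\<^esub> (y \<oplus>\<^bsub>V\<^esub> z)"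
    and "z \<in> carrier V \<Longrightarrow> x \<oplus>\<^bsub>V\<^esub> (y \<oplus>\<^bsub>V\<^esub> z) = y \<oplus>\<^bsub>V\<^esub> (x \<oplus>\<^bsub>V\<^esub> z)"
    using assms by (simp_all add: V.M.a_ac)
qed

lemma mod_finsum [simp]: "\<lbrakk>module K V; \<And>i. i \<in> I \<Longrightarrow> f i \<in> carrier V\<rbrakk> \<Longrightarrow> (\<Oplus>\<^bsub>V\<^esub>i\<in>I. f i) \<in> carrier V"
  by (rule abelian_monoid.finsum_closed) auto

lemma linear_zero: "\<lbrakk>module K V; module K W; f \<in> linear_maps K V W\<rbrakk> \<Longrightarrow> f \<zero>\<^bsub>V\<^esub> = \<zero>\<^bsub>W\<^esub>"
  by (intro additive_zero linear_additive) simp_all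

lemma linear_finsum:
  "\<lbrakk>module K V; module K W; f \<in> linear_maps K V W; \<And>i. i \<in> I \<Longrightarrow> x i \<in> carrier V\<rbrakk>
    \<Longrightarrow> f (\<Oplus>\<^bsub>V\<^esub>i\<in>I. x i) = (\<Oplus>\<^bsub>W\<^esub>i\<in>I. f (x i))"
  by (intro additive_finsum linear_additive) simp_all

lemma linear_cong: "\<lbrakk>module K V; f \<in> linear_maps K V W; \<And>x. x \<in> carrier V \<Longrightarrow> g x = f x\<rbrakk> \<Longrightarrow> g \<in> linear_maps K V W"
  by (rule linear_mapsI) (simp_all add: linear_closed linear_add linear_smult)

lemma linear_comp:
  "\<lbrakk>f \<in> linear_maps K V W; g \<in> linear_maps K W U\<rbrakk> \<Longrightarrow> (\<lambda>x. g (f x)) \<in> linear_maps K V U"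
  by (rule linear_mapsI)
    (simp_all add: linear_closed[of f K V W] linear_closed[of g K W U] linear_add[of f K V W]
      linear_add[of g K W U] linear_smult[of f K V W] linear_smult[of g K W U])

lemma linear_id: "(\<lambda>x. x) \<in> linear_maps K V V"
  by (rule linear_mapsI) simp_all

lemma linear_const_zero: "module K W \<Longrightarrow> (\<lambda>_. \<zero>\<^bsub>W\<^esub>) \<in> linear_maps K V W"
  by (rule linear_mapsI) simp_all

lemma linear_plus:
  "\<lbrakk>module K V; module K W; f \<in> linear_maps K V W; g \<in> linear_maps K V W\<rbrakk>
    \<Longrightarrow> (\<lambda>x. f x \<oplus>\<^bsub>W\<^esub> g x) \<in> linear_maps K V W"
  by (rule linear_mapsI) (simp_all add: linear_closed linear_add linear_smult mod_smult_add mod_add_ac)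

lemma linear_scale:
  "\<lbrakk>module K V; module K W; c \<in> carrier K; f \<in> linear_maps K V W\<rbrakk> \<Longrightarrow> (\<lambda>x. c \<odot>\<^bsub>W\<^esub> f x) \<in> linear_maps K V W"
  by (rule linear_mapsI)
    (simp_all add: linear_closed linear_add linear_smult mod_smult_add mod_mult_smult[symmetric] K.m_comm)

lemma linear_finsum_fun:
  assumes "module K V" "module K W" "\<And>i. i \<in> I \<Longrightarrow> f i \<in> linear_maps K V W"
  shows "(\<lambda>x. \<Oplus>\<^bsub>W\<^esub>i\<in>I. f i x) \<in> linear_maps K V W"
  using assms(3)
proof (induction I rule: infinite_finite_induct)
  case (insert i I)
  interpret W: module K W by fact
  have *: "(\<lambda>x. f i x \<oplus>\<^bsub>W\<^esub> (\<Oplus>\<^bsub>W\<^esub>i\<in>I. f i x)) \<in> linear_maps K V W"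
    by (rule linear_plus[OF assms(1,2) insert.prems[OF insertI1] insert.IH]) (simp add: insert.prems)
  have closed: "f j x \<in> carrier W" if "j \<in> insert i I" "x \<in> carrier V" for j x
    using insert.prems[OF that(1)] that(2) by (rule linear_closed)
  show ?case
    by (rule linear_cong[OF assms(1) *], rule W.M.finsum_insert) (use insert.hyps closed in auto)
next
  case (infinite I)
  interpret W: module K W by fact
  show ?case using infinite by (simp add: linear_const_zero assms)
next
  case empty
  interpret W: module K W by fact
  show ?case by (simp add: linear_const_zero assms)
qed

lemma linear_eq_on_carrier:
  assumes "module K V" "module K W" "f \<in> linear_maps K V W" "g \<in> linear_maps K V W" "generates V A"
    and "\<And>a. a \<in> A \<Longrightarrow> f a = g a" and "x \<in> carrier V"
  shows "f x = g x"
  using assms additive_eq_on_carrier[of V W f g A x] by (simp add: linear_additive)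

text \<open>For a fixed scalar c both x \<mapsto> f (c x) and x \<mapsto> c (f x) are additive, so
  homogeneity has to be seen on generators only.\<close>

lemma additive_imp_linear:
  assumes "module K V" "module K W" "additive V W f" "generates V A"
    and "\<And>c a. \<lbrakk>c \<in> carrier K; a \<in> A\<rbrakk> \<Longrightarrow> f (c \<odot>\<^bsub>V\<^esub> a) = c \<odot>\<^bsub>W\<^esub> f a"
  shows "f \<in> linear_maps K V W"
proof (rule linear_mapsI)
  fix c x assume c: "c \<in> carrier K" and x: "x \<in> carrier V"
  show "f (c \<odot>\<^bsub>V\<^esub> x) = c \<odot>\<^bsub>W\<^esub> f x"
  proof (rule additive_eq_on_carrier[OF _ _ _ _ assms(4) assms(5)[OF c] x])
    show "additive V W (\<lambda>x. f (c \<odot>\<^bsub>V\<^esub> x))" "additive V W (\<lambda>x. c \<odot>\<^bsub>W\<^esub> f x)"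
      using assms(1-3) c
      by (auto intro!: additiveI simp: mod_smult_add additive_closed[OF assms(3)] additive_add[OF assms(3)])
  qed (use assms(1,2) in simp_all)
next
  show "f x \<in> carrier W" if "x \<in> carrier V" for x
    using assms(3) that by (rule additive_closed)
  show "f (x \<oplus>\<^bsub>V\<^esub> y) = f x \<oplus>\<^bsub>W\<^esub> f y" if "x \<in> carrier V" "y \<in> carrier V" for x y
    using assms(3) that by (rule additive_add)
qed

text \<open>The tool for nested lifts, where \<open>x\<close> is an arbitrary element of a quotient.
  Additivity and homogeneity in the parameter \<open>u\<close> are, for fixed parameters, equalities
  of linear maps in \<open>x\<close>, so they follow from their instances on generators.\<close>

lemma linear_param:
  assumes "module K U" "module K X" "module K T" "generates X A"
    and "\<And>u. u \<in> carrier U \<Longrightarrow> F u \<in> linear_maps K X T"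
    and "\<And>a. a \<in> A \<Longrightarrow> (\<lambda>u. F u a) \<in> linear_maps K U T"
    and "x \<in> carrier X"
  shows "(\<lambda>u. F u x) \<in> linear_maps K U T"
proof (rule linear_mapsI)
  note F = assms(5)
  fix u u' assume u: "u \<in> carrier U" "u' \<in> carrier U"
  have *: "(\<lambda>x. F u x \<oplus>\<^bsub>T\<^esub> F u' x) \<in> linear_maps K X T"
    using assms u by (intro linear_plus) auto
  show "F (u \<oplus>\<^bsub>U\<^esub> u') x = F u x \<oplus>\<^bsub>T\<^esub> F u' x"
    by (rule linear_eq_on_carrier[OF assms(2,3) F * assms(4)])
      (use assms u linear_add[OF assms(6)] in auto)
next
  fix c u assume u: "c \<in> carrier K" "u \<in> carrier U"
  have *: "(\<lambda>x. c \<odot>\<^bsub>T\<^esub> F u x) \<in> linear_maps K X T"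
    using assms u by (intro linear_scale) auto
  show "F (c \<odot>\<^bsub>U\<^esub> u) x = c \<odot>\<^bsub>T\<^esub> F u x"
    by (rule linear_eq_on_carrier[OF assms(2,3) assms(5) * assms(4)])
      (use assms u linear_smult[OF assms(6)] in auto)
next
  show "F u x \<in> carrier T" if "u \<in> carrier U" for u
    using assms(5)[OF that] assms(7) by (rule linear_closed)
qed

text \<open>Turns finite dimension into a statement about generators, the form in which it passes to
  tensor products and induced modules. Sums of generators are collected into one coefficient
  function on \<open>B\<close>.\<close>

lemma finite_dim_iff_generates:
  assumes "module K V"
  shows "finite_dim K V \<longleftrightarrow>
    (\<exists>B. finite B \<and> B \<subseteq> carrier V \<and> generates V {c \<odot>\<^bsub>V\<^esub> b | c b. c \<in> carrier K \<and> b \<in> B})"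
proof -
  interpret V: module K V by fact
  have "generates V {c \<odot>\<^bsub>V\<^esub> b | c b. c \<in> carrier K \<and> b \<in> B}
      \<longleftrightarrow> (\<forall>v \<in> carrier V. \<exists>c \<in> B \<rightarrow> carrier K. v = (\<Oplus>\<^bsub>V\<^esub>b\<in>B. c b \<odot>\<^bsub>V\<^esub> b))" (is "?l \<longleftrightarrow> ?r")
    if fin: "finite B" and B: "B \<subseteq> carrier V" for B
  proof
    let ?A = "{c \<odot>\<^bsub>V\<^esub> b | c b. c \<in> carrier K \<and> b \<in> B}"
    assume l: "generates V ?A"
    show ?r
    proof
      fix v assume "v \<in> carrier V"
      with l show "\<exists>c \<in> B \<rightarrow> carrier K. v = (\<Oplus>\<^bsub>V\<^esub>b\<in>B. c b \<odot>\<^bsub>V\<^esub> b)"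
      proof (induction rule: V.M.generates_induct)
        case zero
        have "(\<Oplus>\<^bsub>V\<^esub>b\<in>B. \<zero>\<^bsub>K\<^esub> \<odot>\<^bsub>V\<^esub> b) = \<zero>\<^bsub>V\<^esub>"
          using B by (subst V.M.add.finprod_cong'[of B B "\<lambda>_. \<zero>\<^bsub>V\<^esub>"]) auto
        then show ?case by (intro bexI[of _ "\<lambda>_. \<zero>\<^bsub>K\<^esub>"]) auto
      next
        case (base a)
        then obtain d b where a: "a = d \<odot>\<^bsub>V\<^esub> b" "d \<in> carrier K" "b \<in> B" by blast
        have "(\<Oplus>\<^bsub>V\<^esub>b'\<in>B. (if b' = b then d else \<zero>\<^bsub>K\<^esub>) \<odot>\<^bsub>V\<^esub> b') = (if b = b then d else \<zero>\<^bsub>K\<^esub>) \<odot>\<^bsub>V\<^esub> b"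
          by (rule V.M.finsum_single) (use a B fin in auto)
        then show ?case using a by (intro bexI[of _ "\<lambda>b'. if b' = b then d else \<zero>\<^bsub>K\<^esub>"]) auto
      next
        case (add x y)
        then obtain c d where cd: "c \<in> B \<rightarrow> carrier K" "x = (\<Oplus>\<^bsub>V\<^esub>b\<in>B. c b \<odot>\<^bsub>V\<^esub> b)"
          "d \<in> B \<rightarrow> carrier K" "y = (\<Oplus>\<^bsub>V\<^esub>b\<in>B. d b \<odot>\<^bsub>V\<^esub> b)" by blast
        have "(\<Oplus>\<^bsub>V\<^esub>b\<in>B. (c b \<oplus>\<^bsub>K\<^esub> d b) \<odot>\<^bsub>V\<^esub> b) = (\<Oplus>\<^bsub>V\<^esub>b\<in>B. c b \<odot>\<^bsub>V\<^esub> b \<oplus>\<^bsub>V\<^esub> d b \<odot>\<^bsub>V\<^esub> b)"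
          by (rule V.M.finsum_cong') (use cd B in \<open>auto simp: Pi_iff subset_iff V.smult_l_distr\<close>)
        also have "\<dots> = x \<oplus>\<^bsub>V\<^esub> y"
          unfolding cd(2,4) by (rule V.M.finsum_addf) (use cd B in \<open>auto simp: Pi_iff subset_iff\<close>)
        finally show ?case using cd by (intro bexI[of _ "\<lambda>b. c b \<oplus>\<^bsub>K\<^esub> d b"]) auto
      qed
    qed
  next
    let ?A = "{c \<odot>\<^bsub>V\<^esub> b | c b. c \<in> carrier K \<and> b \<in> B}"
    assume r: ?r
    have A: "?A \<subseteq> carrier V" using B by auto
    have "v \<in> additive_span V ?A" if v: "v \<in> carrier V" for v
    proof -
      obtain c where c: "c \<in> B \<rightarrow> carrier K" "v = (\<Oplus>\<^bsub>V\<^esub>b\<in>B. c b \<odot>\<^bsub>V\<^esub> b)" using r v by blast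
      show ?thesis unfolding c(2)
      proof (rule V.M.finsum_mem)
        show "additive_span V ?A \<subseteq> carrier V" using V.M.additive_span_closed[OF A] by blast
        fix b assume "b \<in> B"
        then show "c b \<odot>\<^bsub>V\<^esub> b \<in> additive_span V ?A"
          using c(1) by (intro V.M.additive_span_base A) auto
      qed (auto intro: additive_span.zero V.M.additive_span_add[OF A])
    qed
    then show ?l using A by (auto simp: generates_def)
  qed
  then show ?thesis unfolding finite_dim_def by blast
qed

end


section \<open>Yetter--Drinfeld modules\<close>

definition homogeneous :: "('g, 'm) monoid_scheme \<Rightarrow> ('k, 'v, 'g, 'n) yd_scheme \<Rightarrow> 'v set" where
  "homogeneous G V = (\<Union>g \<in> carrier G. grade V g)"

text \<open>A finite carrier makes a sum over all degrees an honest sum; over an infinite set it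
  would be zero by convention.\<close>

locale yd_modules = modules_over K + group G
  for K :: "('k, 'r) ring_scheme" and G :: "('g, 'm) monoid_scheme" (structure) +
  assumes finite_G: "finite (carrier G)"
begin

abbreviation (input) ten where "ten \<equiv> tensor_yd K G"
abbreviation (input) Unit where "Unit \<equiv> unit_yd K G"
abbreviation (input) pures where "pures V W A B \<equiv> {pure K V W a b | a b. a \<in> A \<and> b \<in> B}"
abbreviation rp :: "('k, 'v, 'g, 'n) rep_scheme \<Rightarrow> bool" where "rp V \<equiv> representation K G V"
abbreviation yd :: "('k, 'v, 'g, 'n) yd_scheme \<Rightarrow> bool" where "yd V \<equiv> yetter_drinfeld K G V"

lemma rep_module [simp]: "rp V \<Longrightarrow> module K V"
  by (auto simp only: representation_def)

lemma rep_act_linear [simp]: "\<lbrakk>rp V; g \<in> carrier G\<rbrakk> \<Longrightarrow> act V g \<in> linear_maps K V V"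
  by (auto simp only: representation_def)

lemma rep_act_closed [simp]: "\<lbrakk>rp V; g \<in> carrier G; v \<in> carrier V\<rbrakk> \<Longrightarrow> act V g v \<in> carrier V"
  by (rule linear_closed[OF rep_act_linear])

lemma rep_act_one [simp]: "\<lbrakk>rp V; v \<in> carrier V\<rbrakk> \<Longrightarrow> act V \<one> v = v"
  by (auto simp only: representation_def)

lemma rep_act_mult: "\<lbrakk>rp V; g \<in> carrier G; h \<in> carrier G; v \<in> carrier V\<rbrakk> \<Longrightarrow> act V (g \<otimes> h) v = act V g (act V h v)"
  by (auto simp only: representation_def)

lemma rep_act_inv:
  "\<lbrakk>rp V; g \<in> carrier G; v \<in> carrier V\<rbrakk> \<Longrightarrow> act V g (act V (inv g) v) = v"
  "\<lbrakk>rp V; g \<in> carrier G; v \<in> carrier V\<rbrakk> \<Longrightarrow> act V (inv g) (act V g v) = v"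
  by (simp_all add: rep_act_mult[symmetric])

lemma yd_rep [simp]: "yd V \<Longrightarrow> rp V"
  by (auto simp only: yetter_drinfeld_def)

lemma yd_submodule: "\<lbrakk>yd V; g \<in> carrier G\<rbrakk> \<Longrightarrow> submodule (grade V g) K V"
  by (auto simp only: yetter_drinfeld_def)

lemma grade_subset: "\<lbrakk>yd V; g \<in> carrier G\<rbrakk> \<Longrightarrow> grade V g \<subseteq> carrier V"
  by (rule module.submoduleE(1)[OF _ yd_submodule]) simp_all

lemma grade_closed: "\<lbrakk>yd V; g \<in> carrier G; v \<in> grade V g\<rbrakk> \<Longrightarrow> v \<in> carrier V"
  using grade_subset by blast

lemma grade_add: "\<lbrakk>yd V; g \<in> carrier G; v \<in> grade V g; w \<in> grade V g\<rbrakk> \<Longrightarrow> v \<oplus>\<^bsub>V\<^esub> w \<in> grade V g"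
  by (rule module.submoduleE(5)[OF _ yd_submodule]) simp_all

lemma grade_smult: "\<lbrakk>yd V; g \<in> carrier G; c \<in> carrier K; v \<in> grade V g\<rbrakk> \<Longrightarrow> c \<odot>\<^bsub>V\<^esub> v \<in> grade V g"
  by (rule module.submoduleE(4)[OF _ yd_submodule]) simp_all

lemma grade_zero: "\<lbrakk>yd V; g \<in> carrier G\<rbrakk> \<Longrightarrow> \<zero>\<^bsub>V\<^esub> \<in> grade V g"
  using subgroup.one_closed[OF submodule.axioms(1)[OF yd_submodule]] by simp

lemma grade_act:
  assumes "yd V" "g \<in> carrier G" "h \<in> carrier G" "v \<in> grade V h"
  shows "act V g v \<in> grade V (g \<otimes> h \<otimes> inv g)"
proof -
  have "act V g ` grade V h = grade V (g \<otimes> h \<otimes> inv g)"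
    using assms by (simp only: yetter_drinfeld_def)
  then show ?thesis using assms(4) by blast
qed

lemma homogeneous_closed: "\<lbrakk>yd V; v \<in> homogeneous G V\<rbrakk> \<Longrightarrow> v \<in> carrier V"
  by (auto simp: homogeneous_def intro: grade_closed)

lemma homogeneousE:
  assumes "v \<in> homogeneous G V"
  obtains g where "g \<in> carrier G" "v \<in> grade V g"
  using assms unfolding homogeneous_def by blast

lemma homogeneousI: "\<lbrakk>g \<in> carrier G; v \<in> grade V g\<rbrakk> \<Longrightarrow> v \<in> homogeneous G V"
  by (auto simp: homogeneous_def)

lemma decomposition_unique: "\<lbrakk>yd V; v \<in> carrier V\<rbrakk> \<Longrightarrow> \<exists>!f. decomposition G V v f"
  by (simp only: yetter_drinfeld_def)

lemma decomposition_component: "\<lbrakk>yd V; v \<in> carrier V\<rbrakk> \<Longrightarrow> decomposition G V v (component G V v)"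
  unfolding component_def by (rule theI'[of "decomposition G V v"]) (rule decomposition_unique)

lemma component_grade: "\<lbrakk>yd V; v \<in> carrier V; g \<in> carrier G\<rbrakk> \<Longrightarrow> component G V v g \<in> grade V g"
  using decomposition_component[of V v] by (auto simp: decomposition_def dest: PiE_mem)

lemma component_closed: "\<lbrakk>yd V; v \<in> carrier V; g \<in> carrier G\<rbrakk> \<Longrightarrow> component G V v g \<in> carrier V"
  by (rule grade_closed[OF _ _ component_grade])

lemma component_sum: "\<lbrakk>yd V; v \<in> carrier V\<rbrakk> \<Longrightarrow> (\<Oplus>\<^bsub>V\<^esub>g\<in>carrier G. component G V v g) = v"
  using decomposition_component[of V v] by (simp add: decomposition_def)

lemma component_eqI:
  assumes "yd V" "v \<in> carrier V" "\<And>h. h \<in> carrier G \<Longrightarrow> f h \<in> grade V h"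
    and "(\<Oplus>\<^bsub>V\<^esub>h\<in>carrier G. f h) = v" and "g \<in> carrier G"
  shows "component G V v g = f g"
proof -
  interpret V: module K V using assms(1) by simp
  \<comment> \<open>Decompositions are extensional functions, so \<open>f\<close> is cut off outside
    the carrier before uniqueness can be applied to it.\<close>
  have "(\<Oplus>\<^bsub>V\<^esub>h\<in>carrier G. restrict f (carrier G) h) = v"
    unfolding assms(4)[symmetric]
    by (rule V.M.finsum_cong') (auto intro: grade_closed[OF assms(1) _ assms(3)])
  then have "decomposition G V v (restrict f (carrier G))"
    using assms(3) by (auto simp: decomposition_def)
  then have "component G V v = restrict f (carrier G)"
    using decomposition_unique[OF assms(1,2)] decomposition_component[OF assms(1,2)]
    by (metis (no_types))
  then show ?thesis using assms(5) by simp
qed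

lemma component_homogeneous:
  assumes "yd V" "h \<in> carrier G" "v \<in> grade V h" "g \<in> carrier G"
  shows "component G V v g = (if g = h then v else \<zero>\<^bsub>V\<^esub>)"
proof (rule component_eqI[OF assms(1) grade_closed[OF assms(1-3)] _ _ assms(4)])
  interpret V: module K V using assms(1) by simp
  show "(if g = h then v else \<zero>\<^bsub>V\<^esub>) \<in> grade V g" if "g \<in> carrier G" for g
    using assms that by (simp add: grade_zero)
  show "(\<Oplus>\<^bsub>V\<^esub>g\<in>carrier G. if g = h then v else \<zero>\<^bsub>V\<^esub>) = v"
    using V.M.finsum_single[of "carrier G" h "\<lambda>g. if g = h then v else \<zero>\<^bsub>V\<^esub>"] assms finite_G
      grade_closed[OF assms(1-3)] by simp
qed

text \<open>Consequence of uniqueness: sums and multiples of decompositions are again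
  decompositions, now of the sum or multiple.\<close>

lemma component_linear:
  assumes "yd V" "g \<in> carrier G"
  shows "(\<lambda>v. component G V v g) \<in> linear_maps K V V"
proof (rule linear_mapsI)
  interpret V: module K V using assms(1) by simp
  fix v w assume v: "v \<in> carrier V" and w: "w \<in> carrier V"
  note closed = component_closed[OF assms(1) v] component_closed[OF assms(1) w]
  show "component G V (v \<oplus>\<^bsub>V\<^esub> w) g = component G V v g \<oplus>\<^bsub>V\<^esub> component G V w g"
  proof (rule component_eqI[OF assms(1) _ _ _ assms(2)])
    have "(\<Oplus>\<^bsub>V\<^esub>h\<in>carrier G. component G V v h \<oplus>\<^bsub>V\<^esub> component G V w h)
      = (\<Oplus>\<^bsub>V\<^esub>h\<in>carrier G. component G V v h) \<oplus>\<^bsub>V\<^esub> (\<Oplus>\<^bsub>V\<^esub>h\<in>carrier G. component G V w h)"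
      using closed by (intro V.M.finsum_addf) auto
    then show "(\<Oplus>\<^bsub>V\<^esub>h\<in>carrier G. component G V v h \<oplus>\<^bsub>V\<^esub> component G V w h) = v \<oplus>\<^bsub>V\<^esub> w"
      using assms v w by (simp only: component_sum)
  qed (use assms v w in \<open>simp_all add: component_grade grade_add\<close>)
next
  interpret V: module K V using assms(1) by simp
  fix c v assume c: "c \<in> carrier K" and v: "v \<in> carrier V"
  show "component G V (c \<odot>\<^bsub>V\<^esub> v) g = c \<odot>\<^bsub>V\<^esub> component G V v g"
  proof (rule component_eqI[OF assms(1) _ _ _ assms(2)])
    have "c \<odot>\<^bsub>V\<^esub> (\<Oplus>\<^bsub>V\<^esub>h\<in>carrier G. component G V v h) = (\<Oplus>\<^bsub>V\<^esub>h\<in>carrier G. c \<odot>\<^bsub>V\<^esub> component G V v h)"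
      using component_closed[OF assms(1) v] c finite_G by (intro V.finsum_smult_ldistr) auto
    then show "(\<Oplus>\<^bsub>V\<^esub>h\<in>carrier G. c \<odot>\<^bsub>V\<^esub> component G V v h) = c \<odot>\<^bsub>V\<^esub> v"
      using assms v by (simp only: component_sum)
  qed (use assms v c in \<open>simp_all add: component_grade grade_smult\<close>)
next
  show "component G V v g \<in> carrier V" if "v \<in> carrier V" for v
    using assms(1) that assms(2) by (rule component_closed)
qed

lemma generates_homogeneous:
  assumes "yd V"
  shows "generates V (homogeneous G V)"
proof -
  interpret V: module K V using assms by simp
  have A: "homogeneous G V \<subseteq> carrier V" using homogeneous_closed[OF assms] by (rule subsetI)
  have "v \<in> additive_span V (homogeneous G V)" if v: "v \<in> carrier V" for v
  proof -
    have "(\<Oplus>\<^bsub>V\<^esub>g\<in>carrier G. component G V v g) \<in> additive_span V (homogeneous G V)"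
    proof (rule V.M.finsum_mem)
      show "additive_span V (homogeneous G V) \<subseteq> carrier V" using V.M.additive_span_closed[OF A] by blast
      fix g assume "g \<in> carrier G"
      then show "component G V v g \<in> additive_span V (homogeneous G V)"
        using assms v by (intro V.M.additive_span_base[OF A]) (auto intro: homogeneousI component_grade)
    qed (auto intro: additive_span.zero V.M.additive_span_add[OF A])
    then show ?thesis using assms v by (simp add: component_sum)
  qed
  then show ?thesis using A by (auto simp: generates_def)
qed

text \<open>The projections \<open>p g\<close> onto the homogeneous components give existence and uniqueness of the
  decomposition.\<close>

lemma yetter_drinfeldI:
  assumes rep: "rp V"
    and grade: "\<And>g. g \<in> carrier G \<Longrightarrow> grade V g = additive_span V (D g)"
    and D: "\<And>g. g \<in> carrier G \<Longrightarrow> D g \<subseteq> carrier V"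
    and D_smult: "\<And>c g v. \<lbrakk>c \<in> carrier K; g \<in> carrier G; v \<in> D g\<rbrakk> \<Longrightarrow> c \<odot>\<^bsub>V\<^esub> v \<in> D g"
    and D_act: "\<And>g h v. \<lbrakk>g \<in> carrier G; h \<in> carrier G; v \<in> D h\<rbrakk> \<Longrightarrow> act V g v \<in> D (g \<otimes> h \<otimes> inv g)"
    and gen: "generates V (\<Union>g \<in> carrier G. D g)"
    and p: "\<And>g. g \<in> carrier G \<Longrightarrow> additive V V (p g)"
    and p_D: "\<And>g h v. \<lbrakk>g \<in> carrier G; h \<in> carrier G; v \<in> D h\<rbrakk> \<Longrightarrow> p g v = (if g = h then v else \<zero>\<^bsub>V\<^esub>)"
  shows "yd V"
proof -
  interpret V: module K V using rep by simp
  note p_zero = additive_zero[OF V.M.abelian_group_axioms V.M.abelian_group_axioms p]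
  have sub: "additive_span V (D g) \<subseteq> carrier V" if "g \<in> carrier G" for g
    using V.M.additive_span_closed[OF D[OF that]] by blast
  have smult: "c \<odot>\<^bsub>V\<^esub> x \<in> additive_span V (D g)"
    if "c \<in> carrier K" "g \<in> carrier G" "x \<in> additive_span V (D g)" for c g x
    using that(3)
  proof induction
    case zero
    then show ?case using that by (simp add: additive_span.zero)
  next
    case (step a x)
    then have "a \<in> carrier V" "x \<in> carrier V" using that sub D by auto
    then show ?case using step that
      by (simp add: V.smult_r_distr additive_span.step D_smult)
  qed
  have submod: "submodule (grade V g) K V" if "g \<in> carrier G" for g
    unfolding grade[OF that]
  proof (rule V.submoduleI)
    \<comment> \<open>Spans are closed under addition only; a negative is the multiple by minus one,
      hence available through \<open>D_smult\<close>.\<close>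
    fix a assume a: "a \<in> additive_span V (D g)"
    then have "\<ominus>\<^bsub>V\<^esub> a = (\<ominus>\<^bsub>K\<^esub> \<one>\<^bsub>K\<^esub>) \<odot>\<^bsub>V\<^esub> a"
      using sub[OF that] by (subst V.smult_l_minus) auto
    then show "\<ominus>\<^bsub>V\<^esub> a \<in> additive_span V (D g)" using smult[OF _ that a] by simp
  qed (use that sub smult V.M.additive_span_add[OF D] in \<open>auto simp: additive_span.zero\<close>)
  \<comment> \<open>The behaviour of \<open>p g\<close> prescribed on \<open>D h\<close> extends to
    the span, because zero and sums are respected.\<close>
  have p_grade: "p g x = (if g = h then x else \<zero>\<^bsub>V\<^esub>)"
    if "g \<in> carrier G" "h \<in> carrier G" "x \<in> additive_span V (D h)" for g h x
    using that(3)
  proof induction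
    case zero
    then show ?case using that by (simp add: p_zero)
  next
    case (step a x)
    then have "a \<in> carrier V" "x \<in> carrier V" using that sub D by auto
    then show ?case using step that by (simp add: additive_add[OF p] p_D)
  qed
  have p_in: "p g x \<in> additive_span V (D g)" if g: "g \<in> carrier G" and x: "x \<in> carrier V" for g x
    using gen x
  proof (induction rule: V.M.generates_induct)
    case zero
    then show ?case using g by (simp add: p_zero additive_span.zero)
  next
    case (base a)
    then show ?case using g V.M.additive_span_base[OF D] by (auto simp: p_D additive_span.zero)
  next
    case (add x y)
    then show ?case using g V.M.additive_span_add[OF D] by (simp add: additive_add[OF p])
  qed
  have p_closed: "p g x \<in> carrier V" if "g \<in> carrier G" "x \<in> carrier V" for g x
    using p[OF that(1)] that(2) by (rule additive_closed)
  \<comment> \<open>Existence of the decomposition: on a generator of degree \<open>h\<close> only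
    the summand with index \<open>h\<close> survives.\<close>
  have p_sum: "(\<Oplus>\<^bsub>V\<^esub>g\<in>carrier G. p g x) = x" if x: "x \<in> carrier V" for x
    using gen x
  proof (induction rule: V.M.generates_induct)
    case zero
    have "(\<Oplus>\<^bsub>V\<^esub>g\<in>carrier G. p g \<zero>\<^bsub>V\<^esub>) = (\<Oplus>\<^bsub>V\<^esub>g\<in>carrier G. \<zero>\<^bsub>V\<^esub>)"
      by (rule V.M.finsum_cong') (auto simp: p_zero)
    then show ?case by simp
  next
    case (base a)
    then obtain h where h: "h \<in> carrier G" "a \<in> D h" by auto
    have "(\<Oplus>\<^bsub>V\<^esub>g\<in>carrier G. p g a) = p h a"
      using h finite_G D by (intro V.M.finsum_single) (auto simp: p_D)
    then show ?case using h by (simp add: p_D)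
  next
    case (add x y)
    have "(\<Oplus>\<^bsub>V\<^esub>g\<in>carrier G. p g (x \<oplus>\<^bsub>V\<^esub> y)) = (\<Oplus>\<^bsub>V\<^esub>g\<in>carrier G. p g x \<oplus>\<^bsub>V\<^esub> p g y)"
      by (rule V.M.finsum_cong') (use add p_closed in \<open>auto simp: additive_add[OF p]\<close>)
    also have "\<dots> = x \<oplus>\<^bsub>V\<^esub> y"
      using add p_closed by (subst V.M.finsum_addf) auto
    finally show ?case .
  qed
  have dec: "\<exists>!f. decomposition G V v f" if v: "v \<in> carrier V" for v
  proof (rule ex1I)
    have "(\<Oplus>\<^bsub>V\<^esub>g\<in>carrier G. (\<lambda>g\<in>carrier G. p g v) g) = (\<Oplus>\<^bsub>V\<^esub>g\<in>carrier G. p g v)"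
      by (rule V.M.finsum_cong') (use p_closed v in auto)
    then show "decomposition G V v (\<lambda>g\<in>carrier G. p g v)"
      using p_in[OF _ v] p_sum[OF v] by (auto simp: decomposition_def grade)
    fix f assume f: "decomposition G V v f"
    then have fg: "f h \<in> additive_span V (D h)" if "h \<in> carrier G" for h
      using that grade by (auto simp: decomposition_def)
    then have f_closed: "f h \<in> carrier V" if "h \<in> carrier G" for h
      using that sub by blast
    have "f g = p g v" if g: "g \<in> carrier G" for g
    proof -
      \<comment> \<open>Uniqueness: applying \<open>p g\<close> to any decomposition of
        \<open>v\<close> removes every part except the one of degree \<open>g\<close>.\<close>
      have "p g v = p g (\<Oplus>\<^bsub>V\<^esub>h\<in>carrier G. f h)"
        using f by (simp add: decomposition_def)
      also have "\<dots> = (\<Oplus>\<^bsub>V\<^esub>h\<in>carrier G. p g (f h))"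
        using g f_closed by (intro additive_finsum[OF _ _ p]) (auto simp: V.M.abelian_group_axioms)
      also have "\<dots> = p g (f g)"
        using g finite_G f_closed by (intro V.M.finsum_single) (auto simp: p_grade[OF g _ fg])
      finally show ?thesis using g by (simp add: p_grade[OF g g fg])
    qed
    moreover have "f \<in> extensional (carrier G)" using f by (simp add: decomposition_def PiE_def)
    ultimately show "f = (\<lambda>g\<in>carrier G. p g v)"
      by (intro extensionalityI[of _ "carrier G"]) simp_all
  qed
  have act_sub: "act V g x \<in> grade V (g \<otimes> h \<otimes> inv g)"
    if "g \<in> carrier G" "h \<in> carrier G" "x \<in> grade V h" for g h x
  proof -
    have "x \<in> additive_span V (D h)" using that grade by simp
    then have "act V g x \<in> additive_span V (D (g \<otimes> h \<otimes> inv g))"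
    proof induction
      case zero
      then show ?case using that rep
        by (simp add: linear_zero[OF _ _ rep_act_linear] additive_span.zero)
    next
      case (step a x)
      then have "a \<in> carrier V" "x \<in> carrier V" using that sub D by auto
      then show ?case using step that rep
        by (simp add: linear_add[OF rep_act_linear] additive_span.step D_act)
    qed
    then show ?thesis using that grade by simp
  qed
  moreover have "act V g ` grade V h = grade V (g \<otimes> h \<otimes> inv g)"
    if g: "g \<in> carrier G" and h: "h \<in> carrier G" for g h
  proof (intro equalityI subsetI)
    \<comment> \<open>Grades must be carried onto each other, not just into each other. A preimage
      is obtained by acting with \<open>inv g\<close>, which undoes the conjugation of the
      degree.\<close>
    fix x assume x: "x \<in> grade V (g \<otimes> h \<otimes> inv g)"
    then have "act V (inv g) x \<in> grade V (inv g \<otimes> (g \<otimes> h \<otimes> inv g) \<otimes> inv (inv g))"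
      using g h by (intro act_sub) auto
    also have "inv g \<otimes> (g \<otimes> h \<otimes> inv g) \<otimes> inv (inv g) = h"
      using g h by (simp add: m_assoc inv_solve_left')
    finally have "act V (inv g) x \<in> grade V h" .
    moreover have "x \<in> carrier V" using x g h sub[of "g \<otimes> h \<otimes> inv g"] by (auto simp: grade)
    ultimately show "x \<in> act V g ` grade V h"
      using rep g by (intro image_eqI[of _ _ "act V (inv g) x"]) (simp_all add: rep_act_inv)
  qed (use act_sub g h in auto)
  ultimately show ?thesis using rep submod
    unfolding yetter_drinfeld_def by (intro conjI ballI dec)
qed

text \<open>A vector lies in \<open>grade W g\<close> once it equals its own component of degree
  \<open>g\<close>. So it is enough that \<open>f\<close> commutes with the projections, an equality
  of linear maps that is immediate on homogeneous generators.\<close>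

lemma yd_mapsI:
  assumes V: "yd V" and W: "yd W" and f: "f \<in> linear_maps K V W" and gen: "generates V A"
    and act: "\<And>g a. \<lbrakk>g \<in> carrier G; a \<in> A\<rbrakk> \<Longrightarrow> f (act V g a) = act W g (f a)"
    and gr: "\<And>a. a \<in> A \<Longrightarrow> \<exists>g \<in> carrier G. a \<in> grade V g \<and> f a \<in> grade W g"
  shows "f \<in> yd_maps K G V W"
proof -
  have "f (act V g v) = act W g (f v)" if g: "g \<in> carrier G" and v: "v \<in> carrier V" for g v
    by (rule linear_eq_on_carrier[where W = W and f = "\<lambda>v. f (act V g v)" and g = "\<lambda>v. act W g (f v)", OF _ _ _ _ gen])
      (use V W f g v act in \<open>simp_all add: linear_comp[OF rep_act_linear f] linear_comp[OF f rep_act_linear]\<close>)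
  moreover have "f v \<in> grade W g" if g: "g \<in> carrier G" and v: "v \<in> grade V g" for g v
  proof -
    have vc: "v \<in> carrier V" using V g v by (rule grade_closed)
    have "f (component G V v g) = component G W (f v) g"
    proof (rule linear_eq_on_carrier[where W = W and f = "\<lambda>v. f (component G V v g)"
          and g = "\<lambda>v. component G W (f v) g", OF _ _ _ _ gen])
      fix a assume "a \<in> A"
      then obtain h where "h \<in> carrier G" "a \<in> grade V h" "f a \<in> grade W h" using gr by blast
      then show "f (component G V a g) = component G W (f a) g"
        using V W f g by (simp add: component_homogeneous linear_zero)
    qed (use V W f g vc in \<open>simp_all add: linear_comp[OF component_linear f] linear_comp[OF f component_linear]\<close>)
    then show ?thesis
      using V W f g v vc component_grade[OF W linear_closed[OF f vc] g] by (simp add: component_homogeneous)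
  qed
  ultimately show ?thesis using f by (auto simp: yd_maps_def)
qed

lemma yd_maps_linear: "f \<in> yd_maps K G V W \<Longrightarrow> f \<in> linear_maps K V W"
  by (simp add: yd_maps_def)

lemma yd_maps_act:
  "\<lbrakk>f \<in> yd_maps K G V W; g \<in> carrier G; v \<in> carrier V\<rbrakk> \<Longrightarrow> f (act V g v) = act W g (f v)"
  by (simp add: yd_maps_def)

lemma yd_maps_grade: "\<lbrakk>f \<in> yd_maps K G V W; g \<in> carrier G; v \<in> grade V g\<rbrakk> \<Longrightarrow> f v \<in> grade W g"
  unfolding yd_maps_def by blast

end

section \<open>Bilinear maps\<close>

context modules_over
begin

lemma bilinear_left: "\<lbrakk>bilinear K V W T \<phi>; w \<in> carrier W\<rbrakk> \<Longrightarrow> (\<lambda>v. \<phi> v w) \<in> linear_maps K V T"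
  by (simp add: bilinear_def)

lemma bilinear_right: "\<lbrakk>bilinear K V W T \<phi>; v \<in> carrier V\<rbrakk> \<Longrightarrow> \<phi> v \<in> linear_maps K W T"
  by (simp add: bilinear_def)

lemma bilinear_zero:
  assumes "bilinear K V W T \<phi>" "module K V" "module K W" "module K T"
  shows "w \<in> carrier W \<Longrightarrow> \<phi> \<zero>\<^bsub>V\<^esub> w = \<zero>\<^bsub>T\<^esub>" and "v \<in> carrier V \<Longrightarrow> \<phi> v \<zero>\<^bsub>W\<^esub> = \<zero>\<^bsub>T\<^esub>"
  using linear_zero[OF assms(2,4) bilinear_left[OF assms(1)], of w]
    linear_zero[OF assms(3,4) bilinear_right[OF assms(1)], of v] by simp_all

lemma bilinear_comp:
  assumes "bilinear K V W T \<phi>" "f \<in> linear_maps K V' V" "g \<in> linear_maps K W' W"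
  shows "bilinear K V' W' T (\<lambda>v w. \<phi> (f v) (g w))"
  unfolding bilinear_def
proof (intro conjI ballI)
  show "(\<lambda>w. \<phi> (f v) (g w)) \<in> linear_maps K W' T" if "v \<in> carrier V'" for v
    using linear_comp[OF assms(3) bilinear_right[OF assms(1) linear_closed[OF assms(2) that]]] .
  show "(\<lambda>v. \<phi> (f v) (g w)) \<in> linear_maps K V' T" if "w \<in> carrier W'" for w
    using linear_comp[OF assms(2) bilinear_left[OF assms(1) linear_closed[OF assms(3) that]]] .
qed

lemma bilinear_finsum:
  assumes "module K V" "module K W" "module K T" "\<And>i. i \<in> I \<Longrightarrow> bilinear K V W T (\<phi> i)"
  shows "bilinear K V W T (\<lambda>v w. \<Oplus>\<^bsub>T\<^esub>i\<in>I. \<phi> i v w)"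
  unfolding bilinear_def
proof (intro conjI ballI)
  show "(\<lambda>w. \<Oplus>\<^bsub>T\<^esub>i\<in>I. \<phi> i v w) \<in> linear_maps K W T" if "v \<in> carrier V" for v
    by (rule linear_finsum_fun[OF assms(2,3)]) (rule bilinear_right[OF assms(4) that])
  show "(\<lambda>v. \<Oplus>\<^bsub>T\<^esub>i\<in>I. \<phi> i v w) \<in> linear_maps K V T" if "w \<in> carrier W" for w
    by (rule linear_finsum_fun[OF assms(1,3)]) (rule bilinear_left[OF assms(4) that])
qed

text \<open>Whichever entry carries the scalar, it comes out in front of \<open>\<phi> v w\<close>;
  this is the balancing condition.\<close>

lemma balanced_map_of_bilinear:
  assumes "bilinear K V W T \<phi>"
  shows "balanced_map V W (carrier K) (\<lambda>v c. c \<odot>\<^bsub>V\<^esub> v) (\<lambda>c w. c \<odot>\<^bsub>W\<^esub> w) T \<phi>"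
  unfolding balanced_map_def
proof (intro conjI ballI)
  show "\<phi> (c \<odot>\<^bsub>V\<^esub> v) w = \<phi> v (c \<odot>\<^bsub>W\<^esub> w)" if "v \<in> carrier V" "c \<in> carrier K" "w \<in> carrier W" for v c w
    using linear_smult[OF bilinear_left[OF assms that(3)] that(2,1)]
      linear_smult[OF bilinear_right[OF assms that(1)] that(2,3)] by simp
qed (auto intro: linear_additive bilinear_left[OF assms] bilinear_right[OF assms])

end


section \<open>Tensor products\<close>

context yd_modules
begin

context
  fixes V W :: "('g, 'k, 'x) ydo"
  assumes V: "module K V" and W: "module K W"
begin

private abbreviation "T \<equiv> ten V W"

lemma balanced_quotient_tensor:
  "balanced_quotient V W (carrier K) (\<lambda>v c. c \<odot>\<^bsub>V\<^esub> v) (\<lambda>c w. c \<odot>\<^bsub>W\<^esub> w) T"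
  using V W
  by (auto intro!: balanced_quotient.intro balanced_quotient_axioms.intro
      simp: tensor_yd_def tensor_rep_def tensor_class_def rep.defs yd.defs)

interpretation B: balanced_quotient V W "carrier K" "\<lambda>v c. c \<odot>\<^bsub>V\<^esub> v" "\<lambda>c w. c \<odot>\<^bsub>W\<^esub> w" T
  by (rule balanced_quotient_tensor)

private lemma pure_cls: "pure K V W v w = B.cls [(v, w)]"
  by (simp add: pure_def tensor_class_def)

lemma pure_closed [simp]: "\<lbrakk>v \<in> carrier V; w \<in> carrier W\<rbrakk> \<Longrightarrow> pure K V W v w \<in> carrier T"
  by (simp add: pure_cls B.cls1_closed)

lemma generates_pure:
  "\<lbrakk>generates V A; generates W B\<rbrakk> \<Longrightarrow> generates T (pures V W A B)"
  unfolding pure_cls by (rule B.generates_cls1)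

text \<open>The scalar is put on the left entry; moving a second scalar across it uses that
  multiplication in \<open>K\<close> is commutative.\<close>

private lemma smult_balanced:
  assumes "c \<in> carrier K"
  shows "balanced_map V W (carrier K) (\<lambda>v c. c \<odot>\<^bsub>V\<^esub> v) (\<lambda>c w. c \<odot>\<^bsub>W\<^esub> w) T (\<lambda>v w. pure K V W (c \<odot>\<^bsub>V\<^esub> v) w)"
  unfolding balanced_map_def
proof (intro conjI ballI)
  show "pure K V W (c \<odot>\<^bsub>V\<^esub> (d \<odot>\<^bsub>V\<^esub> v)) w = pure K V W (c \<odot>\<^bsub>V\<^esub> v) (d \<odot>\<^bsub>W\<^esub> w)"
    if "v \<in> carrier V" "d \<in> carrier K" "w \<in> carrier W" for v d w
    using B.cls1_balance[of "c \<odot>\<^bsub>V\<^esub> v" d w] that assms V W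
    by (simp add: pure_cls mod_mult_smult[symmetric] K.m_comm)
qed (use assms V W in \<open>auto intro!: additiveI simp: pure_cls B.cls1_closed B.cls1_add_left B.cls1_add_right mod_smult_add\<close>)

private lemma smult_lift:
  assumes "c \<in> carrier K" "x \<in> carrier T"
  shows "c \<odot>\<^bsub>T\<^esub> x = lift T (\<lambda>v w. pure K V W (c \<odot>\<^bsub>V\<^esub> v) w) x"
proof -
  have "c \<odot>\<^bsub>T\<^esub> x = B.cls (map (\<lambda>(v, w). (c \<odot>\<^bsub>V\<^esub> v, w)) (terms x))"
    by (simp add: tensor_yd_def tensor_rep_def tensor_class_def rep.defs yd.defs)
  also have "\<dots> = lift T (\<lambda>v w. B.cls [(c \<odot>\<^bsub>V\<^esub> v, w)]) x"
    by (rule B.cls_map_terms) (use assms V in auto)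
  finally show ?thesis by (simp add: pure_cls)
qed

private lemma smult_additive: "c \<in> carrier K \<Longrightarrow> additive T T (\<lambda>x. c \<odot>\<^bsub>T\<^esub> x)"
  using B.lift_additive[OF B.abelian_group_Q smult_balanced, of c]
  by (simp add: additive_def smult_lift Pi_iff)

lemma smult_pure:
  "\<lbrakk>c \<in> carrier K; v \<in> carrier V; w \<in> carrier W\<rbrakk> \<Longrightarrow> c \<odot>\<^bsub>T\<^esub> pure K V W v w = pure K V W (c \<odot>\<^bsub>V\<^esub> v) w"
  using B.lift_cls1[OF B.abelian_group_Q smult_balanced, of c v w]
  by (simp add: smult_lift) (simp add: pure_cls[abs_def])

text \<open>Multiplication by a fixed scalar is additive, being a lift, so each axiom in the vector
  is an equality of additive maps and is settled on pure tensors.\<close>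

lemma module_tensor: "module K T"
proof (rule moduleI)
  note gen = generates_pure[OF abelian_group.generates_carrier abelian_group.generates_carrier]
  have eq: "f x = g x" if "additive T T f" "additive T T g" "x \<in> carrier T"
    "\<And>v w. \<lbrakk>v \<in> carrier V; w \<in> carrier W\<rbrakk> \<Longrightarrow> f (pure K V W v w) = g (pure K V W v w)" for f g x
    by (rule additive_eq_on_carrier[OF B.abelian_group_Q B.abelian_group_Q that(1,2) gen _ that(3)])
      (use V W that(4) in auto)
  note closed = additive_closed[OF smult_additive]
  fix c d x assume cd: "c \<in> carrier K" "d \<in> carrier K" and x: "x \<in> carrier T"
  show "c \<odot>\<^bsub>T\<^esub> x \<in> carrier T" using smult_additive cd x by (auto intro: additive_closed)
  show "(c \<oplus>\<^bsub>K\<^esub> d) \<odot>\<^bsub>T\<^esub> x = c \<odot>\<^bsub>T\<^esub> x \<oplus>\<^bsub>T\<^esub> d \<odot>\<^bsub>T\<^esub> x"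
  proof (rule eq[OF _ _ x])
    show "additive T T (\<lambda>x. c \<odot>\<^bsub>T\<^esub> x \<oplus>\<^bsub>T\<^esub> d \<odot>\<^bsub>T\<^esub> x)"
      using cd closed by (intro additiveI) (simp_all add: additive_add[OF smult_additive] B.Q.a_ac)
    fix v w assume "v \<in> carrier V" "w \<in> carrier W"
    then show "(c \<oplus>\<^bsub>K\<^esub> d) \<odot>\<^bsub>T\<^esub> pure K V W v w = c \<odot>\<^bsub>T\<^esub> pure K V W v w \<oplus>\<^bsub>T\<^esub> d \<odot>\<^bsub>T\<^esub> pure K V W v w"
      using cd V W by (simp add: smult_pure mod_add_smult, simp add: pure_cls B.cls1_add_left)
  qed (use cd smult_additive in auto)
  show "(c \<otimes>\<^bsub>K\<^esub> d) \<odot>\<^bsub>T\<^esub> x = c \<odot>\<^bsub>T\<^esub> (d \<odot>\<^bsub>T\<^esub> x)"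
  proof (rule eq[OF _ _ x])
    show "additive T T (\<lambda>x. c \<odot>\<^bsub>T\<^esub> (d \<odot>\<^bsub>T\<^esub> x))"
      using cd closed by (intro additiveI) (simp_all add: additive_add[OF smult_additive])
  qed (use cd smult_additive V W in \<open>auto simp: smult_pure mod_mult_smult\<close>)
next
  note gen = generates_pure[OF abelian_group.generates_carrier abelian_group.generates_carrier]
  fix x assume x: "x \<in> carrier T"
  show "\<one>\<^bsub>K\<^esub> \<odot>\<^bsub>T\<^esub> x = x"
    by (rule additive_eq_on_carrier[OF B.abelian_group_Q B.abelian_group_Q _ _ gen _ x])
      (use V W smult_additive in \<open>auto simp: smult_pure intro: additiveI\<close>)
qed (simp_all add: B.abelian_group_Q additive_add[OF smult_additive] K.is_cring)

lemma bilinear_pure: "bilinear K V W T (pure K V W)"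
  using V W B.cls1_balance[symmetric]
  by (auto simp: bilinear_def smult_pure pure_cls B.cls1_add_left B.cls1_add_right B.cls1_closed
      intro!: linear_mapsI simp flip: smult_pure[unfolded pure_cls])

lemma lift_pure:
  assumes "bilinear K V W U \<phi>" "module K U" "v \<in> carrier V" "w \<in> carrier W"
  shows "lift U \<phi> (pure K V W v w) = \<phi> v w"
  unfolding pure_cls
  by (rule B.lift_cls1[OF _ balanced_map_of_bilinear[OF assms(1)]]) (use assms in simp_all)

text \<open>Additivity is inherited from the balanced quotient; compatibility with scalars then has
  to be checked on pure tensors only.\<close>

lemma lift_linear:
  assumes "bilinear K V W U \<phi>" "module K U"
  shows "lift U \<phi> \<in> linear_maps K T U"
proof (rule additive_imp_linear[OF module_tensor assms(2)])
  show "additive T U (lift U \<phi>)"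
    by (rule B.lift_additive[OF _ balanced_map_of_bilinear[OF assms(1)]]) (use assms in simp_all)
  show "generates T (pures V W (carrier V) (carrier W))"
    using V W by (intro generates_pure abelian_group.generates_carrier) simp_all
qed (use V linear_smult[OF bilinear_left[OF assms(1)]] in \<open>auto simp: smult_pure lift_pure[OF assms]\<close>)

lemma act_tensor:
  assumes "act V g \<in> linear_maps K V V" "act W g \<in> linear_maps K W W" "x \<in> carrier T"
  shows "act T g x = lift T (\<lambda>v w. pure K V W (act V g v) (act W g w)) x"
proof -
  have "act T g x = B.cls (map (\<lambda>(v, w). (act V g v, act W g w)) (terms x))"
    by (simp add: tensor_yd_def tensor_rep_def tensor_class_def rep.defs yd.defs)
  also have "\<dots> = lift T (\<lambda>v w. B.cls [(act V g v, act W g w)]) x"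
    by (rule B.cls_map_terms)
      (simp_all add: linear_closed[OF assms(1)] linear_closed[OF assms(2)] assms(3))
  finally show ?thesis by (simp add: pure_cls)
qed

lemma grade_tensor:
  assumes "\<And>g. g \<in> carrier G \<Longrightarrow> grade V g \<subseteq> carrier V" "\<And>g. g \<in> carrier G \<Longrightarrow> grade W g \<subseteq> carrier W"
  shows "grade T x = additive_span T {pure K V W v w | v w. \<exists>g h. g \<in> carrier G \<and> h \<in> carrier G
           \<and> v \<in> grade V g \<and> w \<in> grade W h \<and> g \<otimes> h = x}"
proof -
  have "grade T x = B.cls ` lists {(v, w) | v w g h. g \<in> carrier G \<and> h \<in> carrier G
        \<and> v \<in> grade V g \<and> w \<in> grade W h \<and> g \<otimes> h = x}"
    by (simp add: tensor_yd_def tensor_rep_def tensor_class_def rep.defs yd.defs)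
  also have "\<dots> = additive_span T {B.cls [(v, w)] | v w. (v, w) \<in> {(v, w) | v w g h. g \<in> carrier G \<and> h \<in> carrier G
        \<and> v \<in> grade V g \<and> w \<in> grade W h \<and> g \<otimes> h = x}}"
    by (rule B.cls_image_lists) (use assms in blast)
  finally show ?thesis by (simp add: pure_cls)
qed

end

lemma rep_tensor:
  fixes V W :: "('g, 'k, 'x) ydo"
  assumes V: "rp V" and W: "rp W"
  shows "rp (ten V W)"
    and "\<And>g v w. \<lbrakk>g \<in> carrier G; v \<in> carrier V; w \<in> carrier W\<rbrakk>
      \<Longrightarrow> act (ten V W) g (pure K V W v w) = pure K V W (act V g v) (act W g w)"
proof -
  let ?T = "ten V W"
  have [simp]: "module K V" "module K W" using V W by simp_all
  have [simp]: "module K ?T" by (simp add: module_tensor)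
  have bil: "bilinear K V W ?T (\<lambda>v w. pure K V W (act V g v) (act W g w))" if "g \<in> carrier G" for g
    using V W that by (intro bilinear_comp[OF bilinear_pure]) simp_all
  have act: "act ?T g x = lift ?T (\<lambda>v w. pure K V W (act V g v) (act W g w)) x"
    if "g \<in> carrier G" "x \<in> carrier ?T" for g x
    using V W that by (intro act_tensor) simp_all
  show act_pure: "act ?T g (pure K V W v w) = pure K V W (act V g v) (act W g w)"
    if "g \<in> carrier G" "v \<in> carrier V" "w \<in> carrier W" for g v w
    using that by (simp add: act lift_pure[OF _ _ bil])
  have lin: "act ?T g \<in> linear_maps K ?T ?T" if "g \<in> carrier G" for g
    by (rule linear_cong[OF _ lift_linear[OF _ _ bil]]) (use that act in simp_all)
  have gen: "generates ?T (pures V W (carrier V) (carrier W))"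
    by (intro generates_pure abelian_group.generates_carrier) simp_all
  have "act ?T \<one> x = x" if "x \<in> carrier ?T" for x
    by (rule linear_eq_on_carrier[OF _ _ lin linear_id gen]) (use V W that act_pure in auto)
  moreover have "act ?T (g \<otimes> h) x = act ?T g (act ?T h x)"
    if "g \<in> carrier G" "h \<in> carrier G" "x \<in> carrier ?T" for g h x
    by (rule linear_eq_on_carrier[OF _ _ lin linear_comp[OF lin lin] gen])
      (use V W that act_pure in \<open>auto simp: rep_act_mult\<close>)
  moreover have "finite_dim K ?T"
  proof -
    obtain A B where A: "finite A" "A \<subseteq> carrier V" "generates V {c \<odot>\<^bsub>V\<^esub> b | c b. c \<in> carrier K \<and> b \<in> A}"
      and B: "finite B" "B \<subseteq> carrier W" "generates W {c \<odot>\<^bsub>W\<^esub> b | c b. c \<in> carrier K \<and> b \<in> B}"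
      using V W by (auto simp only: representation_def finite_dim_iff_generates)
    \<comment> \<open>Pairwise products of two spanning families; the two coefficients of a pair
      merge into a single scalar.\<close>
    let ?C = "pures V W A B"
    have "t \<in> {c \<odot>\<^bsub>?T\<^esub> b | c b. c \<in> carrier K \<and> b \<in> ?C}"
      if t: "t \<in> {pure K V W a b | a b. a \<in> {c \<odot>\<^bsub>V\<^esub> b | c b. c \<in> carrier K \<and> b \<in> A} \<and> b \<in> {c \<odot>\<^bsub>W\<^esub> b | c b. c \<in> carrier K \<and> b \<in> B}}" for t
    proof -
      from t obtain a b c d where ab: "a \<in> A" "b \<in> B" and cd: "c \<in> carrier K" "d \<in> carrier K"
        and t: "t = pure K V W (c \<odot>\<^bsub>V\<^esub> a) (d \<odot>\<^bsub>W\<^esub> b)" by blast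
      then have "a \<in> carrier V" "b \<in> carrier W" using A(2) B(2) by auto
      then have "t = (d \<otimes>\<^bsub>K\<^esub> c) \<odot>\<^bsub>?T\<^esub> pure K V W a b"
        using cd linear_smult[OF bilinear_right[OF bilinear_pure[of V W]]]
        by (simp add: t smult_pure mod_mult_smult)
      moreover have "d \<otimes>\<^bsub>K\<^esub> c \<in> carrier K" using cd by simp
      ultimately show ?thesis using ab by blast
    qed
    then have "{pure K V W a b | a b. a \<in> {c \<odot>\<^bsub>V\<^esub> b | c b. c \<in> carrier K \<and> b \<in> A} \<and> b \<in> {c \<odot>\<^bsub>W\<^esub> b | c b. c \<in> carrier K \<and> b \<in> B}}
      \<subseteq> {c \<odot>\<^bsub>?T\<^esub> b | c b. c \<in> carrier K \<and> b \<in> ?C}"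
      by (rule subsetI)
    moreover have "{c \<odot>\<^bsub>?T\<^esub> b | c b. c \<in> carrier K \<and> b \<in> ?C} \<subseteq> carrier ?T"
      using subsetD[OF A(2)] subsetD[OF B(2)] by auto
    ultimately have "generates ?T {c \<odot>\<^bsub>?T\<^esub> b | c b. c \<in> carrier K \<and> b \<in> ?C}"
      using abelian_group.generates_mono[OF _ generates_pure[OF _ _ A(3) B(3)]] by simp
    moreover have "?C = (\<lambda>(a, b). pure K V W a b) ` (A \<times> B)" by auto
    then have "finite ?C" using A(1) B(1) by simp
    moreover have "?C \<subseteq> carrier ?T" using subsetD[OF A(2)] subsetD[OF B(2)] by auto
    ultimately show ?thesis
      unfolding finite_dim_iff_generates[OF \<open>module K ?T\<close>] by (intro exI[of _ ?C] conjI)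
  qed
  ultimately show "rp ?T" using lin unfolding representation_def by simp
qed

context
  fixes V W :: "('g, 'k, 'x) ydo"
  assumes V: "yd V" and W: "yd W"
begin

private abbreviation (input) "VW \<equiv> ten V W"

lemma act_pure:
  "\<lbrakk>g \<in> carrier G; v \<in> carrier V; w \<in> carrier W\<rbrakk>
    \<Longrightarrow> act VW g (pure K V W v w) = pure K V W (act V g v) (act W g w)"
  using V W by (simp add: rep_tensor)

lemma yd_tensor [simp]: "yd VW"
proof -
  have [simp]: "module K V" "module K W" using V W by simp_all
  have [simp]: "module K VW" by (simp add: module_tensor)
  define D where "D x = {pure K V W v w | v w. \<exists>g h. g \<in> carrier G \<and> h \<in> carrier G
           \<and> v \<in> grade V g \<and> w \<in> grade W h \<and> g \<otimes> h = x}" for x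
  \<comment> \<open>Candidate for the projection onto degree \<open>x\<close>: the component of
    \<open>v\<close> in degree \<open>g\<close> contributes to degree \<open>x\<close> exactly when
    paired with the component of \<open>w\<close> in degree
    \<open>inv g \<otimes> x\<close>.\<close>
  define \<phi> where "\<phi> x v w = (\<Oplus>\<^bsub>VW\<^esub>g\<in>carrier G. pure K V W (component G V v g) (component G W w (inv g \<otimes> x)))" for x v w
  have bil: "bilinear K V W VW (\<phi> x)" if "x \<in> carrier G" for x
    unfolding \<phi>_def using V W that
    by (intro bilinear_finsum bilinear_comp[OF bilinear_pure] component_linear) simp_all
  show ?thesis
  proof (rule yetter_drinfeldI[where D = D and p = "\<lambda>x. lift VW (\<phi> x)"])
    show "rp VW" using V W by (simp add: rep_tensor)
    show "grade VW x = additive_span VW (D x)" for x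
      unfolding D_def using V W by (intro grade_tensor grade_subset) simp_all
    show "D x \<subseteq> carrier VW" for x
      using V W by (auto simp: D_def intro!: pure_closed intro: grade_closed)
    show "c \<odot>\<^bsub>VW\<^esub> t \<in> D x" if "c \<in> carrier K" "t \<in> D x" for c x t
      using that(2) V W grade_smult[OF V _ that(1)] grade_closed[OF V] grade_closed[OF W]
      by (force simp: D_def smult_pure that(1))
    show "act VW g t \<in> D (g \<otimes> x \<otimes> inv g)" if g: "g \<in> carrier G" "x \<in> carrier G" and "t \<in> D x" for g x t
    proof -
      from that(3) obtain v w a b where ab: "a \<in> carrier G" "b \<in> carrier G" "v \<in> grade V a" "w \<in> grade W b"
        "a \<otimes> b = x" "t = pure K V W v w" by (auto simp: D_def)
      have "act VW g t = pure K V W (act V g v) (act W g w)"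
        using ab g V W by (simp add: act_pure grade_closed[OF V] grade_closed[OF W])
      moreover have "act V g v \<in> grade V (g \<otimes> a \<otimes> inv g)" "act W g w \<in> grade W (g \<otimes> b \<otimes> inv g)"
        using ab g V W by (simp_all add: grade_act)
      \<comment> \<open>Conjugation by \<open>g\<close> is multiplicative, so the translate has the
        conjugate of \<open>x\<close> as its degree.\<close>
      moreover have "(g \<otimes> a \<otimes> inv g) \<otimes> (g \<otimes> b \<otimes> inv g) = g \<otimes> x \<otimes> inv g"
        using ab(1,2) g unfolding ab(5)[symmetric] by (simp add: m_assoc inv_solve_left')
      moreover have "g \<otimes> a \<otimes> inv g \<in> carrier G" "g \<otimes> b \<otimes> inv g \<in> carrier G" using ab g by simp_all
      ultimately show ?thesis unfolding D_def by blast
    qed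
    have "(pures V W (homogeneous G V) (homogeneous G W)) \<subseteq> (\<Union>x \<in> carrier G. D x)"
      by (force simp: homogeneous_def D_def)
    then show "generates VW (\<Union>x \<in> carrier G. D x)"
      using abelian_group.generates_mono[OF _ generates_pure[OF _ _ generates_homogeneous[OF V] generates_homogeneous[OF W]]]
        \<open>\<And>x. D x \<subseteq> carrier VW\<close> by (simp add: UN_least)
    show "additive VW VW (lift VW (\<phi> x))" if "x \<in> carrier G" for x
      using lift_linear[OF _ _ bil[OF that]] by (simp add: linear_additive)
    show "lift VW (\<phi> x) t = (if x = y then t else \<zero>\<^bsub>VW\<^esub>)"
      if x: "x \<in> carrier G" and y: "y \<in> carrier G" and "t \<in> D y" for x y t
    proof -
      from that(3) obtain v w a b where ab: "a \<in> carrier G" "b \<in> carrier G" "v \<in> grade V a" "w \<in> grade W b"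
        "a \<otimes> b = y" "t = pure K V W v w" by (auto simp: D_def)
      interpret T: module K VW by simp
      have vw: "v \<in> carrier V" "w \<in> carrier W" using ab V W grade_closed by auto
      note zero = bilinear_zero[OF bilinear_pure, of V W]
      have "lift VW (\<phi> x) t = \<phi> x v w"
        using vw by (simp add: ab(6) lift_pure[OF _ _ bil[OF x]])
      \<comment> \<open>\<open>v\<close> lives in degree \<open>a\<close>, so the other summands
        vanish. What remains depends on whether \<open>inv a \<otimes> x\<close> is the degree
        \<open>b\<close> of \<open>w\<close>.\<close>
      also have "\<dots> = pure K V W (component G V v a) (component G W w (inv a \<otimes> x))"
        unfolding \<phi>_def
        by (rule T.M.finsum_single)
          (use ab x vw finite_G V W in \<open>auto simp: component_homogeneous[OF V _ ab(3)] zero component_closed\<close>)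
      also have "\<dots> = pure K V W v (if inv a \<otimes> x = b then w else \<zero>\<^bsub>W\<^esub>)"
        using ab x by (simp add: component_homogeneous[OF V _ ab(3)] component_homogeneous[OF W _ ab(4)])
      also have "inv a \<otimes> x = b \<longleftrightarrow> x = y"
        using ab x by (metis inv_closed inv_solve_left' m_closed)
      finally show ?thesis using vw by (simp add: ab(6) zero)
    qed
  qed
qed

lemma pure_grade:
  "\<lbrakk>g \<in> carrier G; h \<in> carrier G; v \<in> grade V g; w \<in> grade W h\<rbrakk> \<Longrightarrow> pure K V W v w \<in> grade VW (g \<otimes> h)"
  using V W
  by (subst grade_tensor)
    (auto intro!: abelian_group.additive_span_base pure_closed simp: module_tensor grade_subset intro: grade_closed)

end

end


section \<open>The category of Yetter--Drinfeld modules\<close>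

lemma src_arrow_of [simp]: "src (arrow_of V W \<phi>) = V"
  and tgt_arrow_of [simp]: "tgt (arrow_of V W \<phi>) = W"
  and fn_arrow_of [simp]: "v \<in> carrier V \<Longrightarrow> fn (arrow_of V W \<phi>) v = \<phi> v"
  by (simp_all add: arrow_of_def)

text \<open>A name for the left unitor of \<open>YD\<close>, so that rewriting meets a constant
  rather than a \<open>lift\<close> and can use its value on pure tensors.\<close>

definition lunit_yd where
  "lunit_yd K G V = arrow_of (tensor_yd K G (unit_yd K G) V) V (lift V (\<lambda>c v. scalar c \<odot>\<^bsub>V\<^esub> v))"

definition runit_yd where
  "runit_yd K G V = arrow_of (tensor_yd K G V (unit_yd K G)) V (lift V (\<lambda>v c. scalar c \<odot>\<^bsub>V\<^esub> v))"

text \<open>The Frobenius relations mention the inverse associator through the definite description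
  \<open>inv_arrow\<close>; \<open>inverse_assoc\<close> and \<open>inv_arrow_eq\<close> identify it
  with this explicit map.\<close>

definition assoc_inv_yd where
  "assoc_inv_yd K G V W U = (let T = tensor_yd K G (tensor_yd K G V W) U in
     arrow_of (tensor_yd K G V (tensor_yd K G W U)) T
       (lift T (\<lambda>v x. lift T (\<lambda>w u. pure K (tensor_yd K G V W) U (pure K V W v w) u) x)))"

lemma YD_simps [simp]:
  "Dom (YD K G) = src" "Cod (YD K G) = tgt"
  "Ident (YD K G) V = arrow_of V V (\<lambda>v. v)"
  "TenO (YD K G) = tensor_yd K G" "TenA (YD K G) = tensor_arrow K G" "UnitO (YD K G) = unit_yd K G"
  "Assoc (YD K G) = assoc_yd K G" "LUnit (YD K G) = lunit_yd K G" "RUnit (YD K G) = runit_yd K G"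
  by (simp_all add: YD_def lunit_yd_def runit_yd_def fun_eq_iff)

lemma Obj_YD [simp]: "V \<in> Obj (YD K G) \<longleftrightarrow> yetter_drinfeld K G V"
  by (simp add: YD_def)

text \<open>Arrows carry functions cut off outside the source. Extensionality is recorded because it
  turns agreement on the carrier into equality of arrows.\<close>

lemma Arr_YD:
  "f \<in> Arr (YD K G) \<longleftrightarrow> yetter_drinfeld K G (src f) \<and> yetter_drinfeld K G (tgt f)
     \<and> fn f \<in> yd_maps K G (src f) (tgt f) \<and> fn f \<in> extensional (carrier (src f))"
proof
  assume "yetter_drinfeld K G (src f) \<and> yetter_drinfeld K G (tgt f)
     \<and> fn f \<in> yd_maps K G (src f) (tgt f) \<and> fn f \<in> extensional (carrier (src f))"
  moreover from this have "f = arrow_of (src f) (tgt f) (fn f)"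
    by (cases f) (simp add: arrow_of_def extensional_restrict)
  ultimately show "f \<in> Arr (YD K G)" by (force simp: YD_def)
next
  assume "f \<in> Arr (YD K G)"
  then obtain V W \<phi> where *: "f = arrow_of V W \<phi>" "yetter_drinfeld K G V" "yetter_drinfeld K G W"
    "\<phi> \<in> yd_maps K G V W" by (auto simp: YD_def)
  then have "module K V" by (auto simp only: yetter_drinfeld_def representation_def)
  then have V: "abelian_group V" by (rule module.axioms)
  interpret V: module K V by fact
  \<comment> \<open>Cutting \<open>\<phi>\<close> off at the carrier does no harm, since translates
    and graded pieces stay inside it.\<close>
  have cl: "act V g v \<in> carrier V" if "g \<in> carrier G" "v \<in> carrier V" for g v
    using *(2) that by (auto simp only: yetter_drinfeld_def representation_def linear_maps_def)
  have gr: "v \<in> carrier V" if "g \<in> carrier G" "v \<in> grade V g" for g v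
    using *(2) that V.submoduleE(1) by (auto simp only: yetter_drinfeld_def)
  have "restrict \<phi> (carrier V) \<in> yd_maps K G V W"
    using *(4) cl gr by (auto simp: yd_maps_def linear_maps_def image_subset_iff)
  then show "yetter_drinfeld K G (src f) \<and> yetter_drinfeld K G (tgt f)
     \<and> fn f \<in> yd_maps K G (src f) (tgt f) \<and> fn f \<in> extensional (carrier (src f))"
    using * by (simp add: arrow_of_def)
qed

lemma Hom_YD [simp]: "f \<in> Hom (YD K G) X Y \<longleftrightarrow> f \<in> Arr (YD K G) \<and> src f = X \<and> tgt f = Y"
  by (simp add: Hom_def)

lemma src_comp [simp]: "src (g \<cdot>\<^bsub>YD K G\<^esub> f) = src f"
  and tgt_comp [simp]: "tgt (g \<cdot>\<^bsub>YD K G\<^esub> f) = tgt g"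
  and fn_comp [simp]: "v \<in> carrier (src f) \<Longrightarrow> fn (g \<cdot>\<^bsub>YD K G\<^esub> f) v = fn g (fn f v)"
  by (simp_all add: YD_def)

lemma comp_arrow_of: "g \<cdot>\<^bsub>YD K G\<^esub> f = arrow_of (src f) (tgt g) (\<lambda>v. fn g (fn f v))"
  by (simp add: YD_def)

lemma src_tensor_arrow [simp]: "src (tensor_arrow K G f g) = tensor_yd K G (src f) (src g)"
  and tgt_tensor_arrow [simp]: "tgt (tensor_arrow K G f g) = tensor_yd K G (tgt f) (tgt g)"
  by (simp_all add: tensor_arrow_def Let_def)

lemma src_tgt_yd [simp]:
  "src (assoc_yd K G V W U) = tensor_yd K G (tensor_yd K G V W) U"
  "tgt (assoc_yd K G V W U) = tensor_yd K G V (tensor_yd K G W U)"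
  "src (assoc_inv_yd K G V W U) = tensor_yd K G V (tensor_yd K G W U)"
  "tgt (assoc_inv_yd K G V W U) = tensor_yd K G (tensor_yd K G V W) U"
  "src (lunit_yd K G V) = tensor_yd K G (unit_yd K G) V" "tgt (lunit_yd K G V) = V"
  "src (runit_yd K G V) = tensor_yd K G V (unit_yd K G)" "tgt (runit_yd K G V) = V"
  "src (braiding K G V W) = tensor_yd K G V W" "tgt (braiding K G V W) = tensor_yd K G W V"
  by (simp_all add: assoc_yd_def assoc_inv_yd_def lunit_yd_def runit_yd_def braiding_def Let_def)

context yd_modules
begin

abbreviation arr :: "('g, 'k, 'x) yda \<Rightarrow> bool" where "arr f \<equiv> f \<in> Arr (YD K G)"

lemma arr_src [simp]: "arr f \<Longrightarrow> yd (src f)" and arr_tgt [simp]: "arr f \<Longrightarrow> yd (tgt f)"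
  by (simp_all add: Arr_YD)

lemma arr_yd_maps: "arr f \<Longrightarrow> fn f \<in> yd_maps K G (src f) (tgt f)"
  and arr_extensional: "arr f \<Longrightarrow> fn f \<in> extensional (carrier (src f))"
  by (simp_all only: Arr_YD)

lemma arr_linear: "arr f \<Longrightarrow> fn f \<in> linear_maps K (src f) (tgt f)"
  by (rule yd_maps_linear[OF arr_yd_maps])

lemma fn_closed [simp]: "\<lbrakk>arr f; tgt f = W; v \<in> carrier (src f)\<rbrakk> \<Longrightarrow> fn f v \<in> carrier W"
  using linear_closed[OF arr_linear, of f v] by simp

lemma arr_arrow_of:
  assumes "yd V" "yd W" "\<phi> \<in> yd_maps K G V W"
  shows "arr (arrow_of V W \<phi>)"
  using assms by (auto simp: YD_def)

lemma yd_maps_comp: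
  assumes f: "f \<in> yd_maps K G V W" and g: "g \<in> yd_maps K G W U"
  shows "(\<lambda>v. g (f v)) \<in> yd_maps K G V U"
  using linear_comp[OF yd_maps_linear[OF f] yd_maps_linear[OF g]] yd_maps_grade[OF f] yd_maps_grade[OF g]
    linear_closed[OF yd_maps_linear[OF f]] f g
  by (simp add: yd_maps_def image_subset_iff)

lemma arr_ident [simp]: "yd V \<Longrightarrow> arr (arrow_of V V (\<lambda>v. v))"
  by (rule arr_arrow_of) (auto simp: yd_maps_def linear_id)

lemma arr_comp [simp]: "\<lbrakk>arr f; arr g; src g = tgt f\<rbrakk> \<Longrightarrow> arr (g \<cdot>\<^bsub>YD K G\<^esub> f)"
  using arr_arrow_of[OF arr_src arr_tgt yd_maps_comp[OF arr_yd_maps], of f g "fn g"] arr_yd_maps[of g]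
  by (simp add: comp_arrow_of)

text \<open>The test to which the axioms are submitted: values on a generating set of the source
  decide, as the functions are linear and extensional.\<close>

lemma arr_eqI:
  assumes f: "arr f" and g: "arr g" and "src f = src g" "tgt f = tgt g" "generates (src g) A"
    and "\<And>a. a \<in> A \<Longrightarrow> fn f a = fn g a"
  shows "f = g"
proof -
  have "fn f v = fn g v" if "v \<in> carrier (src g)" for v
    by (rule linear_eq_on_carrier[where W = "tgt g", OF _ _ _ arr_linear[OF g] assms(5)])
      (use assms(3,4,6) that arr_linear[OF f] f g in simp_all)
  then have "fn f = fn g"
    using arr_extensional[OF f] arr_extensional[OF g] assms(3)
    by (intro extensionalityI[of _ "carrier (src g)"]) simp_all
  then show ?thesis using assms(3,4) by (cases f, cases g) simp
qed

lemma inverse_arrowsI: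
  assumes f: "arr f" and g: "arr g" and sg: "src g = tgt f" and tg: "tgt g = src f"
    and A: "generates (src f) A" and B: "generates (tgt f) B"
    and gf: "\<And>a. a \<in> A \<Longrightarrow> fn g (fn f a) = a" and fg: "\<And>b. b \<in> B \<Longrightarrow> fn f (fn g b) = b"
  shows "inverse_arrows (YD K G) f g"
  unfolding inverse_arrows_def
proof (intro conjI)
  show "g \<cdot>\<^bsub>YD K G\<^esub> f = Ident (YD K G) (Dom (YD K G) f)"
    by (rule arr_eqI[where A = A]) (use assms generates_subset[OF A] in simp_all)
  show "f \<cdot>\<^bsub>YD K G\<^esub> g = Ident (YD K G) (Cod (YD K G) f)"
    by (rule arr_eqI[where A = B]) (use assms generates_subset[OF B] in simp_all)
qed (use assms in simp_all)

lemma YD_category: "category (YD K G)"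
proof
  fix f g h and X Y Z W :: "('g, 'k, 'x) ydo"
  assume "f \<in> Hom (YD K G) X Y" "g \<in> Hom (YD K G) Y Z" "h \<in> Hom (YD K G) Z W"
  then show "h \<cdot>\<^bsub>YD K G\<^esub> (g \<cdot>\<^bsub>YD K G\<^esub> f) = h \<cdot>\<^bsub>YD K G\<^esub> g \<cdot>\<^bsub>YD K G\<^esub> f"
    by (intro arr_eqI[OF _ _ _ _ abelian_group.generates_carrier]) auto
next
  fix f and X Y :: "('g, 'k, 'x) ydo"
  assume "f \<in> Hom (YD K G) X Y"
  then show "f \<cdot>\<^bsub>YD K G\<^esub> Ident (YD K G) X = f" "Ident (YD K G) Y \<cdot>\<^bsub>YD K G\<^esub> f = f"
    by (auto intro!: arr_eqI[OF _ _ _ _ abelian_group.generates_carrier])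
qed auto

text \<open>Two-sided inverses are unique, so the definite description can be replaced by an
  explicit inverse once one is known.\<close>

lemma inv_arrow_eq:
  assumes "inverse_arrows (YD K G) f g"
  shows "inv_arrow (YD K G) f = g"
  unfolding inv_arrow_def
proof (rule the_equality[of "inverse_arrows (YD K G) f", OF assms])
  interpret category "YD K G" by (rule YD_category)
  fix h assume h: "inverse_arrows (YD K G) f h"
  have "h = h \<cdot>\<^bsub>YD K G\<^esub> (f \<cdot>\<^bsub>YD K G\<^esub> g)"
    using comp_ident[of h] h assms by (simp add: inverse_arrows_def)
  also have "\<dots> = (h \<cdot>\<^bsub>YD K G\<^esub> f) \<cdot>\<^bsub>YD K G\<^esub> g"
    using h assms by (intro comp_assoc[of _ "tgt f" "src f" _ "tgt f" _ "src f"]) (simp_all add: inverse_arrows_def)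
  also have "\<dots> = g"
    using ident_comp[of g] h assms by (simp add: inverse_arrows_def)
  finally show "h = g" .
qed

lemma iso_arrowI: "inverse_arrows (YD K G) f g \<Longrightarrow> iso_arrow (YD K G) f"
  by (auto simp: iso_arrow_def)

end

lemma bilinear_flip: "bilinear K V W T \<phi> \<longleftrightarrow> bilinear K W V T (\<lambda>w v. \<phi> v w)"
  by (auto simp: bilinear_def)

section \<open>The unit object\<close>

lemma Scalar_unit_yd [simp]: "Scalar c \<in> carrier (unit_yd K G) \<longleftrightarrow> c \<in> carrier K"
  by (auto simp: unit_yd_def)

lemma act_unit_yd [simp]: "act (unit_yd K G) g = (\<lambda>x. x)"
  by (simp add: unit_yd_def)

lemma scalar_unit_yd [simp]: "x \<in> carrier (unit_yd K G) \<Longrightarrow> scalar x \<in> carrier K"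
  by (auto simp: unit_yd_def)

context yd_modules
begin

lemma module_unit_yd [simp]: "module K (Unit :: ('g, 'k, 'x) ydo)"
proof (rule moduleI)
  let ?I = "Unit :: ('g, 'k, 'x) ydo"
  show "abelian_group ?I"
  proof (rule abelian_groupI)
    fix x assume "x \<in> carrier ?I"
    then obtain c where "c \<in> carrier K" "x = Scalar c" by (auto simp: unit_yd_def)
    then show "\<exists>y\<in>carrier ?I. y \<oplus>\<^bsub>?I\<^esub> x = \<zero>\<^bsub>?I\<^esub>"
      by (intro bexI[of _ "Scalar (\<ominus>\<^bsub>K\<^esub> c)"]) (simp_all add: unit_yd_def K.l_neg)
  qed (auto simp: unit_yd_def K.a_ac)
qed (auto simp: unit_yd_def K.l_distr K.r_distr K.m_assoc K.is_cring)

lemma rep_unit_yd: "rp (Unit :: ('g, 'k, 'x) ydo)"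
proof -
  let ?I = "Unit :: ('g, 'k, 'x) ydo"
  have "finite_dim K ?I"
    unfolding finite_dim_iff_generates[OF module_unit_yd]
  proof (intro exI[of _ "{Scalar \<one>\<^bsub>K\<^esub>}"] conjI)
    have "carrier ?I \<subseteq> {c \<odot>\<^bsub>?I\<^esub> b |c b. c \<in> carrier K \<and> b \<in> {Scalar \<one>\<^bsub>K\<^esub>}}"
      by (force simp: unit_yd_def)
    moreover have "{c \<odot>\<^bsub>?I\<^esub> b |c b. c \<in> carrier K \<and> b \<in> {Scalar \<one>\<^bsub>K\<^esub>}} \<subseteq> carrier ?I"
      by auto
    ultimately have eq: "{c \<odot>\<^bsub>?I\<^esub> b |c b. c \<in> carrier K \<and> b \<in> {Scalar \<one>\<^bsub>K\<^esub>}} = carrier ?I"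
      by (rule subset_antisym[rotated])
    show "generates ?I {c \<odot>\<^bsub>?I\<^esub> b |c b. c \<in> carrier K \<and> b \<in> {Scalar \<one>\<^bsub>K\<^esub>}}"
      unfolding eq by (intro abelian_group.generates_carrier) simp
  qed auto
  then show ?thesis
    unfolding representation_def by (simp add: linear_id)
qed

lemma yd_unit [simp]: "yd (Unit :: ('g, 'k, 'x) ydo)"
proof -
  let ?I = "Unit :: ('g, 'k, 'x) ydo"
  let ?D = "\<lambda>g. if g = \<one> then carrier ?I else {\<zero>\<^bsub>?I\<^esub>}"
  interpret I: module K ?I by simp
  have D: "?D g \<subseteq> carrier ?I" for g by auto
  show ?thesis
  proof (rule yetter_drinfeldI[where D = ?D and p = "\<lambda>g x. if g = \<one> then x else \<zero>\<^bsub>?I\<^esub>"])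
    fix g assume "g \<in> carrier G"
    have grade: "grade ?I g = ?D g" by (simp add: unit_yd_def)
    show "grade ?I g = additive_span ?I (?D g)"
    proof
      show "grade ?I g \<subseteq> additive_span ?I (?D g)"
        unfolding grade using I.M.additive_span_base[OF D] by blast
      show "additive_span ?I (?D g) \<subseteq> grade ?I g"
        unfolding grade
        by (rule subsetI, rule I.M.additive_span_least[where A = "?D g"]) (auto split: if_splits)
    qed
  next
    show "generates ?I (\<Union>g\<in>carrier G. ?D g)"
      by (rule I.M.generates_mono[OF I.M.generates_carrier]) (auto split: if_splits)
  next
    fix g h v assume "g \<in> carrier G" "h \<in> carrier G" "v \<in> ?D h"
    then show "act ?I g v \<in> ?D (g \<otimes> h \<otimes> inv g)"
      by (auto split: if_splits)
  qed (auto simp: rep_unit_yd intro: additiveI split: if_splits)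
qed

lemma unit_grade: "c \<in> carrier (Unit) \<Longrightarrow> c \<in> grade (Unit) \<one>"
  by (simp add: unit_yd_def)

lemma scalar_smult_bilinear:
  assumes "module K V"
  shows "bilinear K (Unit) V V (\<lambda>c v. scalar c \<odot>\<^bsub>V\<^esub> v)"
  unfolding bilinear_def
proof (intro conjI ballI)
  fix v assume "v \<in> carrier V"
  then show "(\<lambda>c. scalar c \<odot>\<^bsub>V\<^esub> v) \<in> linear_maps K (Unit) V"
    using assms by (auto intro!: linear_mapsI simp: unit_yd_def mod_add_smult mod_mult_smult)
qed (use assms in \<open>auto intro!: linear_scale linear_id\<close>)

text \<open>\<open>A\<close> and \<open>B\<close> stay parameters so that in a threefold product one
  of them can be a set of pure tensors of homogeneous vectors. Since their elements are homogeneous,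
  pure tensors have a known degree and \<open>yd_mapsI\<close> applies.\<close>

lemma lift_yd_maps:
  assumes V: "yd V" and W: "yd W" and U: "yd U" and \<phi>: "bilinear K V W U \<phi>"
    and A: "generates V A" and B: "generates W B"
    and act: "\<And>g v w. \<lbrakk>g \<in> carrier G; v \<in> A; w \<in> B\<rbrakk> \<Longrightarrow> \<phi> (act V g v) (act W g w) = act U g (\<phi> v w)"
    and gr: "\<And>v w. \<lbrakk>v \<in> A; w \<in> B\<rbrakk>
      \<Longrightarrow> \<exists>g \<in> carrier G. \<exists>h \<in> carrier G. v \<in> grade V g \<and> w \<in> grade W h \<and> \<phi> v w \<in> grade U (g \<otimes> h)"
  shows "lift U \<phi> \<in> yd_maps K G (ten V W) U"
proof (rule yd_mapsI[OF yd_tensor[OF V W] U])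
  note [simp] = lift_pure[OF _ _ \<phi>] V W U generates_subset[OF A] generates_subset[OF B]
  show "lift U \<phi> \<in> linear_maps K (ten V W) U"
    by (rule lift_linear[OF _ _ \<phi>]) simp_all
  show "generates (ten V W) (pures V W A B)"
    by (rule generates_pure[OF _ _ A B]) simp_all
  show "lift U \<phi> (act (ten V W) g a) = act U g (lift U \<phi> a)"
    if "g \<in> carrier G" "a \<in> pures V W A B" for g a
    using that by (auto simp: act_pure act)
  fix a assume "a \<in> pures V W A B"
  then obtain v w where a: "a = pure K V W v w" "v \<in> A" "w \<in> B" by blast
  from gr[OF a(2,3)] obtain g h where "g \<in> carrier G" "h \<in> carrier G" "v \<in> grade V g" "w \<in> grade W h"
    "\<phi> v w \<in> grade U (g \<otimes> h)" by blast
  then show "\<exists>g\<in>carrier G. a \<in> grade (ten V W) g \<and> lift U \<phi> a \<in> grade U g"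
    using a(2,3) by (intro bexI[of _ "g \<otimes> h"]) (simp_all add: a(1) pure_grade)
qed

lemma tensor_arrow_bilinear:
  assumes "arr f" "arr g"
  shows "bilinear K (src f) (src g) (ten (tgt f) (tgt g)) (\<lambda>v w. pure K (tgt f) (tgt g) (fn f v) (fn g w))"
  using assms by (intro bilinear_comp[OF bilinear_pure] arr_linear) simp_all

lemma arr_tensor_arrow [simp]:
  assumes f: "arr f" and g: "arr g"
  shows "arr (tensor_arrow K G f g)"
  unfolding tensor_arrow_def Let_def
proof (rule arr_arrow_of)
  show "lift (ten (tgt f) (tgt g)) (\<lambda>v w. pure K (tgt f) (tgt g) (fn f v) (fn g w))
    \<in> yd_maps K G (ten (src f) (src g)) (ten (tgt f) (tgt g))"
  proof (rule lift_yd_maps[OF _ _ _ tensor_arrow_bilinear[OF f g] generates_homogeneous generates_homogeneous])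
    fix k v w assume "k \<in> carrier G" "v \<in> homogeneous G (src f)" "w \<in> homogeneous G (src g)"
    then show "pure K (tgt f) (tgt g) (fn f (act (src f) k v)) (fn g (act (src g) k w))
      = act (ten (tgt f) (tgt g)) k (pure K (tgt f) (tgt g) (fn f v) (fn g w))"
      using f g by (simp add: act_pure homogeneous_closed yd_maps_act[OF arr_yd_maps])
  next
    fix v w assume "v \<in> homogeneous G (src f)" "w \<in> homogeneous G (src g)"
    then obtain a b where ab: "a \<in> carrier G" "b \<in> carrier G" "v \<in> grade (src f) a" "w \<in> grade (src g) b"
      by (auto simp: homogeneous_def)
    then show "\<exists>a \<in> carrier G. \<exists>b \<in> carrier G. v \<in> grade (src f) a \<and> w \<in> grade (src g) b
      \<and> pure K (tgt f) (tgt g) (fn f v) (fn g w) \<in> grade (ten (tgt f) (tgt g)) (a \<otimes> b)"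
      using f g by (intro bexI[of _ a] bexI[of _ b]) (simp_all add: pure_grade yd_maps_grade[OF arr_yd_maps])
  qed (use f g in simp_all)
qed (use f g in simp_all)

text \<open>The sources appear as variables with equations because a pure tensor in a goal is formed
  over the objects themselves, not over \<open>src f\<close> and \<open>src g\<close>.\<close>

lemma fn_tensor_arrow [simp]:
  assumes "arr f" "arr g" "src f = V" "src g = W" "v \<in> carrier V" "w \<in> carrier W"
  shows "fn (tensor_arrow K G f g) (pure K V W v w) = pure K (tgt f) (tgt g) (fn f v) (fn g w)"
proof -
  have "yd V" "yd W" using assms(1-4) by auto
  moreover have "module K (ten (tgt f) (tgt g))" using assms(1,2) by simp
  ultimately show ?thesis
    using assms lift_pure[OF _ _ tensor_arrow_bilinear[OF assms(1,2)], of v w] by (simp add: tensor_arrow_def Let_def)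
qed

text \<open>For fixed \<open>u\<close> this is the universal property. Linearity in \<open>u\<close>
  at an arbitrary \<open>x\<close> has no formula to start from; \<open>linear_param\<close> obtains
  it from pure tensors, where the last assumption provides it.\<close>

lemma nested_bilinear_left:
  assumes "module K V" "module K W" "module K U" "module K T"
    and "\<And>u. u \<in> carrier U \<Longrightarrow> bilinear K V W T (\<psi> u)"
    and "\<And>v w. \<lbrakk>v \<in> carrier V; w \<in> carrier W\<rbrakk> \<Longrightarrow> (\<lambda>u. \<psi> u v w) \<in> linear_maps K U T"
  shows "bilinear K (ten V W) U T (\<lambda>x u. lift T (\<psi> u) x)"
  unfolding bilinear_def
proof (intro conjI ballI)
  note lin = lift_linear[OF assms(1,2,5,4)]
  show "(\<lambda>x. lift T (\<psi> u) x) \<in> linear_maps K (ten V W) T" if "u \<in> carrier U" for u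
    using lin[OF that] by simp
  show "(\<lambda>u. lift T (\<psi> u) x) \<in> linear_maps K U T" if x: "x \<in> carrier (ten V W)" for x
  proof (rule linear_param[OF assms(3) module_tensor[OF assms(1,2)] assms(4) _ lin _ x])
    show "generates (ten V W) (pures V W (carrier V) (carrier W))"
      using assms by (intro generates_pure abelian_group.generates_carrier) simp_all
    show "(\<lambda>u. lift T (\<psi> u) a) \<in> linear_maps K U T"
      if "a \<in> pures V W (carrier V) (carrier W)" for a
    proof -
      from that obtain v w where a: "a = pure K V W v w" "v \<in> carrier V" "w \<in> carrier W" by blast
      show ?thesis
        by (rule linear_cong[OF assms(3) assms(6)[OF a(2,3)]])
          (simp add: a lift_pure[OF assms(1,2,5,4)])
    qed
  qed
qed

lemma nested_bilinear_right:
  assumes "module K V" "module K W" "module K U" "module K T"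
    and "\<And>u. u \<in> carrier U \<Longrightarrow> bilinear K V W T (\<psi> u)"
    and "\<And>v w. \<lbrakk>v \<in> carrier V; w \<in> carrier W\<rbrakk> \<Longrightarrow> (\<lambda>u. \<psi> u v w) \<in> linear_maps K U T"
  shows "bilinear K U (ten V W) T (\<lambda>u x. lift T (\<psi> u) x)"
  by (subst bilinear_flip) (rule nested_bilinear_left[OF assms])

lemma pure_zero [simp]:
  fixes V W :: "('g, 'k, 'x) ydo"
  assumes "module K V" "module K W"
  shows "w \<in> carrier W \<Longrightarrow> pure K V W \<zero>\<^bsub>V\<^esub> w = \<zero>\<^bsub>ten V W\<^esub>"
    and "v \<in> carrier V \<Longrightarrow> pure K V W v \<zero>\<^bsub>W\<^esub> = \<zero>\<^bsub>ten V W\<^esub>"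
  using bilinear_zero[OF bilinear_pure] assms module_tensor by blast+

lemma pure_smult_right:
  fixes V W :: "('g, 'k, 'x) ydo"
  assumes "module K V" "module K W" "c \<in> carrier K" "v \<in> carrier V" "w \<in> carrier W"
  shows "pure K V W v (c \<odot>\<^bsub>W\<^esub> w) = pure K V W (c \<odot>\<^bsub>V\<^esub> v) w"
  using linear_smult[OF bilinear_right[OF bilinear_pure[OF assms(1,2)] assms(4)] assms(3,5)] assms
  by (simp add: smult_pure)

lemma linear_pure_left: "\<lbrakk>module K V; module K W; w \<in> carrier W\<rbrakk> \<Longrightarrow> (\<lambda>v. pure K V W v w) \<in> linear_maps K V (ten V W)"
  by (rule bilinear_left[OF bilinear_pure])

lemma linear_pure_right: "\<lbrakk>module K V; module K W; v \<in> carrier V\<rbrakk> \<Longrightarrow> pure K V W v \<in> linear_maps K W (ten V W)"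
  by (rule bilinear_right[OF bilinear_pure])

lemma generates_pure_homogeneous:
  fixes V W U :: "('g, 'k, 'x) ydo"
  assumes "yd V" "yd W"
  shows "generates (ten V W) (pures V W (homogeneous G V) (homogeneous G W))"
  using assms by (intro generates_pure generates_homogeneous) simp_all

section \<open>The associator and its inverse\<close>

lemma assoc_bilinear:
  fixes V W U :: "('g, 'k, 'x) ydo"
  assumes [simp]: "yd V" "yd W" "yd U"
  defines "T \<equiv> ten V (ten W U)"
  shows "u \<in> carrier U \<Longrightarrow> bilinear K V W T (\<lambda>v w. pure K V (ten W U) v (pure K W U w u))"
    and "bilinear K (ten V W) U T
      (\<lambda>x u. lift T (\<lambda>v w. pure K V (ten W U) v (pure K W U w u)) x)"
proof -
  show *: "bilinear K V W T (\<lambda>v w. pure K V (ten W U) v (pure K W U w u))" if "u \<in> carrier U" for u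
    unfolding T_def
    by (rule bilinear_comp[OF bilinear_pure linear_id linear_pure_left]) (use that in simp_all)
  show "bilinear K (ten V W) U T
      (\<lambda>x u. lift T (\<lambda>v w. pure K V (ten W U) v (pure K W U w u)) x)"
    by (rule nested_bilinear_left[OF _ _ _ _ *])
      (simp_all add: T_def linear_comp[OF linear_pure_right linear_pure_right])
qed

lemma assoc_inv_bilinear:
  fixes V W U :: "('g, 'k, 'x) ydo"
  assumes [simp]: "yd V" "yd W" "yd U"
  defines "T \<equiv> ten (ten V W) U"
  shows "v \<in> carrier V \<Longrightarrow> bilinear K W U T (\<lambda>w u. pure K (ten V W) U (pure K V W v w) u)"
    and "bilinear K V (ten W U) T
      (\<lambda>v x. lift T (\<lambda>w u. pure K (ten V W) U (pure K V W v w) u) x)"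
proof -
  show *: "bilinear K W U T (\<lambda>w u. pure K (ten V W) U (pure K V W v w) u)" if "v \<in> carrier V" for v
    unfolding T_def
    by (rule bilinear_comp[OF bilinear_pure linear_pure_right linear_id]) (use that in simp_all)
  show "bilinear K V (ten W U) T
      (\<lambda>v x. lift T (\<lambda>w u. pure K (ten V W) U (pure K V W v w) u) x)"
    by (rule nested_bilinear_right[OF _ _ _ _ *])
      (simp_all add: T_def linear_comp[OF linear_pure_left linear_pure_left])
qed

context
  fixes V W U :: "('g, 'k, 'x) ydo"
  assumes V [simp]: "yd V" and W [simp]: "yd W" and U [simp]: "yd U"
begin

lemma fn_assoc [simp]:
  "\<lbrakk>v \<in> carrier V; w \<in> carrier W; u \<in> carrier U\<rbrakk>
    \<Longrightarrow> fn (assoc_yd K G V W U) (pure K (ten V W) U (pure K V W v w) u)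
      = pure K V (ten W U) v (pure K W U w u)"
  using lift_pure[OF _ _ assoc_bilinear(2)[OF V W U]] lift_pure[OF _ _ assoc_bilinear(1)[OF V W U]]
  by (simp add: assoc_yd_def Let_def)

lemma fn_assoc_inv [simp]:
  "\<lbrakk>v \<in> carrier V; w \<in> carrier W; u \<in> carrier U\<rbrakk>
    \<Longrightarrow> fn (assoc_inv_yd K G V W U) (pure K V (ten W U) v (pure K W U w u))
      = pure K (ten V W) U (pure K V W v w) u"
  using lift_pure[OF _ _ assoc_inv_bilinear(2)[OF V W U]] lift_pure[OF _ _ assoc_inv_bilinear(1)[OF V W U]]
  by (simp add: assoc_inv_yd_def Let_def)

lemma arr_assoc [simp]: "arr (assoc_yd K G V W U)"
  unfolding assoc_yd_def Let_def
proof (rule arr_arrow_of)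
  let ?T = "ten V (ten W U)"
  let ?\<phi> = "\<lambda>x u. lift ?T (\<lambda>v w. pure K V (ten W U) v (pure K W U w u)) x"
  note [simp] = lift_pure[OF _ _ assoc_bilinear(1)[OF V W U]]
  show "lift ?T ?\<phi> \<in> yd_maps K G (ten (ten V W) U) ?T"
  proof (rule lift_yd_maps[OF _ _ _ assoc_bilinear(2)[OF V W U] generates_pure_homogeneous generates_homogeneous])
    fix g x u assume "g \<in> carrier G" "u \<in> homogeneous G U"
      "x \<in> pures V W (homogeneous G V) (homogeneous G W)"
    then show "?\<phi> (act (ten V W) g x) (act U g u) = act ?T g (?\<phi> x u)"
      by (auto simp: act_pure homogeneous_closed)
  next
    fix x u assume "u \<in> homogeneous G U"
      "x \<in> pures V W (homogeneous G V) (homogeneous G W)"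
    then obtain v w a b c where x: "x = pure K V W v w" and ab: "a \<in> carrier G" "b \<in> carrier G" "c \<in> carrier G"
      "v \<in> grade V a" "w \<in> grade W b" "u \<in> grade U c"
      by (auto simp: homogeneous_def)
    then have "pure K V (ten W U) v (pure K W U w u) \<in> grade ?T (a \<otimes> (b \<otimes> c))"
      by (intro pure_grade) simp_all
    then show "\<exists>g\<in>carrier G. \<exists>h\<in>carrier G. x \<in> grade (ten V W) g \<and> u \<in> grade U h \<and> ?\<phi> x u \<in> grade ?T (g \<otimes> h)"
      using ab by (intro bexI[of _ "a \<otimes> b"] bexI[of _ c]) (simp_all add: x pure_grade m_assoc grade_closed)
  qed simp_all
qed simp_all

lemma arr_assoc_inv [simp]: "arr (assoc_inv_yd K G V W U)"
  unfolding assoc_inv_yd_def Let_def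
proof (rule arr_arrow_of)
  let ?T = "ten (ten V W) U"
  let ?\<phi> = "\<lambda>v x. lift ?T (\<lambda>w u. pure K (ten V W) U (pure K V W v w) u) x"
  note [simp] = lift_pure[OF _ _ assoc_inv_bilinear(1)[OF V W U]]
  show "lift ?T ?\<phi> \<in> yd_maps K G (ten V (ten W U)) ?T"
  proof (rule lift_yd_maps[OF _ _ _ assoc_inv_bilinear(2)[OF V W U] generates_homogeneous generates_pure_homogeneous])
    fix g v x assume "g \<in> carrier G" "v \<in> homogeneous G V"
      "x \<in> pures W U (homogeneous G W) (homogeneous G U)"
    then show "?\<phi> (act V g v) (act (ten W U) g x) = act ?T g (?\<phi> v x)"
      by (auto simp: act_pure homogeneous_closed)
  next
    fix v x assume "v \<in> homogeneous G V"
      "x \<in> pures W U (homogeneous G W) (homogeneous G U)"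
    then obtain w u a b c where x: "x = pure K W U w u" and ab: "a \<in> carrier G" "b \<in> carrier G" "c \<in> carrier G"
      "v \<in> grade V a" "w \<in> grade W b" "u \<in> grade U c"
      by (auto simp: homogeneous_def)
    then have "pure K (ten V W) U (pure K V W v w) u \<in> grade ?T (a \<otimes> b \<otimes> c)"
      by (intro pure_grade) simp_all
    then show "\<exists>g\<in>carrier G. \<exists>h\<in>carrier G. v \<in> grade V g \<and> x \<in> grade (ten W U) h \<and> ?\<phi> v x \<in> grade ?T (g \<otimes> h)"
      using ab by (intro bexI[of _ a] bexI[of _ "b \<otimes> c"]) (simp_all add: x pure_grade m_assoc grade_closed)
  qed simp_all
qed simp_all

lemma generates_triple:
  "generates (ten (ten V W) U)
     {pure K (ten V W) U (pure K V W v w) u | v w u. v \<in> carrier V \<and> w \<in> carrier W \<and> u \<in> carrier U}"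
  "generates (ten V (ten W U))
     {pure K V (ten W U) v (pure K W U w u) | v w u. v \<in> carrier V \<and> w \<in> carrier W \<and> u \<in> carrier U}"
proof -
  note gen = abelian_group.generates_carrier
  have "generates (ten (ten V W) U) (pures (ten V W) U (pures V W (carrier V) (carrier W)) (carrier U))"
    by (intro generates_pure gen) simp_all
  also have "pures (ten V W) U (pures V W (carrier V) (carrier W)) (carrier U)
    = {pure K (ten V W) U (pure K V W v w) u | v w u. v \<in> carrier V \<and> w \<in> carrier W \<and> u \<in> carrier U}"
    by blast
  finally show "generates (ten (ten V W) U)
     {pure K (ten V W) U (pure K V W v w) u | v w u. v \<in> carrier V \<and> w \<in> carrier W \<and> u \<in> carrier U}" .
  have "generates (ten V (ten W U)) (pures V (ten W U) (carrier V) (pures W U (carrier W) (carrier U)))"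
    by (intro generates_pure gen) simp_all
  also have "pures V (ten W U) (carrier V) (pures W U (carrier W) (carrier U))
    = {pure K V (ten W U) v (pure K W U w u) | v w u. v \<in> carrier V \<and> w \<in> carrier W \<and> u \<in> carrier U}"
    by blast
  finally show "generates (ten V (ten W U))
     {pure K V (ten W U) v (pure K W U w u) | v w u. v \<in> carrier V \<and> w \<in> carrier W \<and> u \<in> carrier U}" .
qed

lemma inverse_assoc: "inverse_arrows (YD K G) (assoc_yd K G V W U) (assoc_inv_yd K G V W U)"
proof (rule inverse_arrowsI)
  show "generates (src (assoc_yd K G V W U))
     {pure K (ten V W) U (pure K V W v w) u | v w u. v \<in> carrier V \<and> w \<in> carrier W \<and> u \<in> carrier U}"
    "generates (tgt (assoc_yd K G V W U))
     {pure K V (ten W U) v (pure K W U w u) | v w u. v \<in> carrier V \<and> w \<in> carrier W \<and> u \<in> carrier U}"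
    using generates_triple by simp_all
qed auto

end

section \<open>The unit constraints\<close>

lemma fn_lunit [simp]:
  "\<lbrakk>yd V; c \<in> carrier (Unit); v \<in> carrier V\<rbrakk>
    \<Longrightarrow> fn (lunit_yd K G V) (pure K (Unit) V c v) = scalar c \<odot>\<^bsub>V\<^esub> v"
  by (simp add: lunit_yd_def lift_pure[OF _ _ scalar_smult_bilinear])

lemma fn_runit [simp]:
  "\<lbrakk>yd V; c \<in> carrier (Unit); v \<in> carrier V\<rbrakk>
    \<Longrightarrow> fn (runit_yd K G V) (pure K V (Unit) v c) = scalar c \<odot>\<^bsub>V\<^esub> v"
  by (simp add: runit_yd_def lift_pure[OF _ _ scalar_smult_bilinear[unfolded bilinear_flip[of K "Unit"]]])

lemma arr_lunit [simp]:
  assumes [simp]: "yd V"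
  shows "arr (lunit_yd K G V)"
  unfolding lunit_yd_def
proof (rule arr_arrow_of)
  show "lift V (\<lambda>c v. scalar c \<odot>\<^bsub>V\<^esub> v) \<in> yd_maps K G (ten (Unit) V) V"
  proof (rule lift_yd_maps[OF _ _ _ scalar_smult_bilinear abelian_group.generates_carrier generates_homogeneous])
    fix c v assume "c \<in> carrier (Unit :: ('g, 'k, 'x) ydo)" "v \<in> homogeneous G V"
    then show "\<exists>g\<in>carrier G. \<exists>h\<in>carrier G. c \<in> grade (Unit) g \<and> v \<in> grade V h \<and> scalar c \<odot>\<^bsub>V\<^esub> v \<in> grade V (g \<otimes> h)"
      by (elim homogeneousE, intro bexI[of _ \<one>] bexI) (auto simp: unit_grade grade_smult)
  qed (auto simp: linear_smult[OF rep_act_linear] homogeneous_closed)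
qed simp_all

lemma arr_runit [simp]:
  assumes [simp]: "yd V"
  shows "arr (runit_yd K G V)"
  unfolding runit_yd_def
proof (rule arr_arrow_of)
  show "lift V (\<lambda>v c. scalar c \<odot>\<^bsub>V\<^esub> v) \<in> yd_maps K G (ten V (Unit)) V"
  proof (rule lift_yd_maps[OF _ _ _ scalar_smult_bilinear[unfolded bilinear_flip[of K "Unit"]]
        generates_homogeneous abelian_group.generates_carrier])
    fix v c assume "c \<in> carrier (Unit :: ('g, 'k, 'x) ydo)" "v \<in> homogeneous G V"
    then show "\<exists>g\<in>carrier G. \<exists>h\<in>carrier G. v \<in> grade V g \<and> c \<in> grade (Unit) h \<and> scalar c \<odot>\<^bsub>V\<^esub> v \<in> grade V (g \<otimes> h)"
      by (elim homogeneousE, intro bexI[of _ \<one>] bexI) (auto simp: unit_grade grade_smult)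
  qed (auto simp: linear_smult[OF rep_act_linear] homogeneous_closed)
qed simp_all

lemma generates_pure_carrier:
  fixes V W :: "('g, 'k, 'x) ydo"
  assumes "yd V" "yd W"
  shows "generates (ten V W) (pures V W (carrier V) (carrier W))"
  using assms by (intro generates_pure abelian_group.generates_carrier) simp_all

text \<open>The inverses of the unitors are v \<mapsto> 1 \<otimes> v and v \<mapsto> v \<otimes> 1.
  That they are inverses comes down to sliding a scalar across the tensor sign into the unit object,
  where c = c 1.\<close>

lemma scalar_pure_unit:
  fixes V :: "('g, 'k, 'x) ydo"
  assumes "yd V" "c \<in> carrier (Unit)" "v \<in> carrier V"
  shows "pure K (Unit) V (Scalar \<one>\<^bsub>K\<^esub>) (scalar c \<odot>\<^bsub>V\<^esub> v) = pure K (Unit) V c v"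
    and "pure K V (Unit) (scalar c \<odot>\<^bsub>V\<^esub> v) (Scalar \<one>\<^bsub>K\<^esub>) = pure K V (Unit) v c"
proof -
  have "scalar c \<odot>\<^bsub>Unit\<^esub> Scalar \<one>\<^bsub>K\<^esub> = c"
    using assms(2) by (auto simp: unit_yd_def)
  then show "pure K (Unit) V (Scalar \<one>\<^bsub>K\<^esub>) (scalar c \<odot>\<^bsub>V\<^esub> v) = pure K (Unit) V c v"
    "pure K V (Unit) (scalar c \<odot>\<^bsub>V\<^esub> v) (Scalar \<one>\<^bsub>K\<^esub>) = pure K V (Unit) v c"
    using assms pure_smult_right[of "Unit" V "scalar c" "Scalar \<one>\<^bsub>K\<^esub>" v]
      pure_smult_right[of V "Unit" "scalar c" v "Scalar \<one>\<^bsub>K\<^esub>"] by simp_all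
qed

lemma iso_lunit:
  fixes V :: "('g, 'k, 'x) ydo"
  assumes [simp]: "yd V"
  shows "iso_arrow (YD K G) (lunit_yd K G V)"
proof (rule iso_arrowI[OF inverse_arrowsI])
  let ?I = "Unit :: ('g, 'k, 'x) ydo"
  let ?f = "arrow_of V (ten ?I V) (pure K ?I V (Scalar \<one>\<^bsub>K\<^esub>))"
  show "arr ?f"
  proof (intro arr_arrow_of yd_mapsI[where A = "homogeneous G V"])
    fix v assume "v \<in> homogeneous G V"
    then obtain g where "g \<in> carrier G" "v \<in> grade V g" by (rule homogeneousE)
    then show "\<exists>g\<in>carrier G. v \<in> grade V g \<and> pure K ?I V (Scalar \<one>\<^bsub>K\<^esub>) v \<in> grade (ten ?I V) g"
      using pure_grade[of ?I V \<one> g "Scalar \<one>\<^bsub>K\<^esub>" v] by (intro bexI[of _ g]) (simp_all add: unit_grade)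
  qed (simp_all add: linear_pure_right act_pure homogeneous_closed generates_homogeneous)
  show "generates (src (lunit_yd K G V)) (pures ?I V (carrier ?I) (carrier V))"
    using generates_pure_carrier[of ?I V] by simp
  show "generates (tgt (lunit_yd K G V)) (carrier V)"
    by (simp add: abelian_group.generates_carrier)
qed (auto simp: scalar_pure_unit)

lemma iso_runit:
  fixes V :: "('g, 'k, 'x) ydo"
  assumes [simp]: "yd V"
  shows "iso_arrow (YD K G) (runit_yd K G V)"
proof (rule iso_arrowI[OF inverse_arrowsI])
  let ?I = "Unit :: ('g, 'k, 'x) ydo"
  let ?f = "arrow_of V (ten V ?I) (\<lambda>v. pure K V ?I v (Scalar \<one>\<^bsub>K\<^esub>))"
  show "arr ?f"
  proof (intro arr_arrow_of yd_mapsI[where A = "homogeneous G V"])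
    fix v assume "v \<in> homogeneous G V"
    then obtain g where "g \<in> carrier G" "v \<in> grade V g" by (rule homogeneousE)
    then show "\<exists>g\<in>carrier G. v \<in> grade V g \<and> pure K V ?I v (Scalar \<one>\<^bsub>K\<^esub>) \<in> grade (ten V ?I) g"
      using pure_grade[of V ?I g \<one> v "Scalar \<one>\<^bsub>K\<^esub>"] by (intro bexI[of _ g]) (simp_all add: unit_grade)
  qed (simp_all add: linear_pure_left act_pure homogeneous_closed generates_homogeneous)
  show "generates (src (runit_yd K G V)) (pures V ?I (carrier V) (carrier ?I))"
    using generates_pure_carrier[of V ?I] by simp
  show "generates (tgt (runit_yd K G V)) (carrier V)"
    by (simp add: abelian_group.generates_carrier)
qed (auto simp: scalar_pure_unit)

lemma YD_monoidal: "monoidal_category (YD K G :: ('g, 'k, 'x) yd_category)"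
proof (intro monoidal_category.intro YD_category monoidal_category_axioms.intro, goal_cases)
  \<comment> \<open>Functoriality of the tensor product, on identities and then on
    composites.\<close>
  case (3 X Y)
  then show ?case
    using generates_pure_carrier[of X Y] by (auto intro!: arr_eqI)
next
  case (4 f X X' f' X'' g Y Y' g' Y'')
  then have [simp]: "yd X" "yd Y" using arr_src[of f] arr_src[of g] by auto
  from 4 show ?case
    using generates_pure_carrier[of X Y] by (auto intro!: arr_eqI)
next
  \<comment> \<open>The associator is invertible, and, in the next case, natural.\<close>
  case (7 X Y Z)
  then show ?case using iso_arrowI[OF inverse_assoc, of X Y Z] by simp
next
  case (8 f X X' g Y Y' h Z Z')
  then have [simp]: "yd X" "yd Y" "yd Z" "yd X'" "yd Y'" "yd Z'"
    using arr_src[of f] arr_src[of g] arr_src[of h] arr_tgt[of f] arr_tgt[of g] arr_tgt[of h] by auto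
  from 8 show ?case
    using generates_triple(1)[of X Y Z] by (auto intro!: arr_eqI)
next
  \<comment> \<open>Naturality of the left unitor, and next of the right one, is linearity of the
    arrow \<open>f\<close>.\<close>
  case (11 f X Y)
  then have [simp]: "yd X" "yd Y" using arr_src[of f] arr_tgt[of f] by auto
  from 11 show ?case
    using generates_pure_carrier[of "Unit" X]
    by (auto intro!: arr_eqI simp: linear_smult[OF arr_linear])
next
  case (14 f X Y)
  then have [simp]: "yd X" "yd Y" using arr_src[of f] arr_tgt[of f] by auto
  from 14 show ?case
    using generates_pure_carrier[of X "Unit"]
    by (auto intro!: arr_eqI simp: linear_smult[OF arr_linear])
next
  \<comment> \<open>The pentagon, tested on ((w \<otimes> x) \<otimes> y) \<otimes> z.\<close>
  case (15 W X Y Z)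
  then have [simp]: "yd W" "yd X" "yd Y" "yd Z" by simp_all
  note gen = generates_pure[OF _ _ generates_triple(1)[of W X Y] abelian_group.generates_carrier[of Z]]
  show ?case
    using gen by (auto intro!: arr_eqI)
next
  \<comment> \<open>The triangle: the two sides place the scalar of the unit object on different
    factors, and \<open>pure_smult_right\<close> reconciles them.\<close>
  case (16 X Y)
  then have [simp]: "yd X" "yd Y" by simp_all
  show ?case
    using generates_triple(1)[of X "Unit" Y] by (auto intro!: arr_eqI simp: pure_smult_right)
qed (simp_all add: iso_lunit iso_runit)

section \<open>The braiding\<close>

lemma braiding_bilinear:
  fixes V W :: "('g, 'k, 'x) ydo"
  assumes [simp]: "yd V" "yd W"
  shows "bilinear K V W (ten W V)
    (\<lambda>v w. \<Oplus>\<^bsub>ten W V\<^esub>g\<in>carrier G. pure K W V (act W g w) (component G V v g))"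
proof (rule bilinear_finsum)
  fix g assume "g \<in> carrier G"
  then show "bilinear K V W (ten W V) (\<lambda>v w. pure K W V (act W g w) (component G V v g))"
    by (subst bilinear_flip) (simp add: bilinear_comp[OF bilinear_pure] component_linear)
qed simp_all

text \<open>The sum runs over all degrees because a general vector has several components. For
  homogeneous \<open>v\<close> one summand is left, and the usual formula for the braiding
  reappears.\<close>

lemma braiding_homogeneous:
  fixes V W :: "('g, 'k, 'x) ydo"
  assumes [simp]: "yd V" "yd W" and g: "g \<in> carrier G" "v \<in> grade V g" and w: "w \<in> carrier W"
  shows "(\<Oplus>\<^bsub>ten W V\<^esub>h\<in>carrier G. pure K W V (act W h w) (component G V v h)) = pure K W V (act W g w) v"
proof -
  interpret T: module K "ten W V" by simp
  have v: "v \<in> carrier V" using g by (simp add: grade_closed)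
  have "(\<Oplus>\<^bsub>ten W V\<^esub>h\<in>carrier G. pure K W V (act W h w) (component G V v h))
    = pure K W V (act W g w) (component G V v g)"
    by (rule T.M.finsum_single) (use finite_G g w v in \<open>auto simp: component_homogeneous[OF _ g]\<close>)
  then show ?thesis using g by (simp add: component_homogeneous)
qed

lemma fn_braiding [simp]:
  fixes V W :: "('g, 'k, 'x) ydo"
  assumes "yd V" "yd W" "g \<in> carrier G" "v \<in> grade V g" "w \<in> carrier W"
  shows "fn (braiding K G V W) (pure K V W v w) = pure K W V (act W g w) v"
  using assms grade_closed[OF assms(1,3,4)] lift_pure[OF _ _ braiding_bilinear[OF assms(1,2)], of v w]
  by (simp add: braiding_def Let_def braiding_homogeneous)

lemma arr_braiding [simp]:
  fixes V W :: "('g, 'k, 'x) ydo"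
  assumes [simp]: "yd V" "yd W"
  shows "arr (braiding K G V W)"
  unfolding braiding_def Let_def
proof (rule arr_arrow_of)
  let ?T = "ten W V"
  let ?\<phi> = "\<lambda>v w. \<Oplus>\<^bsub>?T\<^esub>g\<in>carrier G. pure K W V (act W g w) (component G V v g)"
  show "lift ?T ?\<phi> \<in> yd_maps K G (ten V W) ?T"
  proof (rule lift_yd_maps[OF _ _ _ braiding_bilinear generates_homogeneous generates_homogeneous])
    fix g v w assume g: "g \<in> carrier G" and v: "v \<in> homogeneous G V" and w: "w \<in> homogeneous G W"
    from v obtain h where h: "h \<in> carrier G" "v \<in> grade V h" by (rule homogeneousE)
    have [simp]: "v \<in> carrier V" "w \<in> carrier W" using v w by (simp_all add: homogeneous_closed)
    \<comment> \<open>The translate of \<open>v\<close> by \<open>g\<close> has degree g h g^-1;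
      acting with it on the translate of \<open>w\<close> amounts to acting with gh on
      \<open>w\<close>, which is the right side.\<close>
    have "g \<otimes> h \<otimes> inv g \<otimes> g = g \<otimes> h" using g h by (simp add: m_assoc)
    then show "?\<phi> (act V g v) (act W g w) = act ?T g (?\<phi> v w)"
      using g h by (simp add: braiding_homogeneous[of V W "g \<otimes> h \<otimes> inv g"] braiding_homogeneous[of V W h]
          grade_act act_pure flip: rep_act_mult)
  next
    fix v w assume v: "v \<in> homogeneous G V" and w: "w \<in> homogeneous G W"
    then obtain g h where g: "g \<in> carrier G" "v \<in> grade V g" and h: "h \<in> carrier G" "w \<in> grade W h"
      by (auto simp: homogeneous_def)
    \<comment> \<open>Swapping the factors changes their order but not the total degree, as the
      first factor has been conjugated by the degree \<open>g\<close> of \<open>v\<close>.\<close>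
    have "pure K W V (act W g w) v \<in> grade ?T ((g \<otimes> h \<otimes> inv g) \<otimes> g)"
      by (rule pure_grade) (use g h in \<open>simp_all add: grade_act\<close>)
    moreover have "(g \<otimes> h \<otimes> inv g) \<otimes> g = g \<otimes> h" using g h by (simp add: m_assoc)
    ultimately show "\<exists>g\<in>carrier G. \<exists>h\<in>carrier G. v \<in> grade V g \<and> w \<in> grade W h \<and> ?\<phi> v w \<in> grade ?T (g \<otimes> h)"
      using g h by (intro bexI[of _ g] bexI[of _ h]) (simp_all add: braiding_homogeneous[of V W g] grade_closed)
  qed simp_all
qed simp_all

end


section \<open>The group algebra\<close>

text \<open>The multiple c g of a group element. Group elements generate the group algebra only
  linearly, whereas these multiples generate it additively.\<close>

definition scalar_elem :: "('k, 'r) ring_scheme \<Rightarrow> 'k \<Rightarrow> 'g \<Rightarrow> ('g, 'k, 'x) vec" where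
  "scalar_elem K c g = Fun (\<lambda>x. if x = g then c else \<zero>\<^bsub>K\<^esub>)"

lemma group_elem_scalar: "group_elem K g = scalar_elem K \<one>\<^bsub>K\<^esub> g"
  by (simp add: group_elem_def scalar_elem_def)

text \<open>Linear extension to the group algebra of a function on the group. Both the action of the
  group algebra on a representation and the inner map of \<open>ind_lift\<close> have this
  form.\<close>

definition expand ::
    "('g, 'm) monoid_scheme \<Rightarrow> ('k, 'v, 'n) module_scheme \<Rightarrow> ('g \<Rightarrow> 'v) \<Rightarrow> ('g, 'k, 'x) vec \<Rightarrow> 'v" where
  "expand G T \<phi> a = (\<Oplus>\<^bsub>T\<^esub>g\<in>carrier G. coeff a g \<odot>\<^bsub>T\<^esub> \<phi> g)"

context yd_modules
begin

abbreviation (input) "kG \<equiv> group_algebra K G"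

lemma algebra_simps:
  "\<zero>\<^bsub>group_algebra K G\<^esub> = Fun (\<lambda>x. \<zero>\<^bsub>K\<^esub>)"
  "a \<oplus>\<^bsub>group_algebra K G\<^esub> b = Fun (\<lambda>x. coeff a x \<oplus>\<^bsub>K\<^esub> coeff b x)"
  "c \<odot>\<^bsub>group_algebra K G\<^esub> a = Fun (\<lambda>x. c \<otimes>\<^bsub>K\<^esub> coeff a x)"
  "a \<otimes>\<^bsub>group_algebra K G\<^esub> b = Fun (\<lambda>x. if x \<in> carrier G
        then \<Oplus>\<^bsub>K\<^esub>y\<in>carrier G. coeff a y \<otimes>\<^bsub>K\<^esub> coeff b (inv y \<otimes> x) else \<zero>\<^bsub>K\<^esub>)"
  by (simp_all add: group_algebra_def)

lemma coeff_closed [simp]: "a \<in> carrier kG \<Longrightarrow> coeff a g \<in> carrier K"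
  by (cases "g \<in> carrier G") (auto simp: group_algebra_def)

lemma coeff_outside: "\<lbrakk>a \<in> carrier kG; g \<notin> carrier G\<rbrakk> \<Longrightarrow> coeff a g = \<zero>\<^bsub>K\<^esub>"
  by (auto simp: group_algebra_def)

lemma Fun_algebra:
  "(Fun f \<in> carrier kG) \<longleftrightarrow> (\<forall>g \<in> carrier G. f g \<in> carrier K) \<and> (\<forall>g. g \<notin> carrier G \<longrightarrow> f g = \<zero>\<^bsub>K\<^esub>)"
  by (auto simp: group_algebra_def)

lemma algebra_eqI:
  assumes "a \<in> carrier kG" "b \<in> carrier kG" "\<And>g. g \<in> carrier G \<Longrightarrow> coeff a g = coeff b g"
  shows "a = b"
proof -
  have "coeff a g = coeff b g" for g
    using assms by (cases "g \<in> carrier G") (auto simp: coeff_outside)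
  moreover have "a = Fun (coeff a)" "b = Fun (coeff b)"
    using assms(1,2) by (auto simp: group_algebra_def)
  ultimately show ?thesis by (metis ext)
qed

lemma abelian_group_algebra [simp]: "abelian_group kG"
proof (rule abelian_groupI)
  fix a assume a: "a \<in> carrier kG"
  show "\<exists>b \<in> carrier kG. b \<oplus>\<^bsub>kG\<^esub> a = \<zero>\<^bsub>kG\<^esub>"
    using a by (intro bexI[of _ "Fun (\<lambda>x. \<ominus>\<^bsub>K\<^esub> coeff a x)"])
      (auto simp: algebra_simps Fun_algebra coeff_outside K.l_neg)
qed (auto simp: algebra_simps Fun_algebra coeff_outside K.a_ac intro!: algebra_eqI)

lemma scalar_elem_closed [simp]: "\<lbrakk>c \<in> carrier K; g \<in> carrier G\<rbrakk> \<Longrightarrow> scalar_elem K c g \<in> carrier kG"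
  by (auto simp: scalar_elem_def Fun_algebra)

lemma additive_coeff: "additive kG K (\<lambda>a. coeff a g)"
  by (rule additiveI) (simp_all add: algebra_simps)

lemma generates_algebra:
  "generates kG {(scalar_elem K c g :: ('g, 'k, 'x) vec) | c g. c \<in> carrier K \<and> g \<in> carrier G}"
  (is "generates ?A ?B")
proof -
  interpret A: abelian_group ?A by simp
  have B: "?B \<subseteq> carrier kG" by auto
  have "a \<in> additive_span ?A ?B" if a: "a \<in> carrier ?A" for a
  proof -
    have closed: "(\<Oplus>\<^bsub>?A\<^esub>g\<in>carrier G. scalar_elem K (coeff a g) g) \<in> carrier ?A"
      using a by (intro A.finsum_closed) auto
    \<comment> \<open>Reading off the coefficient at \<open>g\<close> is additive, so it passes
      through the sum and leaves the single term with index \<open>g\<close>.\<close>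
    have "a = (\<Oplus>\<^bsub>?A\<^esub>g\<in>carrier G. scalar_elem K (coeff a g) g)"
    proof (rule algebra_eqI[OF a closed])
      fix g assume g: "g \<in> carrier G"
      have "coeff (\<Oplus>\<^bsub>?A\<^esub>g\<in>carrier G. scalar_elem K (coeff a g) g) g
        = (\<Oplus>\<^bsub>K\<^esub>h\<in>carrier G. coeff (scalar_elem K (coeff a h) h :: ('g, 'k, 'x) vec) g)"
        using a by (intro additive_finsum[OF _ _ additive_coeff]) (simp_all add: K.abelian_group_axioms)
      also have "\<dots> = coeff (scalar_elem K (coeff a g) g :: ('g, 'k, 'x) vec) g"
        using a g finite_G by (intro K.finsum_single) (auto simp: scalar_elem_def)
      finally show "coeff a g = coeff (\<Oplus>\<^bsub>?A\<^esub>g\<in>carrier G. scalar_elem K (coeff a g) g) g"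
        by (simp add: scalar_elem_def)
    qed
    also have "\<dots> \<in> additive_span ?A ?B"
    proof (rule A.finsum_mem)
      show "additive_span ?A ?B \<subseteq> carrier ?A" by (rule subsetI) (rule A.additive_span_closed[OF B])
      fix g assume "g \<in> carrier G"
      then show "scalar_elem K (coeff a g) g \<in> additive_span ?A ?B"
        using coeff_closed[OF a] by (intro A.additive_span_base[OF B]) blast
    qed (auto intro: additive_span.zero A.additive_span_add[OF B])
    finally show ?thesis .
  qed
  then show ?thesis using B by (auto simp: generates_def)
qed

lemma algebra_mult_closed [simp]: "\<lbrakk>a \<in> carrier kG; b \<in> carrier kG\<rbrakk> \<Longrightarrow> a \<otimes>\<^bsub>kG\<^esub> b \<in> carrier kG"
  by (auto simp: algebra_simps Fun_algebra intro!: K.finsum_closed)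

lemma additive_algebra_mult_left: "b \<in> carrier kG \<Longrightarrow> additive kG kG (\<lambda>a. a \<otimes>\<^bsub>kG\<^esub> b)"
  by (rule additiveI, simp)
    (auto simp: algebra_simps Fun_algebra K.l_distr intro!: algebra_eqI K.finsum_closed)

lemma additive_algebra_mult_right: "a \<in> carrier kG \<Longrightarrow> additive kG kG (\<lambda>b. a \<otimes>\<^bsub>kG\<^esub> b)"
  by (rule additiveI, simp)
    (auto simp: algebra_simps Fun_algebra K.r_distr intro!: algebra_eqI K.finsum_closed)

lemma additive_algebra_smult: "c \<in> carrier K \<Longrightarrow> additive kG kG (\<lambda>a. c \<odot>\<^bsub>kG\<^esub> a)"
  by (rule additiveI) (auto simp: algebra_simps Fun_algebra coeff_outside K.r_distr)

lemma scalar_elem_smult: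
  "\<lbrakk>c \<in> carrier K; d \<in> carrier K\<rbrakk> \<Longrightarrow> c \<odot>\<^bsub>kG\<^esub> scalar_elem K d g = scalar_elem K (c \<otimes>\<^bsub>K\<^esub> d) g"
  by (auto simp: scalar_elem_def algebra_simps)

text \<open>In the convolution only the index \<open>g\<close> contributes, and the second factor is
  then supported at \<open>g \<otimes> h\<close>.\<close>

lemma scalar_elem_mult:
  assumes c: "c \<in> carrier K" "d \<in> carrier K" and g: "g \<in> carrier G" "h \<in> carrier G"
  shows "(scalar_elem K c g :: ('g, 'k, 'x) vec) \<otimes>\<^bsub>kG\<^esub> scalar_elem K d h
    = scalar_elem K (c \<otimes>\<^bsub>K\<^esub> d) (g \<otimes> h)"
proof (rule algebra_eqI)
  let ?a = "scalar_elem K c g :: ('g, 'k, 'x) vec" and ?b = "scalar_elem K d h :: ('g, 'k, 'x) vec"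
  fix x assume x: "x \<in> carrier G"
  have "(\<Oplus>\<^bsub>K\<^esub>y\<in>carrier G. coeff ?a y \<otimes>\<^bsub>K\<^esub> coeff ?b (inv y \<otimes> x))
    = coeff ?a g \<otimes>\<^bsub>K\<^esub> coeff ?b (inv g \<otimes> x)"
    by (rule K.finsum_single) (use assms x finite_G in \<open>auto simp: scalar_elem_def\<close>)
  moreover have "inv g \<otimes> x = h \<longleftrightarrow> x = g \<otimes> h"
    using x g by (metis inv_solve_left)
  ultimately show "coeff (?a \<otimes>\<^bsub>kG\<^esub> ?b) x
    = coeff (scalar_elem K (c \<otimes>\<^bsub>K\<^esub> d) (g \<otimes> h) :: ('g, 'k, 'x) vec) x"
    using c x by (simp add: algebra_simps) (simp add: scalar_elem_def)
qed (use assms in simp_all)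

lemma additive_comp: "\<lbrakk>additive M N f; additive N T g\<rbrakk> \<Longrightarrow> additive M T (\<lambda>x. g (f x))"
  by (rule additiveI) (simp_all add: additive_closed[of M N f] additive_closed[of N T g]
      additive_add[of M N f] additive_add[of N T g])

lemma algebra_eq_on_generators:
  assumes "abelian_group T" "additive kG T f" "additive kG T f'" "a \<in> carrier kG"
    and "\<And>c g. \<lbrakk>c \<in> carrier K; g \<in> carrier G\<rbrakk> \<Longrightarrow> f (scalar_elem K c g) = f' (scalar_elem K c g)"
  shows "f a = f' a"
  by (rule additive_eq_on_carrier[OF abelian_group_algebra assms(1-3) generates_algebra _ assms(4)])
    (use assms(5) in auto)

text \<open>Both sides are additive in each variable. Testing one variable after another on
  multiples of group elements replaces the reindexing of a double sum by associativity in the group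
  and in \<open>K\<close>.\<close>

lemma algebra_mult_assoc:
  assumes a: "a \<in> carrier kG" and b: "b \<in> carrier kG" and c: "c \<in> carrier kG"
  shows "(a \<otimes>\<^bsub>kG\<^esub> b) \<otimes>\<^bsub>kG\<^esub> c = a \<otimes>\<^bsub>kG\<^esub> (b \<otimes>\<^bsub>kG\<^esub> c)"
proof -
  note left = additive_algebra_mult_left and right = additive_algebra_mult_right
  show ?thesis
  proof (rule algebra_eq_on_generators[where a = a and T = kG])
    show "additive kG kG (\<lambda>a. (a \<otimes>\<^bsub>kG\<^esub> b) \<otimes>\<^bsub>kG\<^esub> c)" "additive kG kG (\<lambda>a. a \<otimes>\<^bsub>kG\<^esub> (b \<otimes>\<^bsub>kG\<^esub> c))"
      using additive_comp[OF left[OF b] left[OF c]] left[of "b \<otimes>\<^bsub>kG\<^esub> c"] b c by simp_all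
    fix x g assume x: "x \<in> carrier K" "g \<in> carrier G"
    let ?a = "scalar_elem K x g"
    have a: "?a \<in> carrier kG" using x by simp
    show "(?a \<otimes>\<^bsub>kG\<^esub> b) \<otimes>\<^bsub>kG\<^esub> c = ?a \<otimes>\<^bsub>kG\<^esub> (b \<otimes>\<^bsub>kG\<^esub> c)"
    proof (rule algebra_eq_on_generators[where a = b and T = kG])
      show "additive kG kG (\<lambda>b. (?a \<otimes>\<^bsub>kG\<^esub> b) \<otimes>\<^bsub>kG\<^esub> c)" "additive kG kG (\<lambda>b. ?a \<otimes>\<^bsub>kG\<^esub> (b \<otimes>\<^bsub>kG\<^esub> c))"
        using additive_comp[OF right[OF a] left[OF c]] additive_comp[OF left[OF c] right[OF a]] by simp_all
      fix y h assume y: "y \<in> carrier K" "h \<in> carrier G"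
      let ?b = "scalar_elem K y h"
      have b: "?b \<in> carrier kG" and ab: "?a \<otimes>\<^bsub>kG\<^esub> ?b \<in> carrier kG" using x y by simp_all
      show "(?a \<otimes>\<^bsub>kG\<^esub> ?b) \<otimes>\<^bsub>kG\<^esub> c = ?a \<otimes>\<^bsub>kG\<^esub> (?b \<otimes>\<^bsub>kG\<^esub> c)"
      proof (rule algebra_eq_on_generators[where a = c and T = kG])
        show "additive kG kG (\<lambda>c. (?a \<otimes>\<^bsub>kG\<^esub> ?b) \<otimes>\<^bsub>kG\<^esub> c)" "additive kG kG (\<lambda>c. ?a \<otimes>\<^bsub>kG\<^esub> (?b \<otimes>\<^bsub>kG\<^esub> c))"
          using right[OF ab] additive_comp[OF right[OF b] right[OF a]] by simp_all
      qed (use x y c in \<open>simp_all add: scalar_elem_mult m_assoc K.m_assoc\<close>)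
    qed (use b in simp_all)
  qed (use a in simp_all)
qed

lemma algebra_smult_mult:
  assumes "c \<in> carrier K" "a \<in> carrier kG" "b \<in> carrier kG"
  shows "c \<odot>\<^bsub>kG\<^esub> (a \<otimes>\<^bsub>kG\<^esub> b) = (c \<odot>\<^bsub>kG\<^esub> a) \<otimes>\<^bsub>kG\<^esub> b"
  using assms finite_G
  by (auto simp: algebra_simps K.finsum_rdistr K.m_assoc Pi_iff intro!: ext K.finsum_cong')

lemma additive_expand:
  assumes "module K T" "\<And>g. g \<in> carrier G \<Longrightarrow> \<phi> g \<in> carrier T"
  shows "additive (kG :: ('k, ('g, 'k, 'x) vec) module) T (expand G T \<phi>)"
proof (rule additiveI)
  interpret T: module K T by fact
  fix a b :: "('g, 'k, 'x) vec" assume ab: "a \<in> carrier kG" "b \<in> carrier kG"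
  have "expand G T \<phi> (a \<oplus>\<^bsub>kG\<^esub> b) = (\<Oplus>\<^bsub>T\<^esub>g\<in>carrier G. coeff a g \<odot>\<^bsub>T\<^esub> \<phi> g \<oplus>\<^bsub>T\<^esub> coeff b g \<odot>\<^bsub>T\<^esub> \<phi> g)"
    unfolding expand_def by (rule T.M.finsum_cong') (use ab assms in \<open>auto simp: algebra_simps T.smult_l_distr\<close>)
  also have "\<dots> = expand G T \<phi> a \<oplus>\<^bsub>T\<^esub> expand G T \<phi> b"
    unfolding expand_def by (rule T.M.finsum_addf) (use ab assms in auto)
  finally show "expand G T \<phi> (a \<oplus>\<^bsub>kG\<^esub> b) = expand G T \<phi> a \<oplus>\<^bsub>T\<^esub> expand G T \<phi> b" .
qed (use assms in \<open>simp add: expand_def\<close>)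

lemma expand_scalar_elem:
  assumes "module K T" "\<And>g. g \<in> carrier G \<Longrightarrow> \<phi> g \<in> carrier T" "c \<in> carrier K" "g \<in> carrier G"
  shows "expand G T \<phi> (scalar_elem K c g :: ('g, 'k, 'x) vec) = c \<odot>\<^bsub>T\<^esub> \<phi> g"
proof -
  interpret T: module K T by fact
  let ?a = "scalar_elem K c g :: ('g, 'k, 'x) vec"
  have "expand G T \<phi> ?a = coeff ?a g \<odot>\<^bsub>T\<^esub> \<phi> g"
    unfolding expand_def
    by (rule T.M.finsum_single) (use assms finite_G in \<open>auto simp: scalar_elem_def\<close>)
  then show ?thesis by (simp add: scalar_elem_def)
qed

lemma algebra_act_expand: "algebra_act G V a v = expand G V (\<lambda>g. act V g v) a"
  by (simp add: algebra_act_def expand_def)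

lemma algebra_act_closed [simp]: "\<lbrakk>rp V; a \<in> carrier kG; v \<in> carrier V\<rbrakk> \<Longrightarrow> algebra_act G V a v \<in> carrier V"
  unfolding algebra_act_expand by (rule additive_closed[OF additive_expand]) simp_all

lemma algebra_act_scalar_elem:
  "\<lbrakk>rp V; c \<in> carrier K; g \<in> carrier G; v \<in> carrier V\<rbrakk> \<Longrightarrow> algebra_act G V (scalar_elem K c g) v = c \<odot>\<^bsub>V\<^esub> act V g v"
  unfolding algebra_act_expand by (rule expand_scalar_elem) simp_all

text \<open>The action permutes the projections by conjugation. This is what makes the projections
  on an induced module respect the relation gh \<otimes> v = g \<otimes> hv.\<close>

lemma component_act:
  assumes V: "yd V" and h: "h \<in> carrier G" and g: "g \<in> carrier G" and v: "v \<in> carrier V"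
  shows "component G V (act V h v) g = act V h (component G V v (inv h \<otimes> g \<otimes> h))"
proof (rule linear_eq_on_carrier[where V = V and W = V and f = "\<lambda>v. component G V (act V h v) g"
      and g = "\<lambda>v. act V h (component G V v (inv h \<otimes> g \<otimes> h))"])
  show "(\<lambda>v. component G V (act V h v) g) \<in> linear_maps K V V"
    "(\<lambda>v. act V h (component G V v (inv h \<otimes> g \<otimes> h))) \<in> linear_maps K V V"
    using V h g by (simp_all add: linear_comp[OF rep_act_linear component_linear]
        linear_comp[OF component_linear rep_act_linear])
  fix v assume "v \<in> homogeneous G V"
  then obtain k where k: "k \<in> carrier G" "v \<in> grade V k" by (rule homogeneousE)
  have "g = h \<otimes> k \<otimes> inv h \<longleftrightarrow> inv h \<otimes> g \<otimes> h = k"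
    using h g k(1) by (metis inv_closed inv_solve_left inv_solve_right m_assoc m_closed)
  then show "component G V (act V h v) g = act V h (component G V v (inv h \<otimes> g \<otimes> h))"
    using V h g k by (simp add: component_homogeneous[OF V _ grade_act[OF V h k]] component_homogeneous[OF V k]
        linear_zero[OF _ _ rep_act_linear])
qed (use V v in \<open>simp_all add: generates_homogeneous\<close>)

end


section \<open>Induced modules\<close>

text \<open>A kH-balanced map on kG and V, recorded by its values on group elements:
  \<open>\<phi> g v\<close> is to be the image of g \<otimes> v. This is the shape in which maps are
  supplied to \<open>ind_lift\<close>.\<close>

definition induction_map ::
    "('k, 'r) ring_scheme \<Rightarrow> ('g, 'm) monoid_scheme \<Rightarrow> 'g set \<Rightarrow> ('k, 'v, 'g, 'n) rep_scheme
      \<Rightarrow> ('k, 't, 'p) module_scheme \<Rightarrow> ('g \<Rightarrow> 'v \<Rightarrow> 't) \<Rightarrow> bool" where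
  "induction_map K G H V T \<phi> \<longleftrightarrow> (\<forall>g \<in> carrier G. \<phi> g \<in> linear_maps K V T) \<and>
     (\<forall>g \<in> carrier G. \<forall>h \<in> H. \<forall>v \<in> carrier V. \<phi> (g \<otimes>\<^bsub>G\<^esub> h) v = \<phi> g (act V h v))"

locale subgroup_modules = yd_modules K G for K :: "('k, 'r) ring_scheme"
    and G :: "('g, 'm) monoid_scheme" (structure) +
  fixes H :: "'g set"
  assumes subgroup_H: "subgroup H G"
begin

abbreviation "GH \<equiv> G\<lparr>carrier := H\<rparr>"
abbreviation (input) Ind where "Ind \<equiv> ind_yd K G H"
abbreviation (input) ipure where "ipure \<equiv> ind_pure K G H"
abbreviation (input) ipures where "ipures V A \<equiv> {ind_pure K G H V g a | g a. g \<in> carrier G \<and> a \<in> A}"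

text \<open>\<open>GH\<close> is the same record with a smaller carrier, so the theory above becomes
  available for the subgroup too. Several rules below restate its facts with membership in
  \<open>H\<close> instead of \<open>carrier GH\<close>.\<close>

sublocale H: yd_modules K GH
proof (intro yd_modules.intro yd_modules_axioms.intro modules_over_axioms)
  show "group GH" by (rule subgroup_imp_group[OF subgroup_H])
  show "finite (carrier GH)"
    using finite_G subgroup.subset[OF subgroup_H] by (simp add: finite_subset)
qed

lemma H_closed [simp]: "h \<in> H \<Longrightarrow> h \<in> carrier G"
  using subgroup.subset[OF subgroup_H] by blast

lemma H_mult [simp]: "\<lbrakk>g \<in> H; h \<in> H\<rbrakk> \<Longrightarrow> g \<otimes> h \<in> H"
  by (rule subgroup.m_closed[OF subgroup_H])

lemma H_one [simp]: "\<one> \<in> H"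
  by (rule subgroup.one_closed[OF subgroup_H])

lemma H_inv [simp]: "h \<in> H \<Longrightarrow> inv h \<in> H"
  by (rule subgroup.m_inv_closed[OF subgroup_H])

lemma inv_GH [simp]: "h \<in> H \<Longrightarrow> inv\<^bsub>GH\<^esub> h = inv h"
  by (rule m_inv_consistent[OF subgroup_H])

lemmas H_act_mult = H.rep_act_mult[simplified]
lemmas H_act_one [simp] = H.rep_act_one[simplified]
lemmas H_act_linear [simp] = H.rep_act_linear[simplified]

lemma subalgebra_closed: "b \<in> carrier (group_algebra K GH) \<Longrightarrow> b \<in> carrier (group_algebra K G)"
proof -
  assume "b \<in> carrier (group_algebra K GH)"
  then obtain f where b: "b = Fun f" "\<And>g. g \<in> H \<Longrightarrow> f g \<in> carrier K" "\<And>g. g \<notin> H \<Longrightarrow> f g = \<zero>\<^bsub>K\<^esub>"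
    by (auto simp: group_algebra_def)
  then have "f g \<in> carrier K" for g by (cases "g \<in> H") simp_all
  moreover have "f g = \<zero>\<^bsub>K\<^esub>" if "g \<notin> carrier G" for g using b(3) H_closed that by blast
  ultimately show ?thesis by (simp add: b(1) Fun_algebra)
qed

text \<open>The element moved across in a balanced map runs through kH only, while the additive maps
  at hand are given on kG, whose addition restricts.\<close>

lemma additive_subalgebra:
  assumes "additive (group_algebra K G) T f"
  shows "additive (group_algebra K GH) T f"
  using assms by (auto simp: additive_def subalgebra_closed algebra_simps H.algebra_simps)

context
  fixes V :: "('g, 'k, 'x) ydo"
  assumes V [simp]: "H.rp V"
begin

private abbreviation "I \<equiv> Ind V"
private abbreviation "A \<equiv> group_algebra K G :: ('k, ('g, 'k, 'x) vec) module"
private abbreviation "B \<equiv> group_algebra K GH :: ('k, ('g, 'k, 'x) vec) module"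

lemma balanced_quotient_ind:
  "balanced_quotient A V (carrier B) (\<lambda>a b. a \<otimes>\<^bsub>A\<^esub> b) (algebra_act GH V) I"
  using V
  by (auto simp: subalgebra_closed ind_yd_def ind_rep_def ind_class_def
      rep.defs yd.defs intro!: balanced_quotient.intro balanced_quotient_axioms.intro)

interpretation C: balanced_quotient A V "carrier B" "\<lambda>a b. a \<otimes>\<^bsub>A\<^esub> b" "algebra_act GH V" I
  by (rule balanced_quotient_ind)

private lemma ind_pure_cls: "ipure V g v = C.cls [(scalar_elem K \<one>\<^bsub>K\<^esub> g, v)]"
  by (simp add: ind_pure_def ind_class_def group_elem_scalar)

text \<open>The quotient is balanced over kH; a scalar gets across as the element c 1 of kH.\<close>

lemma ind_class_scalar_elem:
  assumes "c \<in> carrier K" "g \<in> carrier G" "v \<in> carrier V"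
  shows "C.cls [(scalar_elem K c g, v)] = ipure V g (c \<odot>\<^bsub>V\<^esub> v)"
  using C.cls1_balance[of "scalar_elem K \<one>\<^bsub>K\<^esub> g" "scalar_elem K c \<one>" v] assms
  by (simp add: ind_pure_cls scalar_elem_mult H.algebra_act_scalar_elem)

lemma ind_pure_closed [simp]: "\<lbrakk>g \<in> carrier G; v \<in> carrier V\<rbrakk> \<Longrightarrow> ipure V g v \<in> carrier I"
  by (simp add: ind_pure_cls C.cls1_closed)

lemma ind_pure_mult:
  "\<lbrakk>g \<in> carrier G; h \<in> H; v \<in> carrier V\<rbrakk> \<Longrightarrow> ipure V (g \<otimes> h) v = ipure V g (act V h v)"
  using C.cls1_balance[of "scalar_elem K \<one>\<^bsub>K\<^esub> g" "scalar_elem K \<one>\<^bsub>K\<^esub> h" v]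
  by (simp add: ind_pure_cls scalar_elem_mult H.algebra_act_scalar_elem)

private lemma additive_ind_pure: "g \<in> carrier G \<Longrightarrow> additive V I (ipure V g)"
  using C.additive_cls1_right[of "scalar_elem K \<one>\<^bsub>K\<^esub> g"] by (simp add: ind_pure_cls[abs_def])

text \<open>A scalar in front of a group element is moved into \<open>V\<close>, so group elements
  alone are enough on the left even for additive generation.\<close>

lemma generates_ind_pure:
  assumes D: "generates V D"
  shows "generates I (ipures V D)" (is "generates I ?S")
proof (rule C.Q.generatesI)
  show S: "?S \<subseteq> carrier I" using generates_subset[OF D] by auto
  show "generates I {C.cls [(a, v)] | a v. a \<in> {scalar_elem K c g | c g. c \<in> carrier K \<and> g \<in> carrier G} \<and> v \<in> carrier V}"
    by (rule C.generates_cls1[OF generates_algebra C.N.generates_carrier])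
  fix x assume "x \<in> {C.cls [(a, v)] | a v. a \<in> {scalar_elem K c g | c g. c \<in> carrier K \<and> g \<in> carrier G} \<and> v \<in> carrier V}"
  then obtain c g v where x: "x = C.cls [(scalar_elem K c g, v)]" "c \<in> carrier K" "g \<in> carrier G" "v \<in> carrier V"
    by blast
  then have x': "x = ipure V g (c \<odot>\<^bsub>V\<^esub> v)" by (simp add: ind_class_scalar_elem)
  have "ipure V g w \<in> additive_span I ?S" if "w \<in> carrier V" for w
    using D that
  proof (induction rule: C.N.generates_induct)
    case zero
    show ?case using additive_zero[OF _ C.abelian_group_Q additive_ind_pure[OF x(3)]] by (simp add: additive_span.zero)
  next
    case (base v)
    then show ?case using x(3) by (intro C.Q.additive_span_base[OF S]) blast
  next
    case (add v w)
    then show ?case using x(3) by (simp add: additive_add[OF additive_ind_pure] C.Q.additive_span_add[OF S])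
  qed
  then show "x \<in> additive_span I ?S" using x(2-4) by (simp add: x')
qed

text \<open>Scalars act on the left entry, where they commute with right multiplication by
  kH.\<close>

private lemma smult_balanced:
  assumes c: "c \<in> carrier K"
  shows "balanced_map A V (carrier B) (\<lambda>a b. a \<otimes>\<^bsub>A\<^esub> b) (algebra_act GH V) I (\<lambda>a v. C.cls [(c \<odot>\<^bsub>A\<^esub> a, v)])"
  unfolding balanced_map_def
proof (intro conjI ballI)
  note smult = additive_algebra_smult[OF c]
  show "additive V I (\<lambda>v. C.cls [(c \<odot>\<^bsub>A\<^esub> a, v)])" if "a \<in> carrier A" for a
    by (rule C.additive_cls1_right) (rule additive_closed[OF smult that])
  show "additive A I (\<lambda>a. C.cls [(c \<odot>\<^bsub>A\<^esub> a, v)])" if "v \<in> carrier V" for v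
    using additive_comp[OF smult C.additive_cls1_left[OF that]] .
  show "C.cls [(c \<odot>\<^bsub>A\<^esub> (a \<otimes>\<^bsub>A\<^esub> b), v)] = C.cls [(c \<odot>\<^bsub>A\<^esub> a, algebra_act GH V b v)]"
    if "a \<in> carrier A" "b \<in> carrier B" "v \<in> carrier V" for a b v
    using that c by (simp add: algebra_smult_mult subalgebra_closed C.cls1_balance additive_closed[OF smult])
qed

private lemma smult_lift:
  assumes "c \<in> carrier K" "x \<in> carrier I"
  shows "c \<odot>\<^bsub>I\<^esub> x = lift I (\<lambda>a v. C.cls [(c \<odot>\<^bsub>A\<^esub> a, v)]) x"
proof -
  have "c \<odot>\<^bsub>I\<^esub> x = C.cls (map (\<lambda>(a, v). (c \<odot>\<^bsub>A\<^esub> a, v)) (terms x))"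
    by (simp add: ind_yd_def ind_rep_def ind_class_def rep.defs yd.defs)
  also have "\<dots> = lift I (\<lambda>a v. C.cls [(c \<odot>\<^bsub>A\<^esub> a, v)]) x"
    by (rule C.cls_map_terms)
      (simp_all add: Pi_iff additive_closed[OF additive_algebra_smult[OF assms(1)]] assms(2))
  finally show ?thesis .
qed

lemma smult_ind_pure:
  assumes "c \<in> carrier K" "g \<in> carrier G" "v \<in> carrier V"
  shows "c \<odot>\<^bsub>I\<^esub> ipure V g v = ipure V g (c \<odot>\<^bsub>V\<^esub> v)"
proof -
  have "c \<odot>\<^bsub>I\<^esub> ipure V g v = C.cls [(c \<odot>\<^bsub>A\<^esub> scalar_elem K \<one>\<^bsub>K\<^esub> g, v)]"
    using C.lift_cls1[OF C.abelian_group_Q smult_balanced, of c "scalar_elem K \<one>\<^bsub>K\<^esub> g" v] assms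
    by (simp add: smult_lift) (simp add: ind_pure_cls)
  then show ?thesis using assms by (simp add: scalar_elem_smult ind_class_scalar_elem)
qed

private lemma smult_additive: "c \<in> carrier K \<Longrightarrow> additive I I (\<lambda>x. c \<odot>\<^bsub>I\<^esub> x)"
  using C.lift_additive[OF C.abelian_group_Q smult_balanced, of c]
  by (simp add: additive_def smult_lift Pi_iff)

lemma module_ind: "module K I"
proof -
  note gen = generates_ind_pure[OF abelian_group.generates_carrier]
  have eq: "f x = g x" if "additive I I f" "additive I I g" "x \<in> carrier I"
    "\<And>g' v. \<lbrakk>g' \<in> carrier G; v \<in> carrier V\<rbrakk> \<Longrightarrow> f (ipure V g' v) = g (ipure V g' v)" for f g x
    by (rule additive_eq_on_carrier[OF C.abelian_group_Q C.abelian_group_Q that(1,2) gen _ that(3)])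
      (use that(4) in auto)
  note closed = additive_closed[OF smult_additive]
  show ?thesis
  proof (rule moduleI)
    fix c d x assume cd: "c \<in> carrier K" "d \<in> carrier K" and x: "x \<in> carrier I"
    show "c \<odot>\<^bsub>I\<^esub> x \<in> carrier I" using cd x by (simp add: closed)
    show "(c \<oplus>\<^bsub>K\<^esub> d) \<odot>\<^bsub>I\<^esub> x = c \<odot>\<^bsub>I\<^esub> x \<oplus>\<^bsub>I\<^esub> d \<odot>\<^bsub>I\<^esub> x"
    proof (rule eq[OF _ _ x])
      show "additive I I (\<lambda>x. c \<odot>\<^bsub>I\<^esub> x \<oplus>\<^bsub>I\<^esub> d \<odot>\<^bsub>I\<^esub> x)"
        using cd closed by (intro additiveI) (simp_all add: additive_add[OF smult_additive] C.Q.a_ac)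
    qed (use cd smult_additive in \<open>simp_all add: smult_ind_pure mod_add_smult additive_add[OF additive_ind_pure]\<close>)
    show "(c \<otimes>\<^bsub>K\<^esub> d) \<odot>\<^bsub>I\<^esub> x = c \<odot>\<^bsub>I\<^esub> (d \<odot>\<^bsub>I\<^esub> x)"
    proof (rule eq[OF _ _ x])
      show "additive I I (\<lambda>x. c \<odot>\<^bsub>I\<^esub> (d \<odot>\<^bsub>I\<^esub> x))"
        using cd closed by (intro additiveI) (simp_all add: additive_add[OF smult_additive])
    qed (use cd smult_additive in \<open>simp_all add: smult_ind_pure mod_mult_smult\<close>)
  next
    fix x assume x: "x \<in> carrier I"
    show "\<one>\<^bsub>K\<^esub> \<odot>\<^bsub>I\<^esub> x = x"
    proof (rule eq[OF _ _ x])
      show "additive I I (\<lambda>x. x)" by (rule additiveI) simp_all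
    qed (use smult_additive in \<open>simp_all add: smult_ind_pure\<close>)
  qed (simp_all add: C.abelian_group_Q additive_add[OF smult_additive] K.is_cring)
qed

lemma linear_ind_pure: "g \<in> carrier G \<Longrightarrow> ipure V g \<in> linear_maps K V I"
  by (rule linear_mapsI) (simp_all add: additive_add[OF additive_ind_pure] smult_ind_pure)

context
  fixes T :: "('k, 't, 'p) module_scheme" and \<phi> :: "'g \<Rightarrow> ('g, 'k, 'x) vec \<Rightarrow> 't"
  assumes T [simp]: "module K T" and \<phi>: "induction_map K G H V T \<phi>"
begin

private lemma \<phi>_linear: "g \<in> carrier G \<Longrightarrow> \<phi> g \<in> linear_maps K V T"
  and \<phi>_mult: "\<lbrakk>g \<in> carrier G; h \<in> H; v \<in> carrier V\<rbrakk> \<Longrightarrow> \<phi> (g \<otimes> h) v = \<phi> g (act V h v)"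
  using \<phi> by (simp_all add: induction_map_def)

private lemma \<phi>_closed [simp]: "\<lbrakk>g \<in> carrier G; v \<in> carrier V\<rbrakk> \<Longrightarrow> \<phi> g v \<in> carrier T"
  by (rule linear_closed[OF \<phi>_linear])

private lemma expand_additive: "v \<in> carrier V \<Longrightarrow> additive A T (expand G T (\<lambda>g. \<phi> g v))"
  by (rule additive_expand) simp_all

private lemma expand_linear: "a \<in> carrier A \<Longrightarrow> (\<lambda>v. expand G T (\<lambda>g. \<phi> g v) a) \<in> linear_maps K V T"
  unfolding expand_def by (intro linear_finsum_fun linear_scale \<phi>_linear) simp_all

text \<open>Both sides are additive in \<open>a\<close> and in \<open>b\<close>. For a = c g and b =
  d h the claim reduces to the compatibility \<open>\<phi>_mult\<close> of the family with
  \<open>H\<close>.\<close>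

private lemma expand_balanced:
  "balanced_map A V (carrier B) (\<lambda>a b. a \<otimes>\<^bsub>A\<^esub> b) (algebra_act GH V) T (\<lambda>a v. expand G T (\<lambda>g. \<phi> g v) a)"
  unfolding balanced_map_def
proof (intro conjI ballI)
  fix a b v assume a: "a \<in> carrier A" and b: "b \<in> carrier B" and v: "v \<in> carrier V"
  show "expand G T (\<lambda>g. \<phi> g v) (a \<otimes>\<^bsub>A\<^esub> b) = expand G T (\<lambda>g. \<phi> g (algebra_act GH V b v)) a"
  proof (rule algebra_eq_on_generators[where a = a and T = T])
    show "additive A T (\<lambda>a. expand G T (\<lambda>g. \<phi> g v) (a \<otimes>\<^bsub>A\<^esub> b))"
      by (rule additive_comp[OF additive_algebra_mult_left expand_additive]) (use b v subalgebra_closed in simp_all)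
    show "additive A T (\<lambda>a. expand G T (\<lambda>g. \<phi> g (algebra_act GH V b v)) a)"
      using b v expand_additive by simp
    fix c g assume c: "c \<in> carrier K" and g: "g \<in> carrier G"
    let ?a = "scalar_elem K c g :: ('g, 'k, 'x) vec"
    show "expand G T (\<lambda>g. \<phi> g v) (?a \<otimes>\<^bsub>A\<^esub> b) = expand G T (\<lambda>g. \<phi> g (algebra_act GH V b v)) ?a"
    proof (rule H.algebra_eq_on_generators[where a = b and T = T])
      show "additive B T (\<lambda>b. expand G T (\<lambda>g. \<phi> g v) (?a \<otimes>\<^bsub>A\<^esub> b))"
        by (rule additive_subalgebra, rule additive_comp[OF additive_algebra_mult_right expand_additive])
          (use c g v in simp_all)
      show "additive B T (\<lambda>b. expand G T (\<lambda>g. \<phi> g (algebra_act GH V b v)) ?a)"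
        unfolding H.algebra_act_expand
        by (rule additive_comp[OF H.additive_expand linear_additive[OF expand_linear]]) (use c g v in simp_all)
      fix d h assume d: "d \<in> carrier K" and h: "h \<in> carrier GH"
      then show "expand G T (\<lambda>g. \<phi> g v) (?a \<otimes>\<^bsub>A\<^esub> scalar_elem K d h)
        = expand G T (\<lambda>g. \<phi> g (algebra_act GH V (scalar_elem K d h) v)) ?a"
        using c g v by (simp add: scalar_elem_mult expand_scalar_elem H.algebra_act_scalar_elem \<phi>_mult
            mod_mult_smult linear_smult[OF \<phi>_linear])
    qed (use b in simp_all)
  qed (use a in simp_all)
qed (simp_all add: expand_additive linear_additive[OF expand_linear])

private lemma ind_lift_expand: "ind_lift G T \<phi> = lift T (\<lambda>a v. expand G T (\<lambda>g. \<phi> g v) a)"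
  by (simp add: ind_lift_def expand_def)

lemma ind_lift_pure: "\<lbrakk>g \<in> carrier G; v \<in> carrier V\<rbrakk> \<Longrightarrow> ind_lift G T \<phi> (ipure V g v) = \<phi> g v"
  unfolding ind_lift_expand ind_pure_cls
  by (subst C.lift_cls1[OF _ expand_balanced]) (simp_all add: expand_scalar_elem)

lemma ind_lift_linear: "ind_lift G T \<phi> \<in> linear_maps K I T"
proof (rule additive_imp_linear[OF module_ind T _ generates_ind_pure[OF abelian_group.generates_carrier]])
  show "additive I T (ind_lift G T \<phi>)"
    unfolding ind_lift_expand by (rule C.lift_additive[OF _ expand_balanced]) simp
qed (auto simp: smult_ind_pure ind_lift_pure linear_smult[OF \<phi>_linear])

end

text \<open>Left multiplication by a group element commutes with right multiplication by kH and
  hence descends to the quotient. In the form of \<open>ind_lift\<close> the action can be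
  evaluated, and its laws tested, on g \<otimes> v.\<close>

lemma act_ind_lift:
  assumes "k \<in> carrier G" "x \<in> carrier I"
  shows "act I k x = ind_lift G I (\<lambda>g v. ipure V (k \<otimes> g) v) x"
proof -
  let ?k = "group_elem K k :: ('g, 'k, 'x) vec"
  have k: "?k \<in> carrier A" using assms by (simp add: group_elem_scalar)
  have bal: "balanced_map A V (carrier B) (\<lambda>a b. a \<otimes>\<^bsub>A\<^esub> b) (algebra_act GH V) I (\<lambda>a v. C.cls [(?k \<otimes>\<^bsub>A\<^esub> a, v)])"
    unfolding balanced_map_def
  proof (intro conjI ballI)
    show "additive V I (\<lambda>v. C.cls [(?k \<otimes>\<^bsub>A\<^esub> a, v)])" if "a \<in> carrier A" for a
      using that k by (intro C.additive_cls1_right) simp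
    show "additive A I (\<lambda>a. C.cls [(?k \<otimes>\<^bsub>A\<^esub> a, v)])" if "v \<in> carrier V" for v
      using additive_comp[OF additive_algebra_mult_right[OF k] C.additive_cls1_left[OF that]] .
    show "C.cls [(?k \<otimes>\<^bsub>A\<^esub> (a \<otimes>\<^bsub>A\<^esub> b), v)] = C.cls [(?k \<otimes>\<^bsub>A\<^esub> a, algebra_act GH V b v)]"
      if "a \<in> carrier A" "b \<in> carrier B" "v \<in> carrier V" for a b v
      using that k by (simp add: algebra_mult_assoc[symmetric] subalgebra_closed C.cls1_balance)
  qed
  have ind: "induction_map K G H V I (\<lambda>g v. ipure V (k \<otimes> g) v)"
    using assms(1) by (auto simp: induction_map_def linear_ind_pure ind_pure_mult m_assoc[symmetric])
  have "act I k x = C.cls (map (\<lambda>(a, v). (?k \<otimes>\<^bsub>A\<^esub> a, v)) (terms x))"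
    by (simp add: ind_yd_def ind_rep_def ind_class_def rep.defs yd.defs)
  also have "\<dots> = lift I (\<lambda>a v. C.cls [(?k \<otimes>\<^bsub>A\<^esub> a, v)]) x"
    by (rule C.cls_map_terms) (use assms k in auto)
  also have "\<dots> = ind_lift G I (\<lambda>g v. ipure V (k \<otimes> g) v) x"
  proof (rule additive_eq_on_carrier[OF C.abelian_group_Q C.abelian_group_Q
        C.lift_additive[OF C.abelian_group_Q bal] linear_additive[OF ind_lift_linear[OF module_ind ind]]
        generates_ind_pure[OF abelian_group.generates_carrier] _ assms(2)])
    fix y assume "y \<in> ipures V (carrier V)"
    then obtain g v where y: "y = ipure V g v" "g \<in> carrier G" "v \<in> carrier V" by blast
    then have "lift I (\<lambda>a v. C.cls [(?k \<otimes>\<^bsub>A\<^esub> a, v)]) y = C.cls [(?k \<otimes>\<^bsub>A\<^esub> scalar_elem K \<one>\<^bsub>K\<^esub> g, v)]"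
      by (simp add: ind_pure_cls C.lift_cls1[OF C.abelian_group_Q bal])
    also have "\<dots> = ipure V (k \<otimes> g) v"
      using y assms(1) by (simp add: group_elem_scalar scalar_elem_mult ind_pure_cls)
    finally show "lift I (\<lambda>a v. C.cls [(?k \<otimes>\<^bsub>A\<^esub> a, v)]) y = ind_lift G I (\<lambda>g v. ipure V (k \<otimes> g) v) y"
      using y by (simp add: ind_lift_pure[OF module_ind ind])
  qed simp
  finally show ?thesis .
qed

lemma act_ind_pure:
  assumes "k \<in> carrier G" "g \<in> carrier G" "v \<in> carrier V"
  shows "act I k (ipure V g v) = ipure V (k \<otimes> g) v"
proof -
  have ind: "induction_map K G H V I (\<lambda>g v. ipure V (k \<otimes> g) v)"
    using assms(1) by (auto simp: induction_map_def linear_ind_pure ind_pure_mult m_assoc[symmetric])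
  show ?thesis using assms by (simp add: act_ind_lift ind_lift_pure[OF module_ind ind])
qed

lemma rep_ind: "rp I"
proof -
  have ind: "induction_map K G H V I (\<lambda>g v. ipure V (k \<otimes> g) v)" if "k \<in> carrier G" for k
    using that by (auto simp: induction_map_def linear_ind_pure ind_pure_mult m_assoc[symmetric])
  have lin: "act I k \<in> linear_maps K I I" if "k \<in> carrier G" for k
    by (rule linear_cong[OF module_ind ind_lift_linear[OF module_ind ind]]) (use that in \<open>simp_all add: act_ind_lift\<close>)
  note gen = generates_ind_pure[OF abelian_group.generates_carrier]
  have "act I \<one> x = x" if "x \<in> carrier I" for x
    by (rule linear_eq_on_carrier[OF module_ind module_ind lin linear_id gen]) (use that in \<open>auto simp: act_ind_pure\<close>)
  moreover have "act I (g \<otimes> h) x = act I g (act I h x)"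
    if "g \<in> carrier G" "h \<in> carrier G" "x \<in> carrier I" for g h x
    by (rule linear_eq_on_carrier[OF module_ind module_ind lin linear_comp[OF lin lin] gen])
      (use that in \<open>auto simp: act_ind_pure m_assoc\<close>)
  moreover have "finite_dim K I"
  proof -
    obtain D where D: "finite D" "D \<subseteq> carrier V" "generates V {c \<odot>\<^bsub>V\<^esub> b | c b. c \<in> carrier K \<and> b \<in> D}"
      using V by (auto simp only: representation_def finite_dim_iff_generates)
    \<comment> \<open>The finite set of all g \<otimes> b with b in \<open>D\<close> spans, because
      scalars pass between \<open>V\<close> and the induced module by
      \<open>smult_ind_pure\<close>.\<close>
    let ?S = "ipures V D"
    have S: "?S \<subseteq> carrier I" using subsetD[OF D(2)] by auto
    have "?S = (\<lambda>(g, v). ipure V g v) ` (carrier G \<times> D)" by auto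
    then have "finite ?S" using D(1) finite_G by simp
    have "{ipure V g v | g v. g \<in> carrier G \<and> v \<in> {c \<odot>\<^bsub>V\<^esub> b | c b. c \<in> carrier K \<and> b \<in> D}}
      = {c \<odot>\<^bsub>I\<^esub> b | c b. c \<in> carrier K \<and> b \<in> ?S}" (is "?L = ?R")
    proof (intro equalityI subsetI)
      fix x assume "x \<in> ?L"
      then obtain g c b where x: "g \<in> carrier G" "c \<in> carrier K" "b \<in> D" "x = ipure V g (c \<odot>\<^bsub>V\<^esub> b)"
        by blast
      then have "x = c \<odot>\<^bsub>I\<^esub> ipure V g b" using subsetD[OF D(2)] by (simp add: smult_ind_pure)
      then show "x \<in> ?R" using x by blast
    next
      fix x assume "x \<in> ?R"
      then obtain g c b where x: "g \<in> carrier G" "c \<in> carrier K" "b \<in> D" "x = c \<odot>\<^bsub>I\<^esub> ipure V g b"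
        by blast
      then have "x = ipure V g (c \<odot>\<^bsub>V\<^esub> b)" using subsetD[OF D(2)] by (simp add: smult_ind_pure)
      then show "x \<in> ?L" using x by blast
    qed
    then have "generates I {c \<odot>\<^bsub>I\<^esub> b | c b. c \<in> carrier K \<and> b \<in> ?S}"
      using generates_ind_pure[OF D(3)] by simp
    with \<open>finite ?S\<close> S show ?thesis
      unfolding finite_dim_iff_generates[OF module_ind] by (intro exI[of _ ?S] conjI)
  qed
  ultimately show ?thesis using lin module_ind unfolding representation_def by simp
qed

lemma grade_ind:
  assumes "\<And>h. h \<in> H \<Longrightarrow> grade V h \<subseteq> carrier V"
  shows "grade I x = additive_span I {ipure V g v | g v. \<exists>h. g \<in> carrier G \<and> h \<in> H
        \<and> v \<in> grade V h \<and> g \<otimes> h \<otimes> inv g = x}"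
proof -
  let ?P = "{(group_elem K g, v) | g v h. g \<in> carrier G \<and> h \<in> H \<and> v \<in> grade V h \<and> g \<otimes> h \<otimes> inv g = x}"
  have "grade I x = C.cls ` lists ?P"
    by (simp add: ind_yd_def ind_rep_def ind_class_def rep.defs yd.defs)
  also have "\<dots> = additive_span I {C.cls [(a, v)] | a v. (a, v) \<in> ?P}"
    by (rule C.cls_image_lists) (use assms in \<open>auto simp: group_elem_scalar\<close>)
  also have "{C.cls [(a, v)] | a v. (a, v) \<in> ?P} = {ipure V g v | g v. \<exists>h. g \<in> carrier G \<and> h \<in> H
        \<and> v \<in> grade V h \<and> g \<otimes> h \<otimes> inv g = x}"
    by (auto simp: ind_pure_def ind_class_def)
  finally show ?thesis .
qed

end

lemma unit_GH [simp]: "unit_yd K GH = Unit"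
  by (simp add: unit_yd_def)

text \<open>Replacing g by gh conjugates the element whose membership in \<open>H\<close> selects
  the branch of a projection on the induced module; the branch must stay the same.\<close>

lemma H_conj_iff:
  "\<lbrakk>g \<in> carrier G; h \<in> H\<rbrakk> \<Longrightarrow> inv h \<otimes> g \<otimes> h \<in> H \<longleftrightarrow> g \<in> H"
proof
  assume g: "g \<in> carrier G" and h: "h \<in> H" and "inv h \<otimes> g \<otimes> h \<in> H"
  then have "h \<otimes> (inv h \<otimes> g \<otimes> h) \<otimes> inv h \<in> H" by simp
  moreover have "h \<otimes> (inv h \<otimes> g \<otimes> h) \<otimes> inv h = g"
    using g h by (simp add: m_assoc) (simp add: m_assoc[symmetric])
  ultimately show "g \<in> H" by simp
qed simp

lemma H_mult_iff:
  assumes "g \<in> carrier G" "h \<in> H"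
  shows "h \<otimes> g \<in> H \<longleftrightarrow> g \<in> H" and "g \<otimes> h \<in> H \<longleftrightarrow> g \<in> H"
proof -
  have "inv h \<otimes> (h \<otimes> g) = g" "g \<otimes> h \<otimes> inv h = g"
    using assms by (simp_all add: m_assoc inv_solve_left')
  then show "h \<otimes> g \<in> H \<longleftrightarrow> g \<in> H" "g \<otimes> h \<in> H \<longleftrightarrow> g \<in> H"
    using assms by (metis H_inv H_mult)+
qed

lemma H_rep_modules [simp]: "H.rp V \<Longrightarrow> module K (Ind V)"
  by (rule module_ind)

context
  fixes V :: "('g, 'k, 'x) ydo"
  assumes V [simp]: "H.yd V"
begin

private abbreviation "IV \<equiv> Ind V"

lemma ind_pure_zero: "g \<in> carrier G \<Longrightarrow> ipure V g \<zero>\<^bsub>V\<^esub> = \<zero>\<^bsub>IV\<^esub>"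
  by (rule linear_zero[OF _ _ linear_ind_pure]) simp_all

lemma H_grade_closed: "\<lbrakk>h \<in> H; v \<in> grade V h\<rbrakk> \<Longrightarrow> v \<in> carrier V"
  using H.grade_closed[OF V] by simp

lemma yd_ind [simp]: "yd IV"
proof -
  define D where "D x = {ipure V g v | g v. \<exists>h. g \<in> carrier G \<and> h \<in> H
        \<and> v \<in> grade V h \<and> g \<otimes> h \<otimes> inv g = x}" for x
  \<comment> \<open>Candidate for the projection onto degree \<open>x\<close>: as g \<otimes> v has
    degree g|v|g^-1, it keeps the component of \<open>v\<close> in degree
    \<open>inv g \<otimes> x \<otimes> g\<close>, provided this is an element of
    \<open>H\<close>.\<close>
  define \<phi> where "\<phi> x g v = (if inv g \<otimes> x \<otimes> g \<in> H then ipure V g (component GH V v (inv g \<otimes> x \<otimes> g))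
    else \<zero>\<^bsub>IV\<^esub>)" for x g v
  have \<phi>: "induction_map K G H V IV (\<phi> x)" if x: "x \<in> carrier G" for x
    unfolding induction_map_def
  proof (intro conjI ballI)
    fix g assume g: "g \<in> carrier G"
    show "\<phi> x g \<in> linear_maps K V IV"
    proof (cases "inv g \<otimes> x \<otimes> g \<in> H")
      case True
      then have "(\<lambda>v. ipure V g (component GH V v (inv g \<otimes> x \<otimes> g))) \<in> linear_maps K V IV"
        using g by (intro linear_comp[OF H.component_linear linear_ind_pure]) simp_all
      then show ?thesis using True by (simp add: \<phi>_def[abs_def])
    next
      case False
      then show ?thesis by (simp add: \<phi>_def[abs_def] linear_const_zero)
    qed
    fix h v assume h: "h \<in> H" and v: "v \<in> carrier V"
    \<comment> \<open>Passing from g to gh conjugates the required degree by \<open>h\<close>;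
      \<open>H.component_act\<close> turns this into the action of \<open>h\<close> on
      \<open>v\<close>.\<close>
    have eq: "inv (g \<otimes> h) \<otimes> x \<otimes> (g \<otimes> h) = inv h \<otimes> (inv g \<otimes> x \<otimes> g) \<otimes> h"
      using g h x by (simp add: inv_mult_group m_assoc)
    show "\<phi> x (g \<otimes> h) v = \<phi> x g (act V h v)"
    proof (cases "inv g \<otimes> x \<otimes> g \<in> H")
      case True
      then have "component GH V v (inv h \<otimes> (inv g \<otimes> x \<otimes> g) \<otimes> h) \<in> carrier V"
        using H.component_closed[OF V v] h by simp
      then show ?thesis
        using True g h x v H.component_act[OF V, of h "inv g \<otimes> x \<otimes> g" v]
        by (simp add: \<phi>_def eq H_conj_iff ind_pure_mult)
    next
      case False
      then show ?thesis using g h x by (simp add: \<phi>_def eq H_conj_iff)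
    qed
  qed
  show ?thesis
  proof (rule yetter_drinfeldI[where D = D and p = "\<lambda>x. ind_lift G IV (\<phi> x)"])
    show "rp IV" by (simp add: rep_ind)
    show "grade IV x = additive_span IV (D x)" for x
      unfolding D_def by (rule grade_ind) (use H_grade_closed in auto)
    show D: "D x \<subseteq> carrier IV" for x
      by (auto simp: D_def H_grade_closed)
    show "c \<odot>\<^bsub>IV\<^esub> t \<in> D x" if "c \<in> carrier K" "t \<in> D x" for c x t
    proof -
      from that(2) obtain g v h where t: "t = ipure V g v" "g \<in> carrier G" "h \<in> H"
        "v \<in> grade V h" "g \<otimes> h \<otimes> inv g = x" by (auto simp: D_def)
      then have "c \<odot>\<^bsub>IV\<^esub> t = ipure V g (c \<odot>\<^bsub>V\<^esub> v)"
        using that(1) by (simp add: smult_ind_pure H_grade_closed)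
      moreover have "c \<odot>\<^bsub>V\<^esub> v \<in> grade V h" using H.grade_smult[OF V _ that(1)] t by simp
      ultimately show ?thesis using t unfolding D_def by blast
    qed
    show "act IV k t \<in> D (k \<otimes> x \<otimes> inv k)" if k: "k \<in> carrier G" "x \<in> carrier G" and "t \<in> D x" for k x t
    proof -
      from that(3) obtain g v h where t: "t = ipure V g v" "g \<in> carrier G" "h \<in> H"
        "v \<in> grade V h" "g \<otimes> h \<otimes> inv g = x" by (auto simp: D_def)
      then have "act IV k t = ipure V (k \<otimes> g) v"
        using k by (simp add: act_ind_pure H_grade_closed)
      moreover have "k \<otimes> g \<otimes> h \<otimes> inv (k \<otimes> g) = k \<otimes> x \<otimes> inv k"
        using k t(2,3) by (simp add: t(5)[symmetric] inv_mult_group m_assoc)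
      moreover have "k \<otimes> g \<in> carrier G" using k t by simp
      ultimately show ?thesis using t(3,4) unfolding D_def by blast
    qed
    have "(ipures V (homogeneous GH V)) \<subseteq> (\<Union>x \<in> carrier G. D x)"
    proof
      fix t assume "t \<in> ipures V (homogeneous GH V)"
      then obtain g v h where t: "t = ipure V g v" "g \<in> carrier G" "h \<in> H" "v \<in> grade V h"
        by (auto simp: homogeneous_def)
      then have "t \<in> D (g \<otimes> h \<otimes> inv g)" unfolding D_def by blast
      then show "t \<in> (\<Union>x \<in> carrier G. D x)" using t by (intro UN_I[of "g \<otimes> h \<otimes> inv g"]) simp_all
    qed
    then show "generates IV (\<Union>x \<in> carrier G. D x)"
      using abelian_group.generates_mono[OF _ generates_ind_pure[OF _ H.generates_homogeneous[OF V]]] D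
      by (simp add: UN_least)
    show "additive IV IV (ind_lift G IV (\<phi> x))" if "x \<in> carrier G" for x
      by (rule linear_additive[OF ind_lift_linear[OF _ _ \<phi>[OF that]]]) simp_all
    show "ind_lift G IV (\<phi> x) t = (if x = y then t else \<zero>\<^bsub>IV\<^esub>)"
      if x: "x \<in> carrier G" and y: "y \<in> carrier G" and "t \<in> D y" for x y t
    proof -
      from that(3) obtain g v h where t: "t = ipure V g v" "g \<in> carrier G" "h \<in> H"
        "v \<in> grade V h" "g \<otimes> h \<otimes> inv g = y" by (auto simp: D_def)
      \<comment> \<open>The degree inspected by the projection is the degree \<open>h\<close> of
        \<open>v\<close> exactly when \<open>x\<close> is the degree of \<open>t\<close>.\<close>
      have xy: "inv g \<otimes> x \<otimes> g = h \<longleftrightarrow> x = y"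
        using t(2,3) x unfolding t(5)[symmetric]
        by (metis H_closed inv_closed inv_solve_left inv_solve_right m_assoc m_closed)
      have "ind_lift G IV (\<phi> x) t = \<phi> x g v"
        using t by (simp add: ind_lift_pure[OF _ _ \<phi>[OF x]] H_grade_closed)
      also have "\<dots> = (if inv g \<otimes> x \<otimes> g = h then t else \<zero>\<^bsub>IV\<^esub>)"
        using t(1-4) H.component_homogeneous[OF V _ t(4)]
        by (simp add: \<phi>_def ind_pure_zero)
      finally show ?thesis by (simp only: xy)
    qed
  qed
qed

lemma ind_pure_grade:
  assumes "g \<in> carrier G" "h \<in> H" "v \<in> grade V h"
  shows "ipure V g v \<in> grade IV (g \<otimes> h \<otimes> inv g)"
proof -
  interpret I: module K IV by simp
  have "grade IV (g \<otimes> h \<otimes> inv g) = additive_span IV {ipure V g' v | g' v. \<exists>h'. g' \<in> carrier G \<and> h' \<in> H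
        \<and> v \<in> grade V h' \<and> g' \<otimes> h' \<otimes> inv g' = g \<otimes> h \<otimes> inv g}"
    by (rule grade_ind) (use H_grade_closed in auto)
  also have "ipure V g v \<in> \<dots>"
    by (rule I.M.additive_span_base) (use assms H_grade_closed in auto)
  finally show ?thesis .
qed

text \<open>Counterpart of \<open>lift_yd_maps\<close> for maps out of an induced module. With
  \<open>D\<close> a parameter, the module being induced may itself be a tensor product, tested on
  its pure tensors of homogeneous vectors.\<close>

lemma ind_lift_yd_maps:
  assumes U: "yd U" and \<phi>: "induction_map K G H V U \<phi>" and D: "generates V D"
    and act: "\<And>k g v. \<lbrakk>k \<in> carrier G; g \<in> carrier G; v \<in> D\<rbrakk> \<Longrightarrow> \<phi> (k \<otimes> g) v = act U k (\<phi> g v)"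
    and gr: "\<And>g v. \<lbrakk>g \<in> carrier G; v \<in> D\<rbrakk> \<Longrightarrow> \<exists>h \<in> H. v \<in> grade V h \<and> \<phi> g v \<in> grade U (g \<otimes> h \<otimes> inv g)"
  shows "ind_lift G U \<phi> \<in> yd_maps K G IV U"
proof (rule yd_mapsI[OF yd_ind U])
  note [simp] = ind_lift_pure[OF _ _ \<phi>] U generates_subset[OF D]
  show "ind_lift G U \<phi> \<in> linear_maps K IV U" by (rule ind_lift_linear[OF _ _ \<phi>]) simp_all
  show "generates IV (ipures V D)"
    by (rule generates_ind_pure[OF _ D]) simp
  show "ind_lift G U \<phi> (act IV k a) = act U k (ind_lift G U \<phi> a)"
    if "k \<in> carrier G" "a \<in> ipures V D" for k a
    using that by (auto simp: act_ind_pure act)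
  fix a assume "a \<in> ipures V D"
  then obtain g v where a: "a = ipure V g v" "g \<in> carrier G" "v \<in> D" by blast
  from gr[OF a(2,3)] obtain h where "h \<in> H" "v \<in> grade V h" "\<phi> g v \<in> grade U (g \<otimes> h \<otimes> inv g)" by blast
  then show "\<exists>x\<in>carrier G. a \<in> grade IV x \<and> ind_lift G U \<phi> a \<in> grade U x"
    using a(2,3) by (intro bexI[of _ "g \<otimes> h \<otimes> inv g"]) (simp_all add: a(1) ind_pure_grade)
qed

end

section \<open>Induction on morphisms\<close>

lemma ind_map:
  fixes V W :: "('g, 'k, 'x) ydo"
  assumes V [simp]: "H.rp V" and W [simp]: "H.rp W" and f: "f \<in> linear_maps K V W"
    and act: "\<And>h v. \<lbrakk>h \<in> H; v \<in> carrier V\<rbrakk> \<Longrightarrow> f (act V h v) = act W h (f v)"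
  shows "\<And>g v. \<lbrakk>g \<in> carrier G; v \<in> carrier V\<rbrakk>
      \<Longrightarrow> lift (Ind W) (\<lambda>a v. ind_class K G H W [(a, f v)]) (ipure V g v) = ipure W g (f v)"
    and "lift (Ind W) (\<lambda>a v. ind_class K G H W [(a, f v)]) \<in> linear_maps K (Ind V) (Ind W)"
proof -
  let ?A = "group_algebra K G :: ('k, ('g, 'k, 'x) vec) module"
  let ?B = "group_algebra K GH :: ('k, ('g, 'k, 'x) vec) module"
  let ?F = "lift (Ind W) (\<lambda>a v. ind_class K G H W [(a, f v)])"
  interpret C: balanced_quotient ?A V "carrier ?B" "\<lambda>a b. a \<otimes>\<^bsub>?A\<^esub> b" "algebra_act GH V" "Ind V"
    by (rule balanced_quotient_ind[OF V])
  interpret D: balanced_quotient ?A W "carrier ?B" "\<lambda>a b. a \<otimes>\<^bsub>?A\<^esub> b" "algebra_act GH W" "Ind W"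
    by (rule balanced_quotient_ind[OF W])
  have f_closed: "f v \<in> carrier W" if "v \<in> carrier V" for v using f that by (rule linear_closed)
  \<comment> \<open>Equivariance under \<open>H\<close> extends to all of kH by additivity in
    \<open>b\<close>; this is the balancing condition for (a, v) \<mapsto> a \<otimes> f v.\<close>
  have f_act: "f (algebra_act GH V b v) = algebra_act GH W b (f v)" if b: "b \<in> carrier ?B" and v: "v \<in> carrier V" for b v
    unfolding H.algebra_act_expand
    by (rule H.algebra_eq_on_generators[where a = b and T = W,
          OF _ additive_comp[OF H.additive_expand linear_additive[OF f]] H.additive_expand])
      (use b v f f_closed in \<open>simp_all add: H.algebra_act_scalar_elem linear_smult[OF f] act
        flip: H.algebra_act_expand\<close>)
  have bal: "balanced_map ?A V (carrier ?B) (\<lambda>a b. a \<otimes>\<^bsub>?A\<^esub> b) (algebra_act GH V) (Ind W) (\<lambda>a v. D.cls [(a, f v)])"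
    unfolding balanced_map_def
  proof (intro conjI ballI)
    show "additive V (Ind W) (\<lambda>v. D.cls [(a, f v)])" if "a \<in> carrier ?A" for a
      by (rule additive_comp[OF linear_additive[OF f] D.additive_cls1_right[OF that]])
    show "additive ?A (Ind W) (\<lambda>a. D.cls [(a, f v)])" if "v \<in> carrier V" for v
      by (rule D.additive_cls1_left[OF f_closed[OF that]])
    show "D.cls [(a \<otimes>\<^bsub>?A\<^esub> b, f v)] = D.cls [(a, f (algebra_act GH V b v))]"
      if "a \<in> carrier ?A" "b \<in> carrier ?B" "v \<in> carrier V" for a b v
      using that by (simp add: f_act D.cls1_balance f_closed)
  qed
  show pure: "?F (ipure V g v) = ipure W g (f v)" if "g \<in> carrier G" "v \<in> carrier V" for g v
    using that C.lift_cls1[OF D.abelian_group_Q bal, of "group_elem K g" v]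
    by (simp add: ind_pure_def ind_class_def group_elem_scalar)
  show "?F \<in> linear_maps K (Ind V) (Ind W)"
  proof (rule additive_imp_linear[OF _ _ _ generates_ind_pure[OF V abelian_group.generates_carrier]])
    show "additive (Ind V) (Ind W) ?F"
      using C.lift_additive[OF D.abelian_group_Q bal] by (simp add: ind_class_def)
  qed (auto simp: smult_ind_pure pure linear_smult[OF f] f_closed)
qed

lemma src_tgt_ind [simp]:
  "src (ind_arrow K G H f) = Ind (src f)" "tgt (ind_arrow K G H f) = Ind (tgt f)"
  "src (ind_delta K G H V W) = Ind (H.ten V W)"
  "tgt (ind_delta K G H V W) = ten (Ind V) (Ind W)"
  "src (ind_mu K G H V W) = ten (Ind V) (Ind W)"
  "tgt (ind_mu K G H V W) = Ind (H.ten V W)"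
  "src (ind_eps K G H) = Ind (Unit)" "tgt (ind_eps K G H) = Unit"
  "src (ind_eta K G H) = Unit" "tgt (ind_eta K G H) = Ind (Unit)"
  by (simp_all add: ind_arrow_def ind_delta_def ind_mu_def ind_eps_def ind_eta_def Let_def)

lemma fn_ind_arrow [simp]:
  assumes "H.arr f" "src f = V" "g \<in> carrier G" "v \<in> carrier V"
  shows "fn (ind_arrow K G H f) (ipure V g v) = ipure (tgt f) g (fn f v)"
  using assms ind_map(1)[OF _ _ H.arr_linear[OF assms(1)], of g v] H.yd_maps_act[OF H.arr_yd_maps[OF assms(1)]]
  by (auto simp: ind_arrow_def Let_def)

lemma arr_ind_arrow [simp]:
  assumes f: "H.arr f"
  shows "arr (ind_arrow K G H f)"
proof -
  let ?F = "lift (Ind (tgt f)) (\<lambda>a v. ind_class K G H (tgt f) [(a, fn f v)])"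
  note F = ind_map[OF _ _ H.arr_linear[OF f]]
  have yd [simp]: "H.yd (src f)" "H.yd (tgt f)" using f by simp_all
  have act: "fn f (act (src f) h v) = act (tgt f) h (fn f v)" if "h \<in> H" "v \<in> carrier (src f)" for h v
    using H.yd_maps_act[OF H.arr_yd_maps[OF f]] that by simp
  have "?F \<in> yd_maps K G (Ind (src f)) (Ind (tgt f))"
  proof (rule yd_mapsI[OF _ _ F(2) generates_ind_pure[OF _ H.generates_homogeneous]])
    fix a assume "a \<in> ipures (src f) (homogeneous GH (src f))"
    then obtain g v h where a: "a = ipure (src f) g v" "g \<in> carrier G" "h \<in> H" "v \<in> grade (src f) h"
      by (auto simp: homogeneous_def)
    have v: "v \<in> carrier (src f)" using a(3,4) by (simp add: H_grade_closed)
    have "fn f v \<in> grade (tgt f) h" using H.yd_maps_grade[OF H.arr_yd_maps[OF f]] a by simp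
    then show "\<exists>x\<in>carrier G. a \<in> grade (Ind (src f)) x \<and> ?F a \<in> grade (Ind (tgt f)) x"
      using a v f by (intro bexI[of _ "g \<otimes> h \<otimes> inv g"]) (simp_all add: ind_pure_grade F(1) act)
    show "?F (act (Ind (src f)) k a) = act (Ind (tgt f)) k (?F a)" if "k \<in> carrier G" for k
      using a v f that by (simp add: act_ind_pure F(1) act)
  qed (simp_all add: act)
  then show ?thesis unfolding ind_arrow_def Let_def by (intro arr_arrow_of) simp_all
qed

lemma H_act_pure [simp]:
  fixes V W :: "('g, 'k, 'x) ydo"
  assumes "H.yd V" "H.yd W" "h \<in> H" "v \<in> carrier V" "w \<in> carrier W"
  shows "act (H.ten V W) h (pure K V W v w) = pure K V W (act V h v) (act W h w)"
  using assms H.act_pure by simp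

lemma H_pure_grade:
  fixes V W :: "('g, 'k, 'x) ydo"
  assumes "H.yd V" "H.yd W" "g \<in> H" "h \<in> H" "v \<in> grade V g" "w \<in> grade W h"
  shows "pure K V W v w \<in> grade (H.ten V W) (g \<otimes> h)"
  using assms H.pure_grade[of V W g h v w] by simp

lemma H_grade_act:
  assumes "H.yd V" "g \<in> H" "h \<in> H" "v \<in> grade V h"
  shows "act V g v \<in> grade V (g \<otimes> h \<otimes> inv g)"
  using assms H.grade_act[of V g h v] by simp


section \<open>The monoidal structures of induction\<close>

text \<open>Two universal properties in turn: for each \<open>g\<close> a bilinear map on V and W,
  then compatibility in \<open>g\<close>. The latter holds because \<open>h\<close> acts diagonally
  on V \<otimes> W, while gh \<otimes> v and gh \<otimes> w each pass \<open>h\<close> on to their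
  own vector.\<close>

lemma delta_map:
  fixes V W :: "('g, 'k, 'x) ydo"
  assumes [simp]: "H.yd V" "H.yd W"
  defines "T \<equiv> ten (Ind V) (Ind W)"
    and "\<psi> \<equiv> \<lambda>g v w. pure K (Ind V) (Ind W) (ipure V g v) (ipure W g w)"
  shows "g \<in> carrier G \<Longrightarrow> bilinear K V W T (\<psi> g)"
    and "induction_map K G H (H.ten V W) T (\<lambda>g. lift T (\<psi> g))"
proof -
  have [simp]: "module K T" by (simp add: T_def)
  show bil: "bilinear K V W T (\<psi> g)" if "g \<in> carrier G" for g
    unfolding T_def \<psi>_def using that by (intro bilinear_comp[OF bilinear_pure] linear_ind_pure) simp_all
  show "induction_map K G H (H.ten V W) T (\<lambda>g. lift T (\<psi> g))"
    unfolding induction_map_def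
  proof (intro conjI ballI)
    show lin: "lift T (\<psi> g) \<in> linear_maps K (H.ten V W) T" if "g \<in> carrier G" for g
      by (rule H.lift_linear[OF _ _ bil[OF that]]) simp_all
    fix g h x assume g: "g \<in> carrier G" and h: "h \<in> H" and x: "x \<in> carrier (H.ten V W)"
    show "lift T (\<psi> (g \<otimes> h)) x = lift T (\<psi> g) (act (H.ten V W) h x)"
    proof (rule linear_eq_on_carrier[OF _ _ lin _ H.generates_pure_carrier[of V W] _ x])
      show "(\<lambda>x. lift T (\<psi> g) (act (H.ten V W) h x)) \<in> linear_maps K (H.ten V W) T"
        using g h by (intro linear_comp[OF H_act_linear lin]) simp_all
      have "\<psi> (g \<otimes> h) v w = \<psi> g (act V h v) (act W h w)" if "v \<in> carrier V" "w \<in> carrier W" for v w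
        using g h that by (simp add: \<psi>_def ind_pure_mult)
      then show "lift T (\<psi> (g \<otimes> h)) a = lift T (\<psi> g) (act (H.ten V W) h a)"
        if "a \<in> pures V W (carrier V) (carrier W)" for a
        using g h that by (auto simp: H.lift_pure[OF _ _ bil])
    qed (use g h in simp_all)
  qed
qed

context
  fixes V W :: "('g, 'k, 'x) ydo"
  assumes V [simp]: "H.yd V" and W [simp]: "H.yd W"
begin

lemma fn_delta [simp]:
  assumes "g \<in> carrier G" "v \<in> carrier V" "w \<in> carrier W"
  shows "fn (ind_delta K G H V W) (ipure (H.ten V W) g (pure K V W v w))
    = pure K (Ind V) (Ind W) (ipure V g v) (ipure W g w)"
  using assms
  by (simp add: ind_delta_def Let_def ind_lift_pure[OF _ _ delta_map(2)] H.lift_pure[OF _ _ delta_map(1)])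

lemma arr_delta [simp]: "arr (ind_delta K G H V W)"
  unfolding ind_delta_def Let_def
proof (rule arr_arrow_of)
  let ?IV = "Ind V" and ?IW = "Ind W"
  let ?T = "ten ?IV ?IW"
  let ?\<phi> = "\<lambda>g. lift ?T (\<lambda>v w. pure K ?IV ?IW (ipure V g v) (ipure W g w))"
  note [simp] = H.lift_pure[OF _ _ delta_map(1)]
  show "ind_lift G ?T ?\<phi> \<in> yd_maps K G (Ind (H.ten V W)) ?T"
  proof (rule ind_lift_yd_maps[OF _ _ delta_map(2)[OF V W] H.generates_pure_homogeneous])
    fix k g x assume "k \<in> carrier G" "g \<in> carrier G"
      "x \<in> pures V W (homogeneous GH V) (homogeneous GH W)"
    then show "?\<phi> (k \<otimes> g) x = act ?T k (?\<phi> g x)"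
      by (auto simp: act_pure act_ind_pure H.homogeneous_closed)
  next
    fix g x assume g: "g \<in> carrier G"
      and "x \<in> pures V W (homogeneous GH V) (homogeneous GH W)"
    then obtain v w a b where x: "x = pure K V W v w" and ab: "a \<in> H" "b \<in> H" "v \<in> grade V a" "w \<in> grade W b"
      by (auto simp: homogeneous_def)
    have "pure K ?IV ?IW (ipure V g v) (ipure W g w) \<in> grade ?T ((g \<otimes> a \<otimes> inv g) \<otimes> (g \<otimes> b \<otimes> inv g))"
      using g ab by (intro pure_grade ind_pure_grade) simp_all
    \<comment> \<open>Conjugation by \<open>g\<close> is multiplicative, so the two degrees multiply
      to the degree of g \<otimes> (v \<otimes> w).\<close>
    moreover have "(g \<otimes> a \<otimes> inv g) \<otimes> (g \<otimes> b \<otimes> inv g) = g \<otimes> (a \<otimes> b) \<otimes> inv g"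
      using g ab by (simp add: m_assoc inv_solve_left')
    ultimately show "\<exists>h \<in> H. x \<in> grade (H.ten V W) h \<and> ?\<phi> g x \<in> grade ?T (g \<otimes> h \<otimes> inv g)"
      using g ab by (intro bexI[of _ "a \<otimes> b"]) (simp_all add: x H_pure_grade H_grade_closed)
  qed simp_all
qed simp_all

private abbreviation "TVW \<equiv> H.ten V W"
private abbreviation "JV \<equiv> Ind V"
private abbreviation "JW \<equiv> Ind W"
private abbreviation "JVW \<equiv> Ind TVW"
text \<open>The value of the multiplication on (g \<otimes> v) \<otimes> (k \<otimes> w). It is
  extended first in \<open>k\<close> and \<open>w\<close> with \<open>g\<close> and \<open>v\<close>
  fixed, then in \<open>g\<close> and \<open>v\<close>.\<close>

private abbreviation "\<theta> \<equiv> \<lambda>g v k w. if inv g \<otimes> k \<in> H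
  then ipure TVW g (pure K V W v (act W (inv g \<otimes> k) w)) else \<zero>\<^bsub>JVW\<^esub>"

private lemma \<theta>_inner: "induction_map K G H W JVW (\<theta> g v)" if g: "g \<in> carrier G" and v: "v \<in> carrier V"
  unfolding induction_map_def
proof (intro conjI ballI)
  fix k assume k: "k \<in> carrier G"
  have "(\<lambda>w. ipure TVW g (pure K V W v (act W (inv g \<otimes> k) w))) \<in> linear_maps K W JVW" if "inv g \<otimes> k \<in> H"
    using that g v k by (intro linear_comp[OF linear_comp[OF H_act_linear H.linear_pure_right] linear_ind_pure]) simp_all
  then show "\<theta> g v k \<in> linear_maps K W JVW"
    by (cases "inv g \<otimes> k \<in> H") (simp_all add: linear_const_zero)
  fix h w assume h: "h \<in> H" and w: "w \<in> carrier W"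
  have "inv g \<otimes> (k \<otimes> h) = (inv g \<otimes> k) \<otimes> h" using g k h by (simp add: m_assoc)
  then show "\<theta> g v (k \<otimes> h) w = \<theta> g v k (act W h w)"
    using g k h w by (simp add: H_mult_iff H_act_mult)
qed

text \<open>The element acting on \<open>w\<close> acquires \<open>inv h\<close>, while gh in front
  releases \<open>h\<close> onto both tensor factors. On the second factor the two cancel.\<close>

private lemma \<theta>_mult:
  assumes "g \<in> carrier G" "h \<in> H" "v \<in> carrier V" "k \<in> carrier G" "w \<in> carrier W"
  shows "\<theta> (g \<otimes> h) v k w = \<theta> g (act V h v) k w"
proof -
  have eq: "inv (g \<otimes> h) \<otimes> k = inv h \<otimes> (inv g \<otimes> k)"
    using assms by (simp add: inv_mult_group m_assoc)
  have "act W h (act W (inv h \<otimes> (inv g \<otimes> k)) w) = act W (inv g \<otimes> k) w" if "inv g \<otimes> k \<in> H"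
  proof -
    have "h \<otimes> (inv h \<otimes> (inv g \<otimes> k)) = inv g \<otimes> k" using assms by (simp add: m_assoc[symmetric])
    then show ?thesis using that assms H_act_mult[of W h "inv h \<otimes> (inv g \<otimes> k)" w] by simp
  qed
  then show ?thesis using assms by (simp add: eq H_mult_iff ind_pure_mult)
qed

text \<open>The inner lift at an arbitrary \<open>y\<close> has no closed form, so linearity in
  \<open>v\<close> and compatibility in \<open>g\<close> are both tested on y = k \<otimes>
  w.\<close>

private lemma \<theta>_outer:
  assumes y: "y \<in> carrier JW"
  shows "induction_map K G H V JVW (\<lambda>g v. ind_lift G JVW (\<theta> g v) y)"
  unfolding induction_map_def
proof (intro conjI ballI)
  note gen = generates_ind_pure[OF H.yd_rep[OF W] abelian_group.generates_carrier]
  have lin: "ind_lift G JVW (\<theta> g v) \<in> linear_maps K JW JVW" if "g \<in> carrier G" "v \<in> carrier V" for g v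
    by (rule ind_lift_linear[OF _ _ \<theta>_inner[OF that]]) simp_all
  have pure: "ind_lift G JVW (\<theta> g v) (ipure W k w) = \<theta> g v k w"
    if "g \<in> carrier G" "v \<in> carrier V" "k \<in> carrier G" "w \<in> carrier W" for g v k w
    by (rule ind_lift_pure[OF _ _ \<theta>_inner]) (use that in simp_all)
  fix g assume g: "g \<in> carrier G"
  show "(\<lambda>v. ind_lift G JVW (\<theta> g v) y) \<in> linear_maps K V JVW"
  proof (rule linear_param[OF _ _ _ gen lin[OF g] _ y])
    fix a assume "a \<in> ipures W (carrier W)"
    then obtain k w where a: "a = ipure W k w" "k \<in> carrier G" "w \<in> carrier W" by blast
    have "(\<lambda>v. ipure TVW g (pure K V W v (act W (inv g \<otimes> k) w))) \<in> linear_maps K V JVW" if "inv g \<otimes> k \<in> H"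
      using that g a by (intro linear_comp[OF H.linear_pure_left linear_ind_pure]) simp_all
    then have "(\<lambda>v. \<theta> g v k w) \<in> linear_maps K V JVW"
      by (cases "inv g \<otimes> k \<in> H") (simp_all add: linear_const_zero)
    then show "(\<lambda>v. ind_lift G JVW (\<theta> g v) a) \<in> linear_maps K V JVW"
      by (rule linear_cong[rotated]) (use g a in \<open>simp_all only: pure H.yd_rep H.rep_module V\<close>)
  qed simp_all
  fix h v assume h: "h \<in> H" and v: "v \<in> carrier V"
  show "ind_lift G JVW (\<theta> (g \<otimes> h) v) y = ind_lift G JVW (\<theta> g (act V h v)) y"
  proof (rule linear_eq_on_carrier[OF _ _ lin lin gen _ y])
    fix a assume "a \<in> ipures W (carrier W)"
    then obtain k w where a: "a = ipure W k w" "k \<in> carrier G" "w \<in> carrier W" by blast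
    have "g \<otimes> h \<in> carrier G" "act V h v \<in> carrier V" using g h v by simp_all
    then show "ind_lift G JVW (\<theta> (g \<otimes> h) v) a = ind_lift G JVW (\<theta> g (act V h v)) a"
      unfolding a(1) using pure[of "g \<otimes> h" v k w] pure[of g "act V h v" k w] \<theta>_mult[OF g h v a(2,3)] g v a(2,3)
      by argo
  qed (use g h v in simp_all)
qed

private abbreviation "\<mu> \<equiv> \<lambda>x y. ind_lift G JVW (\<lambda>g v. ind_lift G JVW (\<theta> g v) y) x"

private lemma \<mu>_pure:
  assumes "g \<in> carrier G" "v \<in> carrier V" "k \<in> carrier G" "w \<in> carrier W"
  shows "\<mu> (ipure V g v) (ipure W k w) = \<theta> g v k w"
  using assms ind_lift_pure[OF _ _ \<theta>_outer[of "ipure W k w"], of g v]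
    ind_lift_pure[OF _ _ \<theta>_inner[of g v], of k w] by simp

text \<open>Linearity in the first argument is built in. In the second it is tested on x = g
  \<otimes> v, where the outer lift disappears and the inner one is left.\<close>

private lemma \<mu>_bilinear: "bilinear K JV JW JVW \<mu>"
  unfolding bilinear_def
proof (intro conjI ballI)
  have left: "(\<lambda>x. \<mu> x y) \<in> linear_maps K JV JVW" if "y \<in> carrier JW" for y
    using ind_lift_linear[OF _ _ \<theta>_outer[OF that]] by simp
  then show "(\<lambda>x. \<mu> x y) \<in> linear_maps K JV JVW" if "y \<in> carrier JW" for y using that .
  fix x assume x: "x \<in> carrier JV"
  show "\<mu> x \<in> linear_maps K JW JVW"
  proof (rule linear_param[OF _ _ _ generates_ind_pure[OF H.yd_rep[OF V] abelian_group.generates_carrier] left _ x])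
    fix a assume "a \<in> ipures V (carrier V)"
    then obtain g v where a: "a = ipure V g v" "g \<in> carrier G" "v \<in> carrier V" by blast
    show "\<mu> a \<in> linear_maps K JW JVW"
      by (rule linear_cong[OF _ ind_lift_linear[OF _ _ \<theta>_inner[OF a(2,3)]]])
        (use a ind_lift_pure[OF _ _ \<theta>_outer] in simp_all)
  qed simp_all
qed

lemma fn_mu [simp]:
  assumes "g \<in> carrier G" "v \<in> carrier V" "k \<in> carrier G" "w \<in> carrier W"
  shows "fn (ind_mu K G H V W) (pure K (Ind V) (Ind W) (ipure V g v) (ipure W k w))
    = (if inv g \<otimes> k \<in> H then ipure (H.ten V W) g (pure K V W v (act W (inv g \<otimes> k) w))
       else \<zero>\<^bsub>Ind (H.ten V W)\<^esub>)"
  using assms lift_pure[OF _ _ \<mu>_bilinear, of "ipure V g v" "ipure W k w"] \<mu>_pure[OF assms]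
  by (simp add: ind_mu_def Let_def)

lemma arr_mu [simp]: "arr (ind_mu K G H V W)"
  unfolding ind_mu_def Let_def
proof (rule arr_arrow_of)
  show "lift JVW \<mu> \<in> yd_maps K G (ten JV JW) JVW"
  proof (rule yd_mapsI[OF _ _ lift_linear[OF _ _ \<mu>_bilinear] generates_pure[OF _ _
        generates_ind_pure[OF H.yd_rep[OF V] H.generates_homogeneous[OF V]]
        generates_ind_pure[OF H.yd_rep[OF W] H.generates_homogeneous[OF W]]]])
    fix a assume "a \<in> pures JV JW (ipures V (homogeneous GH V)) (ipures W (homogeneous GH W))"
    then obtain g v k w s t where a: "a = pure K JV JW (ipure V g v) (ipure W k w)"
      and g: "g \<in> carrier G" and k: "k \<in> carrier G" and s: "s \<in> H" "v \<in> grade V s" and t: "t \<in> H" "w \<in> grade W t"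
      by (auto simp: homogeneous_def)
    then have v: "v \<in> carrier V" and w: "w \<in> carrier W" by (simp_all add: H_grade_closed)
    have lift: "lift JVW \<mu> (pure K JV JW (ipure V g v) (ipure W k w)) = \<theta> g v k w"
      if "g \<in> carrier G" "k \<in> carrier G" for g k
      using that v w lift_pure[OF _ _ \<mu>_bilinear, of "ipure V g v" "ipure W k w"]
        \<mu>_pure[of g v k w] by simp
    show "lift JVW \<mu> (act (ten JV JW) l a) = act JVW l (lift JVW \<mu> a)" if l: "l \<in> carrier G" for l
    proof -
      \<comment> \<open>Apart from the leading \<open>g\<close>, multiplication depends on the two
        group elements only through \<open>inv g \<otimes> k\<close>, which a common left
        translation leaves unchanged.\<close>
      have "inv (l \<otimes> g) \<otimes> (l \<otimes> k) = inv g \<otimes> k"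
        using l g k by (simp add: inv_mult_group m_assoc inv_solve_left')
      moreover have "act JVW l \<zero>\<^bsub>JVW\<^esub> = \<zero>\<^bsub>JVW\<^esub>"
        using l by (intro linear_zero[OF _ _ rep_act_linear]) simp_all
      ultimately show ?thesis using l g k v w by (simp add: a act_pure act_ind_pure lift)
    qed
    let ?d = "(g \<otimes> s \<otimes> inv g) \<otimes> (k \<otimes> t \<otimes> inv k)"
    have d: "?d \<in> carrier G" using g k s t by simp
    moreover have "a \<in> grade (ten JV JW) ?d"
      unfolding a using g k s t by (intro pure_grade ind_pure_grade) simp_all
    moreover have "\<theta> g v k w \<in> grade JVW ?d"
    proof (cases "inv g \<otimes> k \<in> H")
      case True
      let ?h = "inv g \<otimes> k"
      have "ipure TVW g (pure K V W v (act W ?h w)) \<in> grade JVW (g \<otimes> (s \<otimes> (?h \<otimes> t \<otimes> inv ?h)) \<otimes> inv g)"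
        using True g s t by (intro ind_pure_grade H_pure_grade H_grade_act) simp_all
      \<comment> \<open>Conjugating by \<open>inv g \<otimes> k\<close> and then by \<open>g\<close>
        is conjugating by \<open>k\<close>.\<close>
      also have "g \<otimes> (s \<otimes> (?h \<otimes> t \<otimes> inv ?h)) \<otimes> inv g = ?d"
        using g k s t by (simp add: inv_mult_group m_assoc)
      finally show ?thesis using True by simp
    next
      \<comment> \<open>Zero belongs to every homogeneous component, so this branch respects degrees
        as well.\<close>
      case False
      then show ?thesis using d by (simp add: grade_zero)
    qed
    ultimately show "\<exists>d\<in>carrier G. a \<in> grade (ten JV JW) d \<and> lift JVW \<mu> a \<in> grade JVW d"
      using lift[OF g k] by (intro bexI[of _ ?d]) (simp_all add: a)
  qed simp_all
qed simp_all

end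

section \<open>The counit map\<close>

lemma eps_map: "induction_map K G H (Unit :: ('g, 'k, 'x) ydo) (Unit) (\<lambda>g c. c)"
  by (simp add: induction_map_def linear_id)

lemma H_yd_unit [simp]: "H.yd (Unit :: ('g, 'k, 'x) ydo)"
  using H.yd_unit by simp

lemma fn_eps [simp]:
  "\<lbrakk>g \<in> carrier G; c \<in> carrier (Unit)\<rbrakk> \<Longrightarrow> fn (ind_eps K G H) (ipure (Unit) g c) = c"
  by (simp add: ind_eps_def ind_lift_pure[OF _ _ eps_map])

lemma arr_eps [simp]: "arr (ind_eps K G H)"
  unfolding ind_eps_def unit_GH
proof (rule arr_arrow_of)
  let ?I = "Unit :: ('g, 'k, 'x) ydo"
  show "ind_lift G ?I (\<lambda>g c. c) \<in> yd_maps K G (Ind ?I) ?I"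
  proof (rule ind_lift_yd_maps[OF _ _ eps_map abelian_group.generates_carrier])
    fix g c assume "g \<in> carrier G" "c \<in> carrier ?I"
    then show "\<exists>h\<in>H. c \<in> grade ?I h \<and> c \<in> grade ?I (g \<otimes> h \<otimes> inv g)"
      by (intro bexI[of _ \<one>]) (simp_all add: unit_grade)
  qed simp_all
qed simp_all

end

context yd_modules
begin

text \<open>Carries the zero branch of the multiplication through the arrows that follow it.\<close>

lemma fn_zero [simp]: "\<lbrakk>arr f; src f = V\<rbrakk> \<Longrightarrow> fn f \<zero>\<^bsub>V\<^esub> = \<zero>\<^bsub>tgt f\<^esub>"
  using linear_zero[OF _ _ arr_linear[of f]] by auto

end

context subgroup_modules
begin

section \<open>Left cosets and the unit map\<close>

abbreviation coset_rep :: "'g set \<Rightarrow> 'g" where "coset_rep X \<equiv> SOME g. g \<in> X"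

lemma mem_lcoset_iff: "\<lbrakk>g \<in> carrier G; k \<in> carrier G\<rbrakk> \<Longrightarrow> k \<in> g <# H \<longleftrightarrow> inv g \<otimes> k \<in> H"
  by (force simp: l_coset_def m_assoc[symmetric] intro: inv_solve_left')

lemma lcoset_eq_iff: "\<lbrakk>g \<in> carrier G; k \<in> carrier G\<rbrakk> \<Longrightarrow> g <# H = k <# H \<longleftrightarrow> inv g \<otimes> k \<in> H"
proof -
  assume g: "g \<in> carrier G" and k: "k \<in> carrier G"
  have "k \<in> k <# H" using k by (simp add: mem_lcoset_iff)
  then show ?thesis
    using mem_lcoset_iff[OF g k] l_repr_independence[OF _ g subgroup_H] by auto
qed

lemma coset_rep:
  assumes "X \<in> lcosets H"
  shows "coset_rep X \<in> carrier G" and "coset_rep X <# H = X"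
proof -
  from assms obtain g where g: "g \<in> carrier G" "X = g <# H" by (auto simp: LCOSETS_def)
  then have "g \<in> X" by (simp add: mem_lcoset_iff)
  then have *: "coset_rep X \<in> g <# H" unfolding g(2) by (rule someI)
  then show "coset_rep X \<in> carrier G" using g(1) by (auto simp: l_coset_def)
  then show "coset_rep X <# H = X" using * g by (simp add: mem_lcoset_iff lcoset_eq_iff[symmetric])
qed

lemma lcoset_in_lcosets: "g \<in> carrier G \<Longrightarrow> g <# H \<in> lcosets H"
  by (auto simp: LCOSETS_def)

text \<open>The membership test in the multiplication singles out one coset, that of
  \<open>k\<close>. This collapses the sum defining the unit map in the unit laws.\<close>

lemma coset_rep_iff:
  "\<lbrakk>X \<in> lcosets H; k \<in> carrier G\<rbrakk> \<Longrightarrow> inv (coset_rep X) \<otimes> k \<in> H \<longleftrightarrow> X = k <# H"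
  using lcoset_eq_iff[OF coset_rep(1), of X k] coset_rep(2) by simp

lemma finite_lcosets: "finite (lcosets H)"
  using finite_G by (simp add: LCOSETS_def)

lemma ind_pure_act:
  fixes V :: "('g, 'k, 'x) ydo"
  assumes "H.rp V" "g \<in> carrier G" "k \<in> carrier G" "v \<in> carrier V" "inv g \<otimes> k \<in> H"
  shows "ipure V g (act V (inv g \<otimes> k) v) = ipure V k v"
  using ind_pure_mult[OF assms(1,2,5,4)] assms(2,3) by (simp add: m_assoc[symmetric])

text \<open>\<open>H\<close> acts trivially on the unit object, so g \<otimes> c depends on the left
  coset of \<open>g\<close> alone, and the unit map does not depend on the representatives picked by
  \<open>SOME\<close>.\<close>

lemma ind_unit_coset:
  assumes "g \<in> carrier G" "k \<in> carrier G" "inv g \<otimes> k \<in> H" "c \<in> carrier (Unit)"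
  shows "ipure (Unit) k c = ipure (Unit) g c"
  using ind_pure_act[of "Unit" g k c] assms by simp

lemma fn_eta:
  assumes "c \<in> carrier (Unit)"
  shows "fn (ind_eta K G H) c = (\<Oplus>\<^bsub>Ind (Unit)\<^esub>X\<in>lcosets H. ipure (Unit) (coset_rep X) c)"
  using assms by (simp add: ind_eta_def Let_def)

lemma arr_eta [simp]: "arr (ind_eta K G H :: ('g, 'k, 'x) yda)"
proof -
  let ?I = "Unit :: ('g, 'k, 'x) ydo"
  let ?T = "Ind ?I"
  let ?f = "\<lambda>c. \<Oplus>\<^bsub>?T\<^esub>X\<in>lcosets H. ipure ?I (coset_rep X) c"
  interpret T: module K ?T by simp
  have lin: "?f \<in> linear_maps K ?I ?T"
    by (rule linear_finsum_fun) (simp_all add: linear_ind_pure coset_rep)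
  have "?f \<in> yd_maps K G ?I ?T"
  proof (rule yd_mapsI[OF _ _ lin abelian_group.generates_carrier])
    fix c assume c: "c \<in> carrier ?I"
    \<comment> \<open>Every summand has degree one, a conjugate of the neutral degree of
      \<open>c\<close>.\<close>
    have "?f c \<in> grade ?T \<one>"
    proof (rule T.M.finsum_mem)
      fix X assume X: "X \<in> lcosets H"
      show "ipure ?I (coset_rep X) c \<in> grade ?T \<one>"
        using ind_pure_grade[of ?I "coset_rep X" \<one> c] coset_rep(1)[OF X] c by (simp add: unit_grade)
    qed (simp_all add: grade_zero grade_add grade_subset)
    then show "\<exists>g\<in>carrier G. c \<in> grade ?I g \<and> ?f c \<in> grade ?T g"
      using c by (intro bexI[of _ \<one>]) (simp_all add: unit_grade)
    fix g assume g: "g \<in> carrier G"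
    \<comment> \<open>Left translation of cosets, expressed through representatives. It permutes the
      finitely many cosets, and reindexing along it gives equivariance.\<close>
    let ?h = "\<lambda>X. (g \<otimes> coset_rep X) <# H"
    have h: "?h X \<in> lcosets H" if "X \<in> lcosets H" for X
      using g coset_rep(1)[OF that] by (simp add: lcoset_in_lcosets)
    have inj: "inj_on ?h (lcosets H)"
    proof (rule inj_onI)
      fix X Y assume X: "X \<in> lcosets H" and Y: "Y \<in> lcosets H" and eq: "?h X = ?h Y"
      note XY = coset_rep(1)[OF X] coset_rep(1)[OF Y]
      have "inv (g \<otimes> coset_rep X) \<otimes> (g \<otimes> coset_rep Y) = inv (coset_rep X) \<otimes> coset_rep Y"
        using g XY by (simp add: inv_mult_group m_assoc inv_solve_left')
      then show "X = Y" using eq g XY lcoset_eq_iff[of "g \<otimes> coset_rep X" "g \<otimes> coset_rep Y"]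
        coset_rep_iff[OF X XY(2)] coset_rep(2)[OF Y] by simp
    qed
    have im: "?h ` (lcosets H) = lcosets H"
      by (rule endo_inj_surj[OF finite_lcosets _ inj]) (use h in blast)
    have closed: "ipure ?I (coset_rep X) c \<in> carrier ?T" if "X \<in> lcosets H" for X
      using c coset_rep(1)[OF that] by simp
    have "act ?T g (?f c) = (\<Oplus>\<^bsub>?T\<^esub>X\<in>lcosets H. act ?T g (ipure ?I (coset_rep X) c))"
      using g closed by (intro linear_finsum[OF _ _ rep_act_linear]) simp_all
    also have "\<dots> = (\<Oplus>\<^bsub>?T\<^esub>X\<in>lcosets H. ipure ?I (coset_rep (?h X)) c)"
    proof (rule T.M.finsum_cong'[OF HOL.refl])
      fix X assume X: "X \<in> lcosets H"
      have gX: "g \<otimes> coset_rep X \<in> carrier G" using g coset_rep(1)[OF X] by simp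
      \<comment> \<open>The translated representative and the chosen representative of the
        translated coset lie in one coset, hence give the same vector.\<close>
      have "inv (coset_rep (?h X)) \<otimes> (g \<otimes> coset_rep X) \<in> H"
        using coset_rep_iff[OF h[OF X] gX] by simp
      then show "act ?T g (ipure ?I (coset_rep X) c) = ipure ?I (coset_rep (?h X)) c"
        using g c coset_rep(1)[OF X] coset_rep(1)[OF h[OF X]] gX ind_unit_coset[OF _ gX]
        by (simp add: act_ind_pure)
    qed (use h closed in auto)
    also have "\<dots> = (\<Oplus>\<^bsub>?T\<^esub>X\<in>?h ` (lcosets H). ipure ?I (coset_rep X) c)"
      by (rule T.M.finsum_reindex[symmetric, OF _ inj]) (use im closed in auto)
    finally show "?f (act ?I g c) = act ?T g (?f c)" by (simp add: im)
  qed simp_all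
  then show ?thesis by (simp add: ind_eta_def Let_def arr_arrow_of)
qed

text \<open>Only the coset of \<open>k\<close> contributes. If x represents it, the result is x
  \<otimes> (c \<otimes> hv) with h = x^-1 k; as \<open>H\<close> acts trivially on c, this is x
  \<otimes> h(c \<otimes> v) = k \<otimes> (c \<otimes> v).\<close>

lemma mu_eta_left:
  fixes V :: "('g, 'k, 'x) ydo"
  assumes V [simp]: "H.yd V" and c: "c \<in> carrier (Unit)" and k: "k \<in> carrier G" and v: "v \<in> carrier V"
  shows "fn (ind_mu K G H (Unit) V)
      (pure K (Ind (Unit)) (Ind V) (fn (ind_eta K G H) c) (ipure V k v))
    = ipure (H.ten (Unit) V) k (pure K (Unit) V c v)"
proof -
  let ?I = "Unit :: ('g, 'k, 'x) ydo"
  let ?T = "H.ten ?I V"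
  let ?F = "\<lambda>x. fn (ind_mu K G H ?I V) (pure K (Ind ?I) (Ind V) x (ipure V k v))"
  interpret T: module K "Ind ?T" by simp
  have lin: "?F \<in> linear_maps K (Ind ?I) (Ind ?T)"
    using linear_comp[OF linear_pure_left arr_linear[OF arr_mu, of ?I V, simplified]] k v by simp
  have val: "?F (ipure ?I (coset_rep X) c)
    = (if X = k <# H then ipure ?T k (pure K ?I V c v) else \<zero>\<^bsub>Ind ?T\<^esub>)" if X: "X \<in> lcosets H" for X
  proof (cases "X = k <# H")
    case True
    then have "inv (coset_rep X) \<otimes> k \<in> H" using coset_rep_iff[OF X k] by simp
    then show ?thesis
      using True c k v coset_rep(1)[OF X] ind_pure_act[of ?T "coset_rep X" k "pure K ?I V c v"] by simp
  qed (use c k v coset_rep(1)[OF X] coset_rep_iff[OF X k] in simp)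
  have "?F (fn (ind_eta K G H) c) = (\<Oplus>\<^bsub>Ind ?T\<^esub>X\<in>lcosets H. ?F (ipure ?I (coset_rep X) c))"
    unfolding fn_eta[OF c] by (rule linear_finsum[OF _ _ lin]) (use c coset_rep in simp_all)
  also have "\<dots> = ?F (ipure ?I (coset_rep (k <# H)) c)"
    by (rule T.M.finsum_single[OF finite_lcosets lcoset_in_lcosets[OF k]])
      (use c k v in \<open>simp_all add: val lcoset_in_lcosets\<close>)
  finally show ?thesis by (simp add: val lcoset_in_lcosets k)
qed

text \<open>Here \<open>k\<close> heads the surviving summand itself, so the trivial action on the
  unit object finishes the computation. The coset test occurs with \<open>k\<close> inverted, which
  \<open>sym\<close> accounts for.\<close>

lemma mu_eta_right:
  fixes V :: "('g, 'k, 'x) ydo"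
  assumes V [simp]: "H.yd V" and c: "c \<in> carrier (Unit)" and k: "k \<in> carrier G" and v: "v \<in> carrier V"
  shows "fn (ind_mu K G H V (Unit))
      (pure K (Ind V) (Ind (Unit)) (ipure V k v) (fn (ind_eta K G H) c))
    = ipure (H.ten V (Unit)) k (pure K V (Unit) v c)"
proof -
  let ?I = "Unit :: ('g, 'k, 'x) ydo"
  let ?T = "H.ten V ?I"
  let ?F = "\<lambda>x. fn (ind_mu K G H V ?I) (pure K (Ind V) (Ind ?I) (ipure V k v) x)"
  interpret T: module K "Ind ?T" by simp
  have lin: "?F \<in> linear_maps K (Ind ?I) (Ind ?T)"
    using linear_comp[OF linear_pure_right arr_linear[OF arr_mu, of V ?I, simplified]] k v by simp
  have sym: "inv k \<otimes> coset_rep X \<in> H \<longleftrightarrow> X = k <# H" if X: "X \<in> lcosets H" for X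
    using lcoset_eq_iff[OF k coset_rep(1)[OF X]] coset_rep(2)[OF X] by auto
  have val: "?F (ipure ?I (coset_rep X) c)
    = (if X = k <# H then ipure ?T k (pure K V ?I v c) else \<zero>\<^bsub>Ind ?T\<^esub>)" if X: "X \<in> lcosets H" for X
    using c k v coset_rep(1)[OF X] sym[OF X] by simp
  have "?F (fn (ind_eta K G H) c) = (\<Oplus>\<^bsub>Ind ?T\<^esub>X\<in>lcosets H. ?F (ipure ?I (coset_rep X) c))"
    unfolding fn_eta[OF c] by (rule linear_finsum[OF _ _ lin]) (use c coset_rep in simp_all)
  also have "\<dots> = ?F (ipure ?I (coset_rep (k <# H)) c)"
    by (rule T.M.finsum_single[OF finite_lcosets lcoset_in_lcosets[OF k]])
      (use c k v in \<open>simp_all add: val lcoset_in_lcosets\<close>)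
  finally show ?thesis by (simp add: val lcoset_in_lcosets k)
qed

lemmas H_fn_lunit [simp] = H.fn_lunit[simplified]
lemmas H_fn_runit [simp] = H.fn_runit[simplified]

section \<open>Generators for testing the axioms\<close>

lemma generates_ind_carrier:
  fixes V :: "('g, 'k, 'x) ydo"
  assumes "H.yd V"
  shows "generates (Ind V) (ipures V (carrier V))"
  using assms by (intro generates_ind_pure abelian_group.generates_carrier) simp_all

lemma generates_ind_tensor:
  fixes V W :: "('g, 'k, 'x) ydo"
  assumes "H.yd V" "H.yd W"
  shows "generates (Ind (H.ten V W))
    (ipures (H.ten V W) (pures V W (carrier V) (carrier W)))"
  using assms by (intro generates_ind_pure H.generates_pure_carrier) simp_all

lemma generates_tensor_ind:
  fixes V W :: "('g, 'k, 'x) ydo"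
  assumes "H.yd V" "H.yd W"
  shows "generates (ten (Ind V) (Ind W)) (pures (Ind V) (Ind W) (ipures V (carrier V)) (ipures W (carrier W)))"
  using assms by (intro generates_pure generates_ind_carrier) simp_all

text \<open>For associativity of the multiplication: the two bracketings test different pairs among
  three group elements, and their actions match through this factorisation.\<close>

lemma H_coset_trans:
  assumes "g \<in> carrier G" "k \<in> carrier G" "l \<in> carrier G" "inv g \<otimes> k \<in> H"
  shows "inv g \<otimes> l \<in> H \<longleftrightarrow> inv k \<otimes> l \<in> H" and "inv g \<otimes> l = (inv g \<otimes> k) \<otimes> (inv k \<otimes> l)"
proof -
  show "inv g \<otimes> l = (inv g \<otimes> k) \<otimes> (inv k \<otimes> l)"
    using assms by (simp add: m_assoc) (simp add: m_assoc[symmetric])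
  then show "inv g \<otimes> l \<in> H \<longleftrightarrow> inv k \<otimes> l \<in> H"
    using assms by (simp add: H_mult_iff)
qed


section \<open>Induction is a separable Frobenius functor\<close>

lemma ind_functor: "category_functor (YD K GH :: ('g, 'k, 'x) yd_category) (YD K G) (Ind) (ind_arrow K G H)"
proof (intro category_functor.intro category_functor_axioms.intro YD_category H.YD_category, goal_cases)
  case (3 X)
  then have [simp]: "H.yd X" by simp
  show ?case using generates_ind_carrier[of X] by (auto intro!: arr_eqI)
next
  case (4 f X Y g Z)
  then have [simp]: "H.yd X" "H.yd Y" using H.arr_src[of f] H.arr_tgt[of f] by auto
  from 4 show ?case using generates_ind_carrier[of X] by (auto intro!: arr_eqI)
qed simp_all

text \<open>Both composites vanish unless g, k and l lie in one left coset. Otherwise both give g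
  \<otimes> (x \<otimes> (g^-1 k y \<otimes> g^-1 l z)); on the right the last action arises in two
  steps, by k^-1 l and then g^-1 k.\<close>

lemma ind_mu_assoc:
  fixes X Y Z :: "('g, 'k, 'x) ydo"
  assumes [simp]: "H.yd X" "H.yd Y" "H.yd Z"
  shows "ind_arrow K G H (assoc_yd K GH X Y Z) \<cdot>\<^bsub>YD K G\<^esub> ind_mu K G H (H.ten X Y) Z
      \<cdot>\<^bsub>YD K G\<^esub> tensor_arrow K G (ind_mu K G H X Y) (arrow_of (Ind Z) (Ind Z) (\<lambda>v. v))
    = ind_mu K G H X (H.ten Y Z)
      \<cdot>\<^bsub>YD K G\<^esub> tensor_arrow K G (arrow_of (Ind X) (Ind X) (\<lambda>v. v)) (ind_mu K G H Y Z)
      \<cdot>\<^bsub>YD K G\<^esub> assoc_yd K G (Ind X) (Ind Y) (Ind Z)" (is "?L = ?R")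
proof (rule arr_eqI)
  let ?IX = "Ind X" and ?IY = "Ind Y" and ?IZ = "Ind Z"
  show "generates (src ?R) (pures (ten ?IX ?IY) ?IZ (pures ?IX ?IY (ipures X (carrier X)) (ipures Y (carrier Y))) (ipures Z (carrier Z)))" (is "generates _ ?A")
    using generates_pure[OF _ _ generates_tensor_ind[of X Y] generates_ind_carrier[of Z]] by simp
  fix a assume "a \<in> ?A"
  then obtain g x k y l z where a: "a = pure K (ten ?IX ?IY) ?IZ
      (pure K ?IX ?IY (ipure X g x) (ipure Y k y)) (ipure Z l z)"
    and [simp]: "g \<in> carrier G" "k \<in> carrier G" "l \<in> carrier G" "x \<in> carrier X" "y \<in> carrier Y" "z \<in> carrier Z"
    by blast
  show "fn ?L a = fn ?R a"
  proof (cases "inv g \<otimes> k \<in> H")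
    case gk: True
    show ?thesis
    proof (cases "inv k \<otimes> l \<in> H")
      case True
      then have "act Z (inv g \<otimes> l) z = act Z (inv g \<otimes> k) (act Z (inv k \<otimes> l) z)"
        using gk H_coset_trans(2)[of g k l] by (simp add: H_act_mult)
      then show ?thesis using gk True H_coset_trans(1)[of g k l] by (simp add: a)
    next
      case False
      then show ?thesis using gk H_coset_trans(1)[of g k l] by (simp add: a)
    qed
  next
    \<comment> \<open>The left side vanishes at its first multiplication; the split on
      \<open>k\<close> and \<open>l\<close> evaluates the inner multiplication on the right.\<close>
    case False
    then show ?thesis by (cases "inv k \<otimes> l \<in> H") (simp_all add: a)
  qed
qed simp_all

lemma ind_lax:
  "lax_monoidal_functor (YD K GH :: ('g, 'k, 'x) yd_category) (YD K G)
    (Ind) (ind_arrow K G H) (ind_mu K G H) (ind_eta K G H)"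
proof (intro lax_monoidal_functor.intro lax_monoidal_functor_axioms.intro YD_monoidal H.YD_monoidal ind_functor, goal_cases)
  \<comment> \<open>Naturality of the multiplication: equivariance moves the arrow \<open>g\<close>
    past the action of an element of \<open>H\<close>.\<close>
  case (2 f X X' g Y Y')
  then have [simp]: "H.arr f" "H.arr g" "src f = X" "tgt f = X'" "src g = Y" "tgt g = Y'" by simp_all
  have [simp]: "H.yd X" "H.yd Y" "H.yd X'" "H.yd Y'"
    using H.arr_src[of f] H.arr_src[of g] H.arr_tgt[of f] H.arr_tgt[of g] by simp_all
  have act: "fn g (act Y h v) = act Y' h (fn g v)" if "h \<in> H" "v \<in> carrier Y" for h v
    using H.yd_maps_act[OF H.arr_yd_maps[of g]] that by simp
  show ?case using generates_tensor_ind[of X Y] by (auto intro!: arr_eqI simp: act)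
next
  case (4 X Y Z)
  then show ?case using ind_mu_assoc[of X Y Z] by simp
next
  \<comment> \<open>Left unit law: both sides send c \<otimes> (g \<otimes> v) to g \<otimes> cv.
    The next case is its mirror image.\<close>
  case (5 X)
  then have [simp]: "H.yd X" by simp
  have smult: "scalar c \<odot>\<^bsub>Ind X\<^esub> ipure X g v = ipure X g (scalar c \<odot>\<^bsub>X\<^esub> v)"
    if "c \<in> carrier (Unit)" "g \<in> carrier G" "v \<in> carrier X" for c :: "('g, 'k, 'x) vec" and g v
    using that by (simp add: smult_ind_pure)
  show ?case
    using generates_pure[OF _ _ abelian_group.generates_carrier[of "Unit"] generates_ind_carrier[of X]]
    by (auto intro!: arr_eqI simp: mu_eta_left smult)
next
  case (6 X)
  then have [simp]: "H.yd X" by simp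
  have smult: "scalar c \<odot>\<^bsub>Ind X\<^esub> ipure X g v = ipure X g (scalar c \<odot>\<^bsub>X\<^esub> v)"
    if "c \<in> carrier (Unit)" "g \<in> carrier G" "v \<in> carrier X" for c :: "('g, 'k, 'x) vec" and g v
    using that by (simp add: smult_ind_pure)
  show ?case
    using generates_pure[OF _ _ generates_ind_carrier[of X] abelian_group.generates_carrier[of "Unit"]]
    by (auto intro!: arr_eqI simp: mu_eta_right smult)
qed simp_all

lemma generates_ind_triple:
  fixes X Y Z :: "('g, 'k, 'x) ydo"
  assumes "H.yd X" "H.yd Y" "H.yd Z"
  shows "generates (Ind (H.ten (H.ten X Y) Z))
    {ipure (H.ten (H.ten X Y) Z) g a | g a. g \<in> carrier G \<and>
      a \<in> {pure K (H.ten X Y) Z (pure K X Y x y) z | x y z. x \<in> carrier X \<and> y \<in> carrier Y \<and> z \<in> carrier Z}}"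
  using assms by (intro generates_ind_pure H.generates_triple) simp_all

lemma ind_oplax:
  "oplax_monoidal_functor (YD K GH :: ('g, 'k, 'x) yd_category) (YD K G)
    (Ind) (ind_arrow K G H) (ind_delta K G H) (ind_eps K G H)"
proof (intro oplax_monoidal_functor.intro oplax_monoidal_functor_axioms.intro YD_monoidal H.YD_monoidal ind_functor, goal_cases)
  case (2 f X X' g Y Y')
  then have [simp]: "H.arr f" "H.arr g" "src f = X" "tgt f = X'" "src g = Y" "tgt g = Y'" by simp_all
  have [simp]: "H.yd X" "H.yd Y" "H.yd X'" "H.yd Y'"
    using H.arr_src[of f] H.arr_src[of g] H.arr_tgt[of f] H.arr_tgt[of g] by simp_all
  show ?case using generates_ind_tensor[of X Y] by (auto intro!: arr_eqI)
next
  \<comment> \<open>Coassociativity: g \<otimes> ((x \<otimes> y) \<otimes> z) goes to (g \<otimes>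
    x) \<otimes> ((g \<otimes> y) \<otimes> (g \<otimes> z)) either way, without any condition on
    cosets.\<close>
  case (4 X Y Z)
  then show ?case using generates_ind_triple[of X Y Z] by (auto intro!: arr_eqI)
next
  \<comment> \<open>Left counit law: the counit returns c from g \<otimes> c, and c (g \<otimes> v)
    = g \<otimes> cv is the value of the induced unitor. The right law is analogous.\<close>
  case (5 X)
  then show ?case
    using generates_ind_tensor[of "Unit" X] by (auto intro!: arr_eqI simp: smult_ind_pure)
next
  case (6 X)
  then show ?case
    using generates_ind_tensor[of X "Unit"] by (auto intro!: arr_eqI simp: smult_ind_pure)
qed simp_all

lemma ind_frobenius:
  "frobenius_monoidal_functor (YD K GH :: ('g, 'k, 'x) yd_category) (YD K G)
    (Ind) (ind_arrow K G H) (ind_mu K G H) (ind_eta K G H) (ind_delta K G H) (ind_eps K G H)"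
proof (intro frobenius_monoidal_functor.intro frobenius_monoidal_functor_axioms.intro ind_lax ind_oplax, goal_cases)
  case (1 V W U)
  then have [simp]: "H.yd V" "H.yd W" "H.yd U" by simp_all
  \<comment> \<open>The inverse associators are definite descriptions; they are evaluated here over
    both groups.\<close>
  have [simp]: "inv_arrow (YD K G) (assoc_yd K G (Ind V) (Ind W) (Ind U))
      = assoc_inv_yd K G (Ind V) (Ind W) (Ind U)"
    "inv_arrow (YD K GH) (assoc_yd K GH V W U) = assoc_inv_yd K GH V W U"
    by (rule inv_arrow_eq[OF inverse_assoc] H.inv_arrow_eq[OF H.inverse_assoc]; simp)+
  have "generates (ten (Ind V) (Ind (H.ten W U)))
     (pures (Ind V) (Ind (H.ten W U)) (ipures V (carrier V)) (ipures (H.ten W U) (pures W U (carrier W) (carrier U))))"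
    by (intro generates_pure generates_ind_carrier generates_ind_tensor) simp_all
  then show ?case by (auto intro!: arr_eqI simp: ind_pure_act)
next
  \<comment> \<open>Both sides of the second relation send (g \<otimes> (v \<otimes> w)) \<otimes>
    (k \<otimes> u) to (g \<otimes> v) \<otimes> (g \<otimes> (w \<otimes> hu)) if h = g^-1 k lies
    in \<open>H\<close>, and to zero otherwise.\<close>
  case (2 V W U)
  then have [simp]: "H.yd V" "H.yd W" "H.yd U" by simp_all
  have "generates (ten (Ind (H.ten V W)) (Ind U))
     (pures (Ind (H.ten V W)) (Ind U) (ipures (H.ten V W) (pures V W (carrier V) (carrier W))) (ipures U (carrier U)))"
    by (intro generates_pure generates_ind_carrier generates_ind_tensor) simp_all
  then show ?case by (auto intro!: arr_eqI simp: ind_pure_act)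
qed

text \<open>Comultiplication produces the same \<open>g\<close> in both factors, so the test in the
  multiplication concerns g^-1 g = 1: it succeeds, and the action that follows is trivial.\<close>

lemma ind_separable_frobenius:
  "separable_frobenius_monoidal_functor (YD K GH :: ('g, 'k, 'x) yd_category) (YD K G)
    (Ind) (ind_arrow K G H) (ind_mu K G H) (ind_eta K G H) (ind_delta K G H) (ind_eps K G H)"
proof (intro separable_frobenius_monoidal_functor.intro separable_frobenius_monoidal_functor_axioms.intro ind_frobenius, goal_cases)
  case (1 V W)
  then have [simp]: "H.yd V" "H.yd W" by simp_all
  show ?case using generates_ind_tensor[of V W] by (auto intro!: arr_eqI)
qed

section \<open>Compatibility with the braidings\<close>

lemma H_fn_braiding:
  fixes V W :: "('g, 'k, 'x) ydo"
  assumes "H.yd V" "H.yd W" "a \<in> H" "v \<in> grade V a" "w \<in> carrier W"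
  shows "fn (braiding K GH V W) (pure K V W v w) = pure K W V (act W a w) v"
  using assms H.fn_braiding[of V W a v w] by simp

text \<open>The degree of g \<otimes> v is g a g^-1, and it acts on k \<otimes> w by left
  multiplication on \<open>k\<close>.\<close>

lemma fn_braiding_ind:
  fixes V W :: "('g, 'k, 'x) ydo"
  assumes V [simp]: "H.yd V" and W [simp]: "H.yd W" and g: "g \<in> carrier G" and k: "k \<in> carrier G"
    and a: "a \<in> H" "v \<in> grade V a" and w: "w \<in> carrier W"
  shows "fn (braiding K G (Ind V) (Ind W))
      (pure K (Ind V) (Ind W) (ipure V g v) (ipure W k w))
    = pure K (Ind W) (Ind V) (ipure W (g \<otimes> a \<otimes> inv g \<otimes> k) w) (ipure V g v)"
  using assms ind_pure_grade[OF V g a] fn_braiding[of "Ind V" "Ind W" "g \<otimes> a \<otimes> inv g" "ipure V g v" "ipure W k w"]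
  by (simp add: act_ind_pure)

text \<open>After comultiplication both factors carry \<open>g\<close>, so the braiding over the
  large group acts by g a g^-1 and yields ga \<otimes> w = g \<otimes> aw. This is what braiding
  over \<open>H\<close> before comultiplication gives.\<close>

lemma delta_braiding:
  fixes V W :: "('g, 'k, 'x) ydo"
  assumes [simp]: "H.yd V" "H.yd W"
  shows "ind_delta K G H W V \<cdot>\<^bsub>YD K G\<^esub> ind_arrow K G H (braiding K GH V W)
    = braiding K G (Ind V) (Ind W) \<cdot>\<^bsub>YD K G\<^esub> ind_delta K G H V W" (is "?L = ?R")
proof (rule arr_eqI)
  let ?A = "ipures (H.ten V W) (pures V W (homogeneous GH V) (homogeneous GH W))"
  show "generates (src ?R) ?A"
    using generates_ind_pure[OF _ H.generates_pure_homogeneous[of V W]] by simp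
  fix x assume "x \<in> ?A"
  then obtain g v w a where x: "x = ipure (H.ten V W) g (pure K V W v w)" and g: "g \<in> carrier G"
    and a: "a \<in> H" "v \<in> grade V a" and w: "w \<in> carrier W"
    by (auto simp: homogeneous_def H_grade_closed)
  have "g \<otimes> a \<otimes> inv g \<otimes> g = g \<otimes> a" using g a by (simp add: m_assoc)
  then show "fn ?L x = fn ?R x"
    using g a w by (simp add: x H_grade_closed H_fn_braiding[OF _ _ a] fn_braiding_ind[OF _ _ _ _ a] ind_pure_mult)
qed simp_all

lemma mu_braiding:
  fixes V W :: "('g, 'k, 'x) ydo"
  assumes [simp]: "H.yd V" "H.yd W"
  shows "ind_arrow K G H (braiding K GH V W) \<cdot>\<^bsub>YD K G\<^esub> ind_mu K G H V W
    = ind_mu K G H W V \<cdot>\<^bsub>YD K G\<^esub> braiding K G (Ind V) (Ind W)" (is "?L = ?R")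
proof (rule arr_eqI)
  let ?IV = "Ind V" and ?IW = "Ind W"
  let ?A = "pures ?IV ?IW (ipures V (homogeneous GH V)) (ipures W (carrier W))"
  show "generates (src ?R) ?A"
    using generates_pure[OF _ _ generates_ind_pure[OF _ H.generates_homogeneous[of V]] generates_ind_carrier[of W]] by simp
  fix x assume "x \<in> ?A"
  then obtain g v k w a where x: "x = pure K ?IV ?IW (ipure V g v) (ipure W k w)"
    and g [simp]: "g \<in> carrier G" and k [simp]: "k \<in> carrier G"
    and a: "a \<in> H" "v \<in> grade V a" and w [simp]: "w \<in> carrier W"
    by (auto simp: homogeneous_def)
  have [simp]: "a \<in> H" "v \<in> carrier V" using a by (simp_all add: H_grade_closed)
  \<comment> \<open>\<open>?l\<close> heads the factor of \<open>w\<close> after braiding over the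
    large group. The subsequent multiplication tests \<open>inv ?l \<otimes> g\<close>, the inverse
    of \<open>a \<otimes> ?h\<close>.\<close>
  let ?h = "inv g \<otimes> k" and ?l = "g \<otimes> a \<otimes> inv g \<otimes> k"
  have l: "?l \<in> carrier G" by simp
  have inv: "inv ?l \<otimes> g = inv (a \<otimes> ?h)"
    by (simp add: inv_mult_group m_assoc)
  show "fn ?L x = fn ?R x"
  proof (cases "?h \<in> H")
    case True
    \<comment> \<open>Since \<open>a \<otimes> ?h\<close> lies in \<open>H\<close>, it can be pulled
      from the leading group element onto both factors, where it cancels its inverse on
      \<open>v\<close> and leaves the action by \<open>?h\<close> and then \<open>a\<close> on
      \<open>w\<close>.\<close>
    have "?l = g \<otimes> (a \<otimes> ?h)" by (simp add: m_assoc)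
    then have "ipure (H.ten W V) ?l (pure K W V w (act V (inv (a \<otimes> ?h)) v))
      = ipure (H.ten W V) g (act (H.ten W V) (a \<otimes> ?h) (pure K W V w (act V (inv (a \<otimes> ?h)) v)))"
      using True by (simp add: ind_pure_mult)
    also have "act (H.ten W V) (a \<otimes> ?h) (pure K W V w (act V (inv (a \<otimes> ?h)) v))
      = pure K W V (act W a (act W ?h w)) v"
      using True by (simp add: H_act_mult[symmetric])
    finally show ?thesis
      using True l inv by (simp add: x H_fn_braiding[OF _ _ a] fn_braiding_ind[OF _ _ _ _ a])
  next
    case False
    \<comment> \<open>Multiplying by the element \<open>a\<close> of \<open>H\<close> and inverting
      do not affect membership, so both multiplications land in their zero branch together.\<close>
    have "inv (a \<otimes> ?h) \<notin> H"
    proof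
      assume "inv (a \<otimes> ?h) \<in> H"
      then have "inv (inv (a \<otimes> ?h)) \<in> H" by (rule H_inv)
      then show False using False by (simp add: H_mult_iff)
    qed
    then show ?thesis
      using False l inv by (simp add: x fn_braiding_ind[OF _ _ _ _ a])
  qed
qed simp_all

end

theorem propositionB1:
  fixes K :: "('k, 'r) ring_scheme" and G :: "('g, 'm) monoid_scheme" and H :: "'g set"
  assumes "field K" and "group G" and "finite (carrier G)" and "subgroup H G"
  defines "ZH \<equiv> (YD K (G\<lparr>carrier := H\<rparr>) :: ('g, 'k, 'x) yd_category)"
    and "ZG \<equiv> (YD K G :: ('g, 'k, 'x) yd_category)"
  shows "separable_frobenius_monoidal_functor ZH ZG
      (ind_yd K G H) (ind_arrow K G H) (ind_mu K G H) (ind_eta K G H) (ind_delta K G H) (ind_eps K G H)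
    \<and> (\<forall>V \<in> Obj ZH. \<forall>W \<in> Obj ZH.
        ind_delta K G H W V \<cdot>\<^bsub>ZG\<^esub> ind_arrow K G H (braiding K (G\<lparr>carrier := H\<rparr>) V W)
          = braiding K G (ind_yd K G H V) (ind_yd K G H W) \<cdot>\<^bsub>ZG\<^esub> ind_delta K G H V W
      \<and> ind_arrow K G H (braiding K (G\<lparr>carrier := H\<rparr>) V W) \<cdot>\<^bsub>ZG\<^esub> ind_mu K G H V W
          = ind_mu K G H W V \<cdot>\<^bsub>ZG\<^esub> braiding K G (ind_yd K G H V) (ind_yd K G H W))"
proof -
  interpret field K by fact
  interpret subgroup_modules K G H
    by (intro subgroup_modules.intro subgroup_modules_axioms.intro yd_modules.intro yd_modules_axioms.intro
        modules_over.intro is_cring assms)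
  show ?thesis
    unfolding ZH_def ZG_def
    by (intro conjI ballI ind_separable_frobenius delta_braiding mu_braiding) simp_all
qed

end
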